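(* Let $n\ge 3$. There exist convex bodies $K$ and $L$ in $\mathbb{R}^n$, with $\rho_K,\rho_L\in C^{\infty}(S^{n-1})$, each a body of revolution about the $x_n$-axis, such that $K$ is not centrally symmetric, $L$ is origin symmetric, and $m_K=m_L$ on $S^{n-1}$.
   Context: A convex body is a compact convex set with nonempty interior. For a body $K$ containing the origin in its interior and star-shaped with respect to it, the radial function is $\rho_K(x)=\max\{c\in\mathbb{R}: cx\in K\}$, $x\neq o$. A set $X$ is origin symmetric if $X=-X$ and centrally symmetric if it is a translate of an origin-symmetric set. The inner section function of a convex body $K$ is $m_K(u)=\max_{t\in\mathbb{R}} V(K\cap(u^{\perp}+tu))$ for $u\in S^{n-1}$, where $u^\perp$ is the hyperplane through the origin orthogonal to $u$ and $V$ denotes $(n-1)$-dimensional volume. *)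

theory Defs
  imports "HOL-Analysis.Analysis"
begin

definition convex_body :: "'a::euclidean_space set \<Rightarrow> bool" where
  "convex_body K \<longleftrightarrow> compact K \<and> convex K \<and> interior K \<noteq> {}"

definition radial_fun :: "'a::euclidean_space set \<Rightarrow> 'a \<Rightarrow> real" where
  "radial_fun K x = Sup {c. c *\<^sub>R x \<in> K}"

fun cont_diff_on :: "nat \<Rightarrow> 'a::euclidean_space set \<Rightarrow> ('a \<Rightarrow> real) \<Rightarrow> bool" where
  "cont_diff_on 0 U f = continuous_on U f"
| "cont_diff_on (Suc k) U f =
     (continuous_on U f \<and>
      (\<forall>b\<in>Basis. \<exists>g. (\<forall>x\<in>U. ((\<lambda>t. f (x + t *\<^sub>R b)) has_real_derivative g x) (at 0))
                     \<and> cont_diff_on k U g))"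

definition smooth_on :: "'a::euclidean_space set \<Rightarrow> ('a \<Rightarrow> real) \<Rightarrow> bool" where
  "smooth_on U f \<longleftrightarrow> open U \<and> (\<forall>k. cont_diff_on k U f)"

definition smooth_on_sphere :: "('a::euclidean_space \<Rightarrow> real) \<Rightarrow> bool" where
  "smooth_on_sphere f \<longleftrightarrow>
     (\<exists>U g. sphere 0 1 \<subseteq> U \<and> smooth_on U g \<and> (\<forall>x\<in>sphere 0 1. g x = f x))"

definition origin_symmetric :: "'a::real_vector set \<Rightarrow> bool" where
  "origin_symmetric X \<longleftrightarrow> X = uminus ` X"

definition centrally_symmetric :: "'a::real_vector set \<Rightarrow> bool" where
  "centrally_symmetric K \<longleftrightarrow> (\<exists>c X. origin_symmetric X \<and> K = (\<lambda>x. c + x) ` X)"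

definition body_of_revolution :: "'a::euclidean_space \<Rightarrow> 'a set \<Rightarrow> bool" where
  "body_of_revolution e K \<longleftrightarrow>
     (\<forall>T. orthogonal_transformation T \<and> T e = e \<longrightarrow> T ` K = K)"

definition hyperplane_at :: "'a::euclidean_space \<Rightarrow> real \<Rightarrow> 'a set" where
  "hyperplane_at u t = {y + t *\<^sub>R u | y. y \<bullet> u = 0}"

text \<open>(n-1)-dimensional volume of a set A lying in a hyperplane orthogonal to the
  unit vector u: the n-dimensional Lebesgue measure of the right prism of height 1
  over A in direction u (Cavalieri).\<close>
definition hyp_volume :: "'a::euclidean_space \<Rightarrow> 'a set \<Rightarrow> real" where
  "hyp_volume u A = measure lebesgue {a + s *\<^sub>R u | a s. a \<in> A \<and> s \<in> {0..1}}"

definition inner_section_fun :: "'a::euclidean_space set \<Rightarrow> 'a \<Rightarrow> real" where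
  "inner_section_fun K u = (SUP t::real. hyp_volume u (K \<inter> hyperplane_at u t))"

end

theory Submission
  imports Defs
begin

text \<open>Let d = n - 2. Up to a factor depending only on the direction, the section of a body of
  revolution by the hyperplane of slope parameter \<open>\<sigma>\<close> (the squared cotangent of the angle between the
  normal and the axis) that meets the axis at height t has the volume of
  \<open>{(z, y). \<bar>y\<bar>\<^sup>2 + \<sigma> (z - t)\<^sup>2 \<le> F z}\<close> with y ranging over \<open>\<real>\<^sup>d\<close>. In polar coordinates around
  \<open>(t, 0)\<close> this is \<open>J\<^sup>d\<close> applied to a power of the radial function, where
  \<open>(J h)(s) = \<integral> h (x\<^sup>2 + s) dx\<close>. Since \<open>J (J h)\<close> is \<open>\<pi>\<close> times the antiderivative of h that vanishes at
  infinity, \<open>J\<^sup>d\<close> is inverted by \<open>\<pi>\<^sup>-\<^sup>d J\<^sup>d (- d/ds)\<^sup>d\<close>, for even and odd d alike.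

  K is the ball slightly flattened in a band above the equator, \<open>\<bar>x\<bar>\<^sup>2 + \<epsilon> \<beta>(x\<^sub>n) \<le> 1\<close> with a bump function
  \<open>\<beta> \<ge> 0\<close>. The height of its maximal section solves an equation to which the implicit function theorem
  applies, so the maximal section volume depends smoothly on \<open>(\<sigma>, \<epsilon>)\<close> and differs from that of the ball
  only for bounded \<open>\<sigma>\<close>. Applying the inverse transform to the difference yields the radial function of
  an origin symmetric star body L whose central sections have these volumes. As everything is smooth in
  \<open>\<epsilon>\<close> and L is the ball for \<open>\<epsilon> = 0\<close>, compactness makes L convex for small \<open>\<epsilon>\<close>, and then its central
  sections are its maximal ones by the Brunn-Minkowski argument.\<close>

section \<open>Smooth functions of several variables\<close>

text \<open>Only differences from the ball are transformed as real functions. They vanish beyond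
  \<sigma> = 100, so every integral runs over one fixed bounded interval, and smooth dependence on
  parameters reduces to differentiation under the integral sign, while the ball enters through its
  closed formula. The same vanishing makes L agree with the ball near the equator, where the
  coordinate \<tau> becomes infinite and smoothness would otherwise be in doubt.

  The delicate direction is \<sigma> = 0, hyperplanes parallel to the axis. It is an endpoint of the
  geometric range, so the functions are continued to slightly negative \<sigma>, on nested ranges
  starting at -1/2, -1/4 and -1/8. Moreover the height t drops out there, which makes the equation
  for the critical height degenerate; dividing the t-derivative of the volume by \<sigma> restores a
  simple zero.

  The band starts at 1/4 and heights satisfy |t| < 1/8. Hence the part of K below the centre of the
  polar coordinates is that of the ball, and only the upper half of a section has to be
  compared.\<close>

abbreviation partial :: "('a::euclidean_space \<Rightarrow> real) \<Rightarrow> 'a \<Rightarrow> 'a \<Rightarrow> real" where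
  "partial f b x \<equiv> frechet_derivative f (at x) b"

text \<open>Frechet differentiability is demanded at every order, more than the partial derivatives
  of \<open>cont_diff_on\<close>, so that the chain rule follows by a plain induction.
  \<open>Cinf_imp_smooth_on\<close> converts to the required notion.\<close>

fun Ck :: "nat \<Rightarrow> 'a::euclidean_space set \<Rightarrow> ('a \<Rightarrow> real) \<Rightarrow> bool" where
  "Ck 0 U f = continuous_on U f"
| "Ck (Suc k) U f = ((\<forall>x\<in>U. f differentiable (at x)) \<and> (\<forall>b\<in>Basis. Ck k U (partial f b)))"

definition Cinf :: "'a::euclidean_space set \<Rightarrow> ('a \<Rightarrow> real) \<Rightarrow> bool" where
  "Cinf U f \<longleftrightarrow> open U \<and> (\<forall>k. Ck k U f)"

lemma Ck_cong:
  assumes "open U" "\<And>x. x \<in> U \<Longrightarrow> f x = g x" "Ck k U f"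
  shows "Ck k U g"
  using assms(2,3)
proof (induction k arbitrary: f g)
  case 0
  then show ?case using continuous_on_cong by force
next
  case (Suc k)
  have d: "(g has_derivative frechet_derivative f (at x)) (at x)" if "x \<in> U" for x
  proof -
    have "(f has_derivative frechet_derivative f (at x)) (at x)"
      using Suc.prems(2) that frechet_derivative_works by auto
    then show ?thesis
      by (rule has_derivative_transform_within_open[OF _ assms(1) that]) (use Suc.prems in auto)
  qed
  have e: "frechet_derivative f (at x) = frechet_derivative g (at x)" if "x \<in> U" for x
    using frechet_derivative_at[OF d[OF that]] .
  show ?case
    using d Suc.IH[of "partial f b" "partial g b" for b] Suc.prems(2) e by (auto simp: differentiable_def)
qed

text \<open>Uniqueness of the Frechet derivative allows it to be supplied in any convenient
  form.\<close>

lemma Ck_I: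
  assumes "open U" "\<And>x. x \<in> U \<Longrightarrow> (f has_derivative f' x) (at x)"
    "\<And>b. b \<in> Basis \<Longrightarrow> Ck k U (\<lambda>x. f' x b)"
  shows "Ck (Suc k) U f"
proof -
  have "f' x = frechet_derivative f (at x)" if "x \<in> U" for x
    using frechet_derivative_at[OF assms(2)[OF that]] .
  then show ?thesis
    using assms Ck_cong[OF assms(1) _ assms(3)] by (auto simp: differentiable_def)
qed

lemma Ck_D:
  assumes "Ck (Suc k) U f" "x \<in> U"
  shows "(f has_derivative frechet_derivative f (at x)) (at x)"
  using assms frechet_derivative_works by auto

lemma Ck_continuous: "Ck k U f \<Longrightarrow> continuous_on U f"
proof (cases k)
  case (Suc n)
  assume "Ck k U f"
  then have "\<forall>x\<in>U. f differentiable (at x)" using Suc by auto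
  then show ?thesis
    by (meson continuous_at_imp_continuous_on differentiable_imp_continuous_within)
qed auto

lemma Ck_SucD: "Ck (Suc k) U f \<Longrightarrow> Ck k U f"
proof (induction k arbitrary: f)
  case 0
  then show ?case using Ck_continuous[OF 0] by simp
next
  case (Suc k)
  then show ?case by auto
qed

lemma Ck_subset:
  "Ck k U f \<Longrightarrow> V \<subseteq> U \<Longrightarrow> Ck k V f"
  by (induction k arbitrary: f) (auto intro: continuous_on_subset)

lemma Ck_Union:
  assumes "\<And>V. V \<in> \<U> \<Longrightarrow> open V" "\<And>V. V \<in> \<U> \<Longrightarrow> Ck k V f"
  shows "Ck k (\<Union>\<U>) f"
  using assms(2)
  by (induction k arbitrary: f) (auto intro!: continuous_on_open_Union assms(1))

lemma Ck_const: "open U \<Longrightarrow> Ck k U (\<lambda>x. c)"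
proof (induction k arbitrary: c)
  case (Suc k)
  then show ?case by (intro Ck_I[where f'="\<lambda>x h. 0"]) auto
qed auto

lemma Ck_linear:
  assumes "open U" "bounded_linear f" shows "Ck k U f"
proof (cases k)
  case 0
  then show ?thesis using assms by (simp add: linear_continuous_on)
next
  case (Suc n)
  show ?thesis unfolding Suc
    by (intro Ck_I[where f'="\<lambda>x. f"] assms(1) Ck_const bounded_linear_imp_has_derivative assms)
qed

lemma Ck_add: "open U \<Longrightarrow> Ck k U f \<Longrightarrow> Ck k U g \<Longrightarrow> Ck k U (\<lambda>x. f x + g x)"
proof (induction k arbitrary: f g)
  case (Suc k)
  show ?case
    by (rule Ck_I[where f'="\<lambda>x h. partial f h x + partial g h x"])
      (use Suc in \<open>auto intro!: has_derivative_add simp: frechet_derivative_works[symmetric]\<close>)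
qed (auto intro: continuous_on_add)

lemma Ck_mult: "open U \<Longrightarrow> Ck k U f \<Longrightarrow> Ck k U g \<Longrightarrow> Ck k U (\<lambda>x. f x * g x)"
proof (induction k arbitrary: f g)
  case (Suc k)
  have "Ck k U f" "Ck k U g" using Suc.prems Ck_SucD by blast+
  then show ?case
    by (intro Ck_I[where f'="\<lambda>x h. f x * partial g h x + partial f h x * g x"])
      (use Suc in \<open>auto intro!: has_derivative_mult Ck_add simp: frechet_derivative_works[symmetric]\<close>)
qed (auto intro: continuous_on_mult)

lemma Ck_sum: "open U \<Longrightarrow> (\<And>i. i \<in> I \<Longrightarrow> Ck k U (f i)) \<Longrightarrow> Ck k U (\<lambda>x. \<Sum>i\<in>I. f i x)"
  by (induction I rule: infinite_finite_induct) (auto intro: Ck_const Ck_add)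

text \<open>The induction generalises over the outer function: the partials of the composition are
  sums of partials of \<open>g\<close> times partials of \<open>f\<close> composed with
  \<open>g\<close>, and the latter fall under the induction hypothesis.\<close>

lemma Ck_compose:
  fixes g :: "'a::euclidean_space \<Rightarrow> 'b::euclidean_space"
  assumes "open U" "\<And>c. c \<in> Basis \<Longrightarrow> Ck k U (\<lambda>x. g x \<bullet> c)" "Ck k V f" "g ` U \<subseteq> V"
  shows "Ck k U (\<lambda>x. f (g x))"
  using assms(2,3)
proof (induction k arbitrary: f)
  case 0
  have "continuous_on U g"
    using 0 continuous_on_componentwise[of U g] by auto
  then show ?case using 0 assms(4) continuous_on_compose2 by (metis Ck.simps(1))
next
  case (Suc k)
  have gd: "(g has_derivative (\<lambda>h. \<Sum>c\<in>Basis. partial (\<lambda>x. g x \<bullet> c) h x *\<^sub>R c)) (at x)" if "x \<in> U" for x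
    using that Ck_D[OF Suc.prems(1)]
    by (subst has_derivative_componentwise_within) (auto simp: inner_sum_left inner_Basis if_distrib cong: if_cong)
  have fd: "(f has_derivative frechet_derivative f (at (g x))) (at (g x))" if "x \<in> U" for x
    using Ck_D[OF Suc.prems(2)] assms(4) that by blast
  have lin: "partial f (\<Sum>c\<in>Basis. a c *\<^sub>R c) (g x) = (\<Sum>c\<in>Basis. a c * partial f c (g x))" if "x \<in> U" for x a
    using has_derivative_linear[OF fd[OF that]]
    by (simp add: linear_sum linear_scale)
  show ?case
  proof (rule Ck_I[OF assms(1), where f'="\<lambda>x h. \<Sum>c\<in>Basis. partial (\<lambda>x. g x \<bullet> c) h x * partial f c (g x)"])
    fix x assume "x \<in> U"
    show "((\<lambda>x. f (g x)) has_derivative (\<lambda>h. \<Sum>c\<in>Basis. partial (\<lambda>x. g x \<bullet> c) h x * partial f c (g x))) (at x)"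
      using diff_chain_at[OF gd[OF \<open>x \<in> U\<close>] fd[OF \<open>x \<in> U\<close>]] lin[OF \<open>x \<in> U\<close>]
      by (simp add: o_def)
  next
    fix b :: 'a assume "b \<in> Basis"
    then show "Ck k U (\<lambda>x. \<Sum>c\<in>Basis. partial (\<lambda>x. g x \<bullet> c) b x * partial f c (g x))"
    proof (intro Ck_sum Ck_mult assms(1))
      fix c :: 'b assume c: "c \<in> Basis"
      show "Ck k U (partial (\<lambda>x. g x \<bullet> c) b)" using Suc.prems(1)[OF c] \<open>b \<in> Basis\<close> by auto
      show "Ck k U (\<lambda>x. partial f c (g x))"
        by (rule Suc.IH) (use Suc.prems Ck_SucD c in \<open>blast, auto\<close>)
    qed
  qed
qed

section \<open>Closure properties of smooth functions\<close>

lemma Cinf_open: "Cinf U f \<Longrightarrow> open U" by (simp add: Cinf_def)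
lemma Cinf_continuous: "Cinf U f \<Longrightarrow> continuous_on U f" using Ck_continuous Cinf_def by blast
lemma Cinf_has_derivative:
  "Cinf U f \<Longrightarrow> x \<in> U \<Longrightarrow> (f has_derivative frechet_derivative f (at x)) (at x)"
  using Ck_D Cinf_def by blast
lemma Cinf_partial: "Cinf U f \<Longrightarrow> b \<in> Basis \<Longrightarrow> Cinf U (partial f b)"
  unfolding Cinf_def by (metis Ck.simps(2))
lemma Cinf_cong: "Cinf U f \<Longrightarrow> (\<And>x. x \<in> U \<Longrightarrow> f x = g x) \<Longrightarrow> Cinf U g"
  unfolding Cinf_def using Ck_cong by blast
lemma Cinf_subset: "Cinf U f \<Longrightarrow> open V \<Longrightarrow> V \<subseteq> U \<Longrightarrow> Cinf V f"
  unfolding Cinf_def using Ck_subset by blast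
lemma Cinf_Un: "Cinf U f \<Longrightarrow> Cinf V f \<Longrightarrow> Cinf (U \<union> V) f"
  unfolding Cinf_def using Ck_Union[of "{U,V}"] by auto
lemma Cinf_const: "open U \<Longrightarrow> Cinf U (\<lambda>x. c)" by (simp add: Cinf_def Ck_const)
lemma Cinf_linear: "open U \<Longrightarrow> bounded_linear f \<Longrightarrow> Cinf U f" by (simp add: Cinf_def Ck_linear)
lemma Cinf_add: "Cinf U f \<Longrightarrow> Cinf U g \<Longrightarrow> Cinf U (\<lambda>x. f x + g x)" by (simp add: Cinf_def Ck_add)
lemma Cinf_mult: "Cinf U f \<Longrightarrow> Cinf U g \<Longrightarrow> Cinf U (\<lambda>x. f x * g x)" by (simp add: Cinf_def Ck_mult)
lemma Cinf_minus: "Cinf U f \<Longrightarrow> Cinf U (\<lambda>x. - f x)"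
  using Cinf_mult[OF Cinf_const, of U f "-1"] Cinf_open by auto
lemma Cinf_diff: "Cinf U f \<Longrightarrow> Cinf U g \<Longrightarrow> Cinf U (\<lambda>x. f x - g x)"
  using Cinf_add[OF _ Cinf_minus, of U f g] by simp
lemma Cinf_power: "Cinf U f \<Longrightarrow> Cinf U (\<lambda>x. f x ^ n)"
  by (induction n) (auto intro: Cinf_mult Cinf_const Cinf_open)
lemma Cinf_sum: "open U \<Longrightarrow> (\<And>i. i \<in> I \<Longrightarrow> Cinf U (f i)) \<Longrightarrow> Cinf U (\<lambda>x. \<Sum>i\<in>I. f i x)"
  unfolding Cinf_def by (auto intro!: Ck_sum)
lemma Cinf_compose:
  fixes g :: "'a::euclidean_space \<Rightarrow> 'b::euclidean_space"
  assumes "Cinf V f" "open U" "\<And>c. c \<in> Basis \<Longrightarrow> Cinf U (\<lambda>x. g x \<bullet> c)" "g ` U \<subseteq> V"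
  shows "Cinf U (\<lambda>x. f (g x))"
  using assms(1,2,4) Ck_compose[OF assms(2) _ _ assms(4)] assms(3) unfolding Cinf_def by presburger

lemma Cinf_compose_real:
  fixes g :: "'a::euclidean_space \<Rightarrow> real"
  assumes "Cinf V f" "Cinf U g" "g ` U \<subseteq> V"
  shows "Cinf U (\<lambda>x. f (g x))"
  using assms(2) by (intro Cinf_compose[OF assms(1) Cinf_open[OF assms(2)] _ assms(3)]) simp

lemma Cinf_compose_Pair:
  fixes g :: "'a::euclidean_space \<Rightarrow> 'b::euclidean_space" and h :: "'a \<Rightarrow> 'c::euclidean_space"
  assumes "Cinf V f" "open U" "\<And>c. c \<in> Basis \<Longrightarrow> Cinf U (\<lambda>x. g x \<bullet> c)"
    "\<And>c. c \<in> Basis \<Longrightarrow> Cinf U (\<lambda>x. h x \<bullet> c)" "\<And>x. x \<in> U \<Longrightarrow> (g x, h x) \<in> V"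
  shows "Cinf U (\<lambda>x. f (g x, h x))"
  by (rule Cinf_compose[OF assms(1,2)]) (use assms in \<open>auto simp: Basis_prod_def\<close>)

text \<open>In one variable it is enough to exhibit the whole sequence of derivatives; the induction
  on the order runs over all members of the sequence at once.\<close>

lemma Cinf_real_I:
  fixes f :: "real \<Rightarrow> real"
  assumes "open U" "\<And>k x. x \<in> U \<Longrightarrow> (g k has_real_derivative g (Suc k) x) (at x)"
  shows "Cinf U (g 0)"
proof -
  have "Ck k U (g n)" for k n
  proof (induction k arbitrary: n)
    case 0
    then show ?case using assms(2) by (auto intro!: continuous_at_imp_continuous_on DERIV_isCont)
  next
    case (Suc k)
    then show ?case
      using assms by (intro Ck_I[where f'="\<lambda>x h. g (Suc n) x * h"]) (auto simp: has_field_derivative_def)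
  qed
  then show ?thesis using assms(1) by (simp add: Cinf_def)
qed

lemma Cinf_powr: "Cinf {0<..} (\<lambda>x::real. x powr a)"
proof -
  define g where "g k x = (\<Prod>i<k. a - real i) * x powr (a - real k)" for k and x :: real
  have "(g k has_real_derivative g (Suc k) x) (at x)" if "x \<in> {0<..}" for k x
    unfolding g_def using that
    by (auto intro!: derivative_eq_intros simp: algebra_simps)
  then have "Cinf {0<..} (g 0)" by (intro Cinf_real_I) auto
  then show ?thesis by (simp add: g_def[abs_def])
qed

lemma Cinf_powr_compose: "Cinf U g \<Longrightarrow> (\<And>x. x \<in> U \<Longrightarrow> g x > 0) \<Longrightarrow> Cinf U (\<lambda>x. g x powr a)"
  by (rule Cinf_compose_real[OF Cinf_powr]) auto

lemma Cinf_inverse: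
  assumes "Cinf U g" "\<And>x. x \<in> U \<Longrightarrow> g x \<noteq> 0"
  shows "Cinf U (\<lambda>x. inverse (g x))"
proof -
  \<comment> \<open>Squaring moves negative values of \<open>g\<close> into the positive half-line,
    where powers are smooth.\<close>
  have "Cinf U (\<lambda>x. g x * (g x ^ 2) powr (-1))"
    by (intro Cinf_mult assms Cinf_powr_compose Cinf_power) (use assms in auto)
  then show ?thesis
    by (rule Cinf_cong) (use assms(2) in \<open>auto simp: powr_minus power2_eq_square divide_simps\<close>)
qed

lemma Cinf_divide:
  "Cinf U f \<Longrightarrow> Cinf U g \<Longrightarrow> (\<And>x. x \<in> U \<Longrightarrow> g x \<noteq> 0) \<Longrightarrow> Cinf U (\<lambda>x. f x / g x)"
  unfolding divide_inverse by (intro Cinf_mult Cinf_inverse)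

lemma Cinf_imp_smooth_on:
  assumes "Cinf U f" shows "smooth_on U f"
proof -
  have "Ck k U f \<Longrightarrow> cont_diff_on k U f" for k
  proof (induction k arbitrary: f)
    case (Suc k)
    have "((\<lambda>t. f (x + t *\<^sub>R b)) has_real_derivative partial f b x) (at 0)" if "x \<in> U" for x b
    proof -
      have f: "(f has_derivative frechet_derivative f (at x)) (at x)" using Ck_D[OF Suc.prems that] .
      have "((\<lambda>t. f (x + t *\<^sub>R b)) has_derivative (\<lambda>t. frechet_derivative f (at x) (t *\<^sub>R b))) (at 0)"
        by (rule has_derivative_compose[of "\<lambda>t. x + t *\<^sub>R b", simplified o_def])
          (use f in \<open>auto intro!: derivative_eq_intros\<close>)
      moreover have "frechet_derivative f (at x) (t *\<^sub>R b) = partial f b x * t" for t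
        using has_derivative_linear[OF f] by (simp add: linear_scale)
      ultimately show ?thesis by (simp add: has_field_derivative_def)
    qed
    then show ?case
      using Suc.IH[of "partial f b" for b] Suc.prems Ck_continuous[OF Suc.prems] by fastforce
  qed auto
  then show ?thesis using assms by (auto simp: Cinf_def smooth_on_def)
qed

section \<open>Parameter integrals and implicit functions\<close>

text \<open>The Leibniz rule works with integrands valued in bounded linear maps. Expanding these in
  the coordinate functionals turns the derivative of the integral into integrals of partial
  derivatives, the form in which an induction on the order can proceed.\<close>

lemma integral_has_derivative_param:
  fixes g :: "'a::euclidean_space \<times> real \<Rightarrow> real"
  assumes "open W" "Ck (Suc 0) W g" "\<And>s. s \<in> {a..b} \<Longrightarrow> (x, s) \<in> W" "open U" "x \<in> U"
    "\<And>x s. x \<in> U \<Longrightarrow> s \<in> {a..b} \<Longrightarrow> (x, s) \<in> W"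
  shows "((\<lambda>x. integral {a..b} (\<lambda>s. g (x, s))) has_derivative
    (\<lambda>h. \<Sum>c\<in>Basis. (h \<bullet> c) * integral {a..b} (\<lambda>s. partial g (c, 0) (x, s)))) (at x)"
proof -
  obtain r where r: "r > 0" "ball x r \<subseteq> U" using assms(4,5) openE by blast
  define fx :: "'a \<Rightarrow> real \<Rightarrow> 'a \<Rightarrow>\<^sub>L real" where
    "fx x s = (\<Sum>c\<in>Basis. partial g (c, 0) (x, s) *\<^sub>R blinfun_inner_left c)" for x s
  have fxa: "blinfun_apply (fx x s) h = (\<Sum>c\<in>Basis. partial g (c, 0) (x, s) * (h \<bullet> c))" for x s h
    by (simp add: fx_def blinfun.sum_left blinfun.scaleR_left inner_commute)
  have gd: "((\<lambda>x. g (x, s)) has_derivative blinfun_apply (fx x s)) (at x)" if "(x, s) \<in> W" for x s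
  proof -
    have D: "(g has_derivative frechet_derivative g (at (x, s))) (at (x, s))"
      using Ck_D[OF assms(2) that] .
    have "((\<lambda>x. g (x, s)) has_derivative (\<lambda>h. frechet_derivative g (at (x, s)) (h, 0))) (at x)"
      using has_derivative_compose[OF has_derivative_Pair[OF has_derivative_ident has_derivative_const] D] .
    moreover have "frechet_derivative g (at (x, s)) (h, 0) = blinfun_apply (fx x s) h" for h
    proof -
      have lin: "linear (\<lambda>h. frechet_derivative g (at (x, s)) (h, 0))"
        using linear_compose[OF _ has_derivative_linear[OF D], of "\<lambda>h. (h, 0)"]
        by (simp add: linear_iff o_def)
      have "frechet_derivative g (at (x, s)) (\<Sum>c\<in>Basis. (h \<bullet> c) *\<^sub>R c, 0) = (\<Sum>c\<in>Basis. (h \<bullet> c) * partial g (c, 0) (x, s))"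
        using linear_sum[OF lin, of "\<lambda>c. (h \<bullet> c) *\<^sub>R c" Basis] linear_scale[OF lin] by simp
      then show ?thesis by (simp add: fxa euclidean_representation mult.commute)
    qed
    ultimately show ?thesis by simp
  qed
  have cpd: "continuous_on W (partial g (c, 0))" if "c \<in> Basis" for c
    using assms(2) that by (auto simp: Basis_prod_def)
  have cg: "continuous_on W g" using Ck_continuous[OF assms(2)] .
  have sub: "ball x r \<times> cbox a b \<subseteq> W" using r assms(6) by auto
  have cfx: "continuous_on (ball x r \<times> cbox a b) (\<lambda>(x, t). fx x t)"
    unfolding fx_def split_beta
    by (intro continuous_intros) (use continuous_on_subset[OF cpd sub] in auto)
  have D: "((\<lambda>x. integral (cbox a b) (\<lambda>s. g (x, s))) has_derivative
    blinfun_apply (integral (cbox a b) (fx x))) (at x within ball x r)"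
  proof (rule leibniz_rule[OF _ _ cfx])
    fix y t assume "y \<in> ball x r" "t \<in> cbox a b"
    then show "((\<lambda>x. g (x, t)) has_derivative blinfun_apply (fx y t)) (at y within ball x r)"
      by (metis (no_types, lifting) SigmaI gd has_derivative_at_withinI sub subsetD)
  next
    fix y assume "y \<in> ball x r"
    then show "(\<lambda>s. g (y, s)) integrable_on cbox a b"
      by (intro integrable_continuous continuous_on_compose2[OF cg] continuous_intros) (use sub in auto)
  qed (use r in auto)
  have i1: "fx x integrable_on cbox a b"
    using r by (intro integrable_continuous continuous_on_compose2[OF cfx, of _ "\<lambda>s. (x, s)", simplified] continuous_intros) auto
  have i2: "(\<lambda>s. partial g (c, 0) (x, s)) integrable_on cbox a b" if "c \<in> Basis" for c
    by (intro integrable_continuous continuous_on_compose2[OF cpd[OF that]] continuous_intros) (use sub r in auto)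
  have "blinfun_apply (integral (cbox a b) (fx x)) h = (\<Sum>c\<in>Basis. (h \<bullet> c) * integral {a..b} (\<lambda>s. partial g (c, 0) (x, s)))" for h
  proof -
    have i3: "(\<lambda>s. (h \<bullet> c) * partial g (c, 0) (x, s)) integrable_on {a..b}" if "c \<in> Basis" for c
      using integrable_on_cmult_left[OF i2[OF that, unfolded cbox_interval], of "h \<bullet> c"] by simp
    show ?thesis
    proof -
      have "blinfun_apply (integral (cbox a b) (fx x)) h = integral (cbox a b) (\<lambda>s. blinfun_apply (fx x s) h)"
        by (rule blinfun_apply_integral[OF i1])
      also have "\<dots> = integral {a..b} (\<lambda>s. \<Sum>c\<in>Basis. (h \<bullet> c) * partial g (c, 0) (x, s))"
        unfolding fxa by (simp add: mult.commute)
      also have "\<dots> = (\<Sum>c\<in>Basis. integral {a..b} (\<lambda>s. (h \<bullet> c) * partial g (c, 0) (x, s)))"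
        by (rule integral_sum) (use i3 in auto)
      finally show ?thesis by simp
    qed
  qed
  then have eq: "blinfun_apply (integral (cbox a b) (fx x)) =
      (\<lambda>h. \<Sum>c\<in>Basis. (h \<bullet> c) * integral {a..b} (\<lambda>s. partial g (c, 0) (x, s)))"
    by (rule ext)
  have "at x within ball x r = at x" using r by (intro at_within_open) auto
  from D[unfolded this, unfolded eq, unfolded cbox_interval] show ?thesis .
qed

lemma Cinf_integral:
  fixes g :: "'a::euclidean_space \<times> real \<Rightarrow> real"
  assumes "Cinf W g" "open U" "\<And>x s. x \<in> U \<Longrightarrow> s \<in> {a..b} \<Longrightarrow> (x, s) \<in> W"
  shows "Cinf U (\<lambda>x. integral {a..b} (\<lambda>s. g (x, s)))"
proof -
  have W: "open W" using assms(1) Cinf_open by blast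
  \<comment> \<open>All orders of \<open>g\<close> are assumed at every stage: even continuity of
    the integral is read off from its differentiability, which already uses one derivative of
    \<open>g\<close>.\<close>
  have "Ck k U (\<lambda>x. integral {a..b} (\<lambda>s. g (x, s)))" if "\<And>k. Ck k W g" for k
    using that
  proof (induction k arbitrary: g)
    case 0
    have "(\<lambda>x. integral {a..b} (\<lambda>s. g (x, s))) differentiable at x" if "x \<in> U" for x
      unfolding differentiable_def
      using integral_has_derivative_param[OF W 0 _ assms(2) that, of a b] assms(3) that by blast
    then have "continuous_on U (\<lambda>x. integral {a..b} (\<lambda>s. g (x, s)))"
      by (meson continuous_at_imp_continuous_on differentiable_imp_continuous_within)
    then show ?case by simp
  next
    case (Suc k)
    show ?case
    proof (rule Ck_I[OF assms(2)])
      fix x assume x: "x \<in> U"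
      show "((\<lambda>x. integral {a..b} (\<lambda>s. g (x, s))) has_derivative
         (\<lambda>h. \<Sum>c\<in>Basis. (h \<bullet> c) * integral {a..b} (\<lambda>s. partial g (c, 0) (x, s)))) (at x)"
        using integral_has_derivative_param[OF W Suc.prems _ assms(2) x, of a b] assms(3) x by blast
    next
      fix b' :: 'a assume b': "b' \<in> Basis"
      have "Ck k' W (partial g (b', 0))" for k'
        using Suc.prems[of "Suc k'"] b' by (auto simp: Basis_prod_def)
      from Suc.IH[OF this]
      show "Ck k U (\<lambda>x. \<Sum>c\<in>Basis. (b' \<bullet> c) * integral {a..b} (\<lambda>s. partial g (c, 0) (x, s)))"
        using b' by (simp add: inner_Basis if_distrib[of "\<lambda>x. x * _"] cong: if_cong)
    qed
  qed
  then show ?thesis using assms unfolding Cinf_def by blast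
qed

text \<open>Expanding H at the point gives |A dx + c dy| \<le> e1 (|dx| + |dy|). For e1 at most
  |c|/2 the dy on the right can be absorbed, so |dy| \<le> K |dx|, and feeding this back makes the
  error o(|dx|). Continuity of y is what brings dy into the range of the expansion.\<close>

lemma implicit_has_derivative:
  fixes H :: "'a::euclidean_space \<times> real \<Rightarrow> real"
  assumes D: "(H has_derivative D) (at (x0, y x0))" and "open U" "x0 \<in> U"
    and root: "\<And>x. x \<in> U \<Longrightarrow> H (x, y x) = 0"
    and cont: "continuous (at x0) y" and nz: "D (0, 1) \<noteq> 0"
  shows "(y has_derivative (\<lambda>h. - D (h, 0) / D (0, 1))) (at x0)"
proof -
  define c where "c = D (0, 1)"
  define A where "A h = D (h, 0)" for h
  have bl: "bounded_linear D" using D has_derivative_bounded_linear by blast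
  have blA: "bounded_linear A"
    unfolding A_def by (rule bounded_linear_compose[OF bl]) (intro bounded_linear_intros)
  then obtain M where M: "M > 0" "\<And>h. norm (A h) \<le> norm h * M"
    using bounded_linear.pos_bounded by blast
  have Dsplit: "D (h, s) = A h + c * s" for h s
  proof -
    have "D (h, s) = D ((h, 0) + s *\<^sub>R (0, 1))" by simp
    also have "\<dots> = A h + c * s"
      using bl by (simp only: linear_add linear_scale bounded_linear.linear A_def c_def) simp
    finally show ?thesis .
  qed
  have c: "c \<noteq> 0" using nz c_def by simp
  define L where "L h = - A h / c" for h
  have "(y has_derivative L) (at x0)"
    unfolding has_derivative_within_alt
  proof (intro conjI allI impI)
    show "bounded_linear L"
      unfolding L_def using bounded_linear_const_mult[OF blA, of "-inverse c"] by (simp add: divide_inverse mult.commute)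
  next
    fix e :: real assume e: "e > 0"
    define K where "K = 2 * M / \<bar>c\<bar> + 2"
    have K: "K > 0" unfolding K_def using M c by (intro add_nonneg_pos divide_nonneg_pos) auto
    \<comment> \<open>The first bound absorbs dy; the second makes e1 (1 + K) |dx| / |c| at most e
      |dx|.\<close>
    define e1 where "e1 = min (\<bar>c\<bar> / 2) (e * \<bar>c\<bar> / (1 + K))"
    have e1: "e1 > 0" using e c K by (simp add: e1_def)
    obtain d where d: "d > 0" "\<And>z. norm (z - (x0, y x0)) < d \<Longrightarrow>
        norm (H z - H (x0, y x0) - D (z - (x0, y x0))) \<le> e1 * norm (z - (x0, y x0))"
      using D e1 unfolding has_derivative_within_alt by auto
    obtain d1 where d1: "d1 > 0" "\<And>x. norm (x - x0) < d1 \<Longrightarrow> \<bar>y x - y x0\<bar> < d / 2"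
      using cont d(1) unfolding continuous_at_eps_delta by (metis dist_norm half_gt_zero real_norm_def)
    obtain d2 where d2: "d2 > 0" "ball x0 d2 \<subseteq> U" using assms openE by blast
    show "\<exists>d>0. \<forall>x\<in>UNIV. norm (x - x0) < d \<longrightarrow> norm (y x - y x0 - L (x - x0)) \<le> e * norm (x - x0)"
    proof (intro exI[of _ "min (d / 2) (min d1 d2)"] conjI ballI impI)
      show "0 < min (d / 2) (min d1 d2)" using d d1 d2 by auto
      fix x assume x: "norm (x - x0) < min (d / 2) (min d1 d2)"
      define dx where "dx = x - x0"
      define dy where "dy = y x - y x0"
      have z: "(x, y x) - (x0, y x0) = (dx, dy)" by (simp add: dx_def dy_def)
      have nz: "norm (dx, dy) \<le> norm dx + \<bar>dy\<bar>" using norm_Pair_le[of dx dy] by simp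
      have "norm (dx, dy) < d"
        using nz x d1(2)[of x] by (auto simp: dx_def dy_def)
      then have "norm (H (x, y x) - H (x0, y x0) - D (dx, dy)) \<le> e1 * norm (dx, dy)"
        using d(2)[of "(x, y x)"] z by simp
      moreover have "x \<in> U" using x d2 by (auto simp: dist_norm norm_minus_commute)
      ultimately have "\<bar>A dx + c * dy\<bar> \<le> e1 * norm (dx, dy)"
        using root assms(3) by (simp add: Dsplit)
      also have "\<dots> \<le> e1 * (norm dx + \<bar>dy\<bar>)" using nz e1 by simp
      finally have 1: "\<bar>A dx + c * dy\<bar> \<le> e1 * (norm dx + \<bar>dy\<bar>)" .
      have eq: "dy - L dx = (A dx + c * dy) / c" using c by (simp add: L_def field_simps)
      have "\<bar>c\<bar> * \<bar>dy\<bar> \<le> \<bar>A dx + c * dy\<bar> + \<bar>A dx\<bar>"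
        by (simp add: abs_mult[symmetric])
      also have "\<dots> \<le> (\<bar>c\<bar> / 2) * (norm dx + \<bar>dy\<bar>) + norm dx * M"
      proof -
        have "e1 * (norm dx + \<bar>dy\<bar>) \<le> (\<bar>c\<bar> / 2) * (norm dx + \<bar>dy\<bar>)"
          unfolding e1_def by (intro mult_right_mono min.cobounded1) auto
        then show ?thesis using 1 M(2)[of dx] by simp
      qed
      finally have "\<bar>c\<bar> * \<bar>dy\<bar> \<le> \<bar>c\<bar> * norm dx + 2 * M * norm dx"
        unfolding distrib_left by (simp add: field_simps)
      then have "\<bar>dy\<bar> \<le> K * norm dx"
      proof -
        have "\<bar>dy\<bar> \<le> (\<bar>c\<bar> * norm dx + 2 * M * norm dx) / \<bar>c\<bar>"
          using \<open>\<bar>c\<bar> * \<bar>dy\<bar> \<le> \<bar>c\<bar> * norm dx + 2 * M * norm dx\<close> c by (simp add: pos_le_divide_eq mult.commute)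
        also have "\<dots> = K * norm dx - norm dx" using c by (simp add: K_def field_simps)
        finally show ?thesis using norm_ge_zero[of dx] by linarith
      qed
      then have "\<bar>A dx + c * dy\<bar> \<le> e1 * ((1 + K) * norm dx)"
        by (intro order_trans[OF 1] mult_left_mono) (use e1 in \<open>auto simp: distrib_right\<close>)
      also have "\<dots> \<le> (e * \<bar>c\<bar> / (1 + K)) * ((1 + K) * norm dx)"
        using K by (intro mult_right_mono) (auto simp: e1_def)
      also have "\<dots> = e * \<bar>c\<bar> * norm dx" using K by simp
      finally have "\<bar>dy - L dx\<bar> \<le> e * norm dx" using c by (simp add: eq field_simps)
      then show "norm (y x - y x0 - L (x - x0)) \<le> e * norm (x - x0)" by (simp add: dx_def dy_def)
    qed
  qed
  then show ?thesis unfolding L_def A_def c_def .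
qed

text \<open>Bootstrapping: if y has order k, so has the formula for its derivative, being built from
  y and the smooth partials of H by composition and division; hence y has order k + 1.\<close>

lemma implicit_Cinf:
  fixes H :: "'a::euclidean_space \<times> real \<Rightarrow> real"
  assumes H: "Cinf W H" and "open U" "\<And>x. x \<in> U \<Longrightarrow> (x, y x) \<in> W"
    and root: "\<And>x. x \<in> U \<Longrightarrow> H (x, y x) = 0"
    and cont: "continuous_on U y"
    and nz: "\<And>x. x \<in> U \<Longrightarrow> partial H (0, 1) (x, y x) \<noteq> 0"
  shows "Cinf U y"
proof -
  have "Ck k U y" for k
  proof (induction k)
    case 0
    then show ?case using cont by simp
  next
    case (Suc k)
    have y: "Ck k U (\<lambda>x. (x, y x) \<bullet> c)" if "c \<in> Basis" for c
      using that Suc Ck_linear[OF \<open>open U\<close> bounded_linear_inner_left] by (auto simp: Basis_prod_def)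
    have pdk: "Ck k U (\<lambda>x. partial H b (x, y x))" if "b \<in> Basis" for b
      by (rule Ck_compose[OF \<open>open U\<close> y, where V=W]) (use Cinf_partial[OF H that] assms(3) in \<open>auto simp: Cinf_def\<close>)
    show ?case
    proof (rule Ck_I[OF \<open>open U\<close>])
      fix x assume x: "x \<in> U"
      show "(y has_derivative (\<lambda>h. - partial H (h, 0) (x, y x) / partial H (0, 1) (x, y x))) (at x)"
        using implicit_has_derivative[OF Cinf_has_derivative[OF H assms(3)[OF x]] \<open>open U\<close> x root _ nz[OF x]]
          cont x \<open>open U\<close> continuous_on_eq_continuous_at by blast
    next
      fix b :: 'a assume b: "b \<in> Basis"
      have i: "Cinf (-{0}) (\<lambda>x::real. inverse x)"
        by (rule Cinf_inverse[OF Cinf_linear]) (auto intro: bounded_linear_ident)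
      have "Ck k U (\<lambda>x. inverse (partial H (0, 1) (x, y x)))"
        by (rule Ck_compose[OF \<open>open U\<close>, where V="-{0}"])
          (use nz i pdk[of "(0,1)"] in \<open>auto simp: Cinf_def Basis_prod_def\<close>)
      moreover have "Ck k U (\<lambda>x. (-1) * partial H (b, 0) (x, y x))"
        using pdk[of "(b, 0)"] b by (intro Ck_mult Ck_const \<open>open U\<close>) (auto simp: Basis_prod_def)
      ultimately show "Ck k U (\<lambda>x. - partial H (b, 0) (x, y x) / partial H (0, 1) (x, y x))"
        unfolding divide_inverse using Ck_mult[OF \<open>open U\<close>] by fastforce
    qed
  qed
  then show ?thesis using \<open>open U\<close> Cinf_def by blast
qed

text \<open>A sign change pins the root down: at s slightly below \<open>y x0\<close> the value of H
  stays negative for x near x0, so \<open>y x\<close> cannot lie below s, and likewise above. Roots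
  chosen pointwise thus depend continuously on x.\<close>

lemma implicit_continuous:
  fixes H :: "'a::t2_space \<times> real \<Rightarrow> real"
  assumes H: "continuous_on (U \<times> {a<..<b}) H" and "open U"
    and y: "\<And>x. x \<in> U \<Longrightarrow> y x \<in> {a<..<b}"
    and neg: "\<And>x s. x \<in> U \<Longrightarrow> a < s \<Longrightarrow> s < y x \<Longrightarrow> H (x, s) < 0"
    and pos: "\<And>x s. x \<in> U \<Longrightarrow> y x < s \<Longrightarrow> s < b \<Longrightarrow> H (x, s) > 0"
  shows "continuous_on U y"
proof -
  have c: "isCont (\<lambda>x. H (x, s)) x0" if "x0 \<in> U" "s \<in> {a<..<b}" for x0 s
  proof -
    have "continuous_on U (\<lambda>x. H (x, s))"
      by (intro continuous_on_compose2[OF H] continuous_intros) (use that in auto)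
    then show ?thesis using \<open>open U\<close> that continuous_on_eq_continuous_at by blast
  qed
  have "isCont y x0" if x0: "x0 \<in> U" for x0
    unfolding isCont_def
  proof (rule order_tendstoI)
    fix l assume l: "l < y x0"
    define s where "s = max ((a + y x0) / 2) ((l + y x0) / 2)"
    have s: "a < s" "s < y x0" "l < s" "s \<in> {a<..<b}" using y[OF x0] l by (auto simp: s_def less_max_iff_disj)
    have "eventually (\<lambda>x. H (x, s) < 0) (at x0)"
      using c[OF x0 s(4)] neg[OF x0 s(1,2)] unfolding isCont_def by (rule order_tendstoD)
    moreover have "eventually (\<lambda>x. x \<in> U) (at x0)" using \<open>open U\<close> x0 eventually_at_topological by blast
    ultimately show "eventually (\<lambda>x. l < y x) (at x0)"
    proof eventually_elim
      case (elim x)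
      then show ?case using pos[of x s] s by (cases "y x < s") auto
    qed
  next
    fix l assume l: "y x0 < l"
    define s where "s = min ((b + y x0) / 2) ((l + y x0) / 2)"
    have s: "y x0 < s" "s < b" "s < l" "s \<in> {a<..<b}" using y[OF x0] l by (auto simp: s_def min_less_iff_disj)
    have "eventually (\<lambda>x. H (x, s) > 0) (at x0)"
      using c[OF x0 s(4)] pos[OF x0 s(1,2)] unfolding isCont_def by (rule order_tendstoD)
    moreover have "eventually (\<lambda>x. x \<in> U) (at x0)" using \<open>open U\<close> x0 eventually_at_topological by blast
    ultimately show "eventually (\<lambda>x. y x < l) (at x0)"
    proof eventually_elim
      case (elim x)
      then show ?case using neg[of x s] s by (cases "s < y x") auto
    qed
  qed
  then show ?thesis by (simp add: continuous_at_imp_continuous_on)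
qed

lemma implicit_Cinf_sign:
  fixes H :: "'a::euclidean_space \<times> real \<Rightarrow> real"
  assumes H: "Cinf (U \<times> {a<..<b}) H" and "open U"
    and y: "\<And>x. x \<in> U \<Longrightarrow> y x \<in> {a<..<b}"
    and neg: "\<And>x s. x \<in> U \<Longrightarrow> a < s \<Longrightarrow> s < y x \<Longrightarrow> H (x, s) < 0"
    and pos: "\<And>x s. x \<in> U \<Longrightarrow> y x < s \<Longrightarrow> s < b \<Longrightarrow> H (x, s) > 0"
    and root: "\<And>x. x \<in> U \<Longrightarrow> H (x, y x) = 0"
    and nz: "\<And>x. x \<in> U \<Longrightarrow> partial H (0, 1) (x, y x) \<noteq> 0"
  shows "Cinf U y"
  using y by (intro implicit_Cinf[OF H \<open>open U\<close> _ root _ nz]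
      implicit_continuous[OF Cinf_continuous[OF H] \<open>open U\<close> y neg pos]) auto

text \<open>The tube lemma. It supplies the non-explicit smallness conditions below: what holds on a
  compact set for the ball persists for all small parameters.\<close>

lemma tube_positive:
  fixes f :: "'a::metric_space \<times> 'b::metric_space \<Rightarrow> real"
  assumes "compact C" "open W" "continuous_on W f" "\<And>x. x \<in> C \<Longrightarrow> (x, y0) \<in> W \<and> f (x, y0) > 0"
  shows "\<exists>d>0. \<forall>x\<in>C. \<forall>y. dist y y0 < d \<longrightarrow> (x, y) \<in> W \<and> f (x, y) > 0"
proof -
  have "open (W \<inter> f -` {0<..})" using assms by (intro continuous_open_preimage) auto
  then have "\<forall>x\<in>C. \<exists>A d. open A \<and> x \<in> A \<and> d > 0 \<and> A \<times> ball y0 d \<subseteq> W \<inter> f -` {0<..}"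
  proof (intro ballI)
    fix x assume "x \<in> C"
    then have "(x, y0) \<in> W \<inter> f -` {0<..}" using assms(4) by auto
    then obtain A B where AB: "open A" "open B" "x \<in> A" "y0 \<in> B" "A \<times> B \<subseteq> W \<inter> f -` {0<..}"
      using open_prod_elim[OF \<open>open (W \<inter> f -` {0<..})\<close>] by (metis SigmaE2)
    obtain d where "d > 0" "ball y0 d \<subseteq> B" using AB openE by blast
    then show "\<exists>A d. open A \<and> x \<in> A \<and> d > 0 \<and> A \<times> ball y0 d \<subseteq> W \<inter> f -` {0<..}"
      using AB by blast
  qed
  then obtain A d where Ad: "\<And>x. x \<in> C \<Longrightarrow> open (A x) \<and> x \<in> A x \<and> (d x :: real) > 0 \<and> A x \<times> ball y0 (d x) \<subseteq> W \<inter> f -` {0<..}"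
    by metis
  obtain C' where C': "C' \<subseteq> C" "finite C'" "C \<subseteq> \<Union>(A ` C')"
    using compactE_image[OF assms(1), of C A] Ad by (metis UN_I subsetI)
  define e where "e = Min (insert 1 (d ` C'))"
  have "e > 0" using C' Ad by (auto simp: e_def)
  moreover have "(x, y) \<in> W \<and> f (x, y) > 0" if "x \<in> C" "dist y y0 < e" for x y
  proof -
    obtain x' where x': "x' \<in> C'" "x \<in> A x'" using C' \<open>x \<in> C\<close> by blast
    then have "e \<le> d x'" using C' by (simp add: e_def)
    then show ?thesis using Ad[of x'] x' C' that by (auto simp: dist_commute subset_iff)
  qed
  ultimately show ?thesis by blast
qed

section \<open>A smooth bump function\<close>

text \<open>This class of functions is closed under differentiation.\<close>

definition flat :: "real poly \<Rightarrow> real \<Rightarrow> real" where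
  "flat p x = (if x \<le> 0 then 0 else poly p (1 / x) * exp (- 1 / x))"

lemma flat_lim: "((\<lambda>x. poly p (1 / x) * exp (- 1 / x)) \<longlongrightarrow> 0) (at_right (0::real))"
proof -
  have "((\<lambda>y. poly p y * exp (- y)) \<longlongrightarrow> 0) at_top"
  proof -
    have "((\<lambda>y. \<Sum>i\<le>degree p. coeff p i * (y ^ i / exp y)) \<longlongrightarrow> (\<Sum>i\<le>degree p. coeff p i * 0)) at_top"
      by (intro tendsto_intros tendsto_power_div_exp_0)
    then show ?thesis
      by (simp add: poly_altdef sum_distrib_right exp_minus field_simps sum_divide_distrib)
  qed
  then have "((\<lambda>x. poly p (inverse x) * exp (- inverse x)) \<longlongrightarrow> 0) (at_right (0::real))"
    using filterlim_compose filterlim_inverse_at_top_right by blast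
  then show ?thesis by (simp add: inverse_eq_divide)
qed

text \<open>The difference quotient at 0 is of the same form, with p multiplied by its variable, so
  \<open>flat_lim\<close> applies on the right.\<close>

lemma flat_deriv_0: "(flat p has_real_derivative 0) (at 0)"
proof -
  have "((\<lambda>x. flat p x / x) \<longlongrightarrow> 0) (at_right 0)"
  proof (rule Lim_transform_eventually[OF flat_lim[of "pCons 0 p"]])
    show "\<forall>\<^sub>F x in at_right 0. poly (pCons 0 p) (1 / x) * exp (- 1 / x) = flat p x / x"
      by (auto simp: flat_def eventually_at_right[of 0 1] intro!: exI[of _ 1])
  qed
  moreover have "((\<lambda>x. flat p x / x) \<longlongrightarrow> 0) (at_left 0)"
    by (rule Lim_transform_eventually[OF tendsto_const[of 0]])
      (auto simp: flat_def eventually_at_left[of "-1" 0] intro!: exI[of _ "-1"])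
  ultimately have "((\<lambda>x. flat p x / x) \<longlongrightarrow> 0) (at 0)"
    using filterlim_split_at by blast
  then show ?thesis
    by (simp add: has_field_derivative_iff flat_def)
qed

text \<open>The two leading zero coefficients multiply p - p' by the square of 1/x, the factor that
  differentiating 1/x produces.\<close>

lemma flat_deriv:
  "(flat p has_real_derivative flat (pCons 0 (pCons 0 (p - pderiv p))) x) (at x)"
proof (cases x "0::real" rule: linorder_cases)
  case less
  have "((\<lambda>x. 0) has_real_derivative 0) (at x)" by simp
  then have "(flat p has_real_derivative 0) (at x)"
    by (rule has_field_derivative_transform_within_open[of _ _ _ "{..<0}"])
      (use less in \<open>auto simp: flat_def\<close>)
  then show ?thesis using less by (simp add: flat_def)
next
  case equal
  then show ?thesis using flat_deriv_0 by (simp add: flat_def)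
next
  case greater
  have "((\<lambda>x. poly p (1 / x) * exp (- 1 / x)) has_real_derivative
      flat (pCons 0 (pCons 0 (p - pderiv p))) x) (at x)"
    using greater
    by (auto intro!: derivative_eq_intros simp: flat_def field_simps power2_eq_square)
  then show ?thesis
    by (rule has_field_derivative_transform_within_open[of _ _ _ "{0<..}"])
      (use greater in \<open>auto simp: flat_def\<close>)
qed

lemma Cinf_flat: "Cinf UNIV (flat p)"
proof -
  define g where "g k = flat (((\<lambda>p. pCons 0 (pCons 0 (p - pderiv p))) ^^ k) p)" for k
  have "Cinf UNIV (g 0)"
    by (rule Cinf_real_I) (auto simp: g_def flat_deriv)
  then show ?thesis by (simp add: g_def)
qed

lemma bump_exists:
  assumes "a < (b::real)"
  shows "\<exists>f. Cinf UNIV f \<and> (\<forall>x. f x \<ge> 0) \<and> (\<forall>x. f x > 0 \<longleftrightarrow> a < x \<and> x < b)"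
proof (intro exI conjI allI)
  have "Cinf UNIV (\<lambda>x::real. c * x + d)" for c d
    by (intro Cinf_add Cinf_mult Cinf_const Cinf_linear bounded_linear_ident) auto
  from this[of 1 "-a"] this[of "-1" b]
  have "Cinf UNIV (\<lambda>x. x - a)" "Cinf UNIV (\<lambda>x. b - x)" by simp_all
  then show "Cinf UNIV (\<lambda>x. flat [:1:] (x - a) * flat [:1:] (b - x))"
    by (intro Cinf_mult Cinf_compose_real[OF Cinf_flat]) auto
  show "flat [:1:] (x - a) * flat [:1:] (b - x) \<ge> 0" for x by (simp add: flat_def)
  show "flat [:1:] (x - a) * flat [:1:] (b - x) > 0 \<longleftrightarrow> a < x \<and> x < b" for x
    by (simp add: flat_def)
qed

section \<open>The Abel-type transform\<close>

text \<open>The d-fold iterate at s is the integral of \<open>h (\<bar>w\<bar>\<^sup>2 + s)\<close> over \<open>w \<in> \<real>\<^sup>d\<close>.\<close>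

definition nn_abel :: "(real \<Rightarrow> ennreal) \<Rightarrow> real \<Rightarrow> ennreal" where
  "nn_abel h s = (\<integral>\<^sup>+x. h (x\<^sup>2 + s) \<partial>lborel)"

lemma nn_abel_measurable [measurable]:
  assumes [measurable]: "h \<in> borel_measurable borel" shows "nn_abel h \<in> borel_measurable borel"
  unfolding nn_abel_def by measurable

lemma nn_abel_pow_measurable [measurable]:
  "h \<in> borel_measurable borel \<Longrightarrow> (nn_abel ^^ k) h \<in> borel_measurable borel"
  by (induction k) auto

lemma nn_abel_cong: "(\<And>t. t \<ge> s \<Longrightarrow> f t = g t) \<Longrightarrow> nn_abel f s = nn_abel g s"
  unfolding nn_abel_def by (intro nn_integral_cong) auto

text \<open>The iterate at s samples its argument only at points |w|^2 + s. Functions may therefore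
  be redefined at will below s, where the geometry gives them no meaning.\<close>

lemma nn_abel_pow_cong: "(\<And>t. t \<ge> s \<Longrightarrow> f t = g t) \<Longrightarrow> (nn_abel ^^ k) f s = (nn_abel ^^ k) g s"
proof (induction k arbitrary: s)
  case (Suc k)
  have "(nn_abel ^^ k) f t = (nn_abel ^^ k) g t" if "t \<ge> s" for t
    by (rule Suc.IH) (use Suc.prems that in auto)
  then show ?case by (auto intro: nn_abel_cong)
qed auto

lemma nn_abel_pow_add:
  assumes "f \<in> borel_measurable borel" "g \<in> borel_measurable borel"
  shows "(nn_abel ^^ k) (\<lambda>t. f t + g t) = (\<lambda>t. (nn_abel ^^ k) f t + (nn_abel ^^ k) g t)"
proof (induction k)
  case (Suc k)
  have [measurable]: "(nn_abel ^^ k) f \<in> borel_measurable borel" "(nn_abel ^^ k) g \<in> borel_measurable borel"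
    using assms by auto
  show ?case by (auto simp: Suc fun_eq_iff) (simp add: nn_abel_def nn_integral_add)
qed auto

lemma nn_abel_pow_cmult:
  assumes "f \<in> borel_measurable borel"
  shows "(nn_abel ^^ k) (\<lambda>t. c * f t) = (\<lambda>t. c * (nn_abel ^^ k) f t)"
proof (induction k)
  case (Suc k)
  have [measurable]: "(nn_abel ^^ k) f \<in> borel_measurable borel" using assms by auto
  show ?case by (auto simp: Suc fun_eq_iff) (simp add: nn_abel_def nn_integral_cmult)
qed auto

lemma nn_abel_pow_mono:
  "(\<And>t. t \<ge> s \<Longrightarrow> f t \<le> g t) \<Longrightarrow> (nn_abel ^^ k) f s \<le> (nn_abel ^^ k) g s"
proof (induction k arbitrary: s)
  case (Suc k)
  have "(nn_abel ^^ k) f (x\<^sup>2 + s) \<le> (nn_abel ^^ k) g (x\<^sup>2 + s)" for x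
  proof (rule Suc.IH)
    fix t assume "x\<^sup>2 + s \<le> t"
    then show "f t \<le> g t" using Suc.prems zero_le_power2[of x] by (meson add_increasing order_refl order_trans)
  qed
  then have "nn_abel ((nn_abel ^^ k) f) s \<le> nn_abel ((nn_abel ^^ k) g) s"
    unfolding nn_abel_def[of _ s] by (intro nn_integral_mono)
  then show ?case by simp
qed auto

text \<open>Integrating out one coordinate replaces h by \<open>nn_abel h\<close>, which is why the
  induction is over all h.\<close>

lemma nn_integral_PiM_radial:
  assumes "finite A" "h \<in> borel_measurable borel"
  shows "(\<integral>\<^sup>+\<omega>. h (s + (\<Sum>i\<in>A. (\<omega> i)\<^sup>2)) \<partial>Pi\<^sub>M A (\<lambda>_. lborel)) = (nn_abel ^^ card A) h s"
  using assms
proof (induction A arbitrary: h rule: finite_induct)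
  case empty
  then show ?case by (simp add: nn_integral_count_space_finite PiM_empty)
next
  case (insert i A)
  interpret product_sigma_finite "\<lambda>_. lborel :: real measure" ..
  note [measurable] = insert.prems
  have "(\<integral>\<^sup>+\<omega>. h (s + (\<Sum>j\<in>insert i A. (\<omega> j)\<^sup>2)) \<partial>Pi\<^sub>M (insert i A) (\<lambda>_. lborel))
    = (\<integral>\<^sup>+\<omega>. (\<integral>\<^sup>+y. h (s + (\<Sum>j\<in>insert i A. (fun_upd \<omega> i y j)\<^sup>2)) \<partial>lborel) \<partial>Pi\<^sub>M A (\<lambda>_. lborel))"
    using insert by (intro product_nn_integral_insert) auto
  also have "\<dots> = (\<integral>\<^sup>+\<omega>. nn_abel h (s + (\<Sum>j\<in>A. (\<omega> j)\<^sup>2)) \<partial>Pi\<^sub>M A (\<lambda>_. lborel))"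
  proof (intro nn_integral_cong)
    fix \<omega> :: "'a \<Rightarrow> real"
    have "(\<Sum>j\<in>insert i A. (fun_upd \<omega> i y j)\<^sup>2) = y\<^sup>2 + (\<Sum>j\<in>A. (\<omega> j)\<^sup>2)" for y
      using insert.hyps by (auto intro!: sum.cong)
    then show "(\<integral>\<^sup>+y. h (s + (\<Sum>j\<in>insert i A. (fun_upd \<omega> i y j)\<^sup>2)) \<partial>lborel) = nn_abel h (s + (\<Sum>j\<in>A. (\<omega> j)\<^sup>2))"
      by (simp add: nn_abel_def add_ac)
  qed
  also have "\<dots> = (nn_abel ^^ card A) (nn_abel h) s" by (rule insert.IH) simp
  also have "\<dots> = (nn_abel ^^ card (insert i A)) h s" using insert by (simp add: funpow_swap1)
  finally show ?case .
qed

lemma nn_abel_scale: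
  assumes [measurable]: "h \<in> borel_measurable borel" and "z \<noteq> 0"
  shows "nn_abel h (s * z\<^sup>2) = ennreal \<bar>z\<bar> * nn_abel (\<lambda>t. h (t * z\<^sup>2)) s"
  unfolding nn_abel_def
  by (subst nn_integral_real_affine[of _ z 0]) (use assms in \<open>auto simp: power_mult_distrib algebra_simps\<close>)

text \<open>A dilation by z in k dimensions; its Jacobian becomes the weight z^k of polar
  coordinates.\<close>

lemma nn_abel_pow_scale:
  assumes "h \<in> borel_measurable borel" and "z \<noteq> 0"
  shows "(nn_abel ^^ k) h (s * z\<^sup>2) = ennreal (\<bar>z\<bar> ^ k) * (nn_abel ^^ k) (\<lambda>t. h (t * z\<^sup>2)) s"
  using assms(1)
proof (induction k arbitrary: h)
  case (Suc k)
  note [measurable] = Suc.prems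
  have "(nn_abel ^^ Suc k) h (s * z\<^sup>2) = (nn_abel ^^ k) (nn_abel h) (s * z\<^sup>2)" by (simp add: funpow_swap1)
  also have "\<dots> = ennreal (\<bar>z\<bar> ^ k) * (nn_abel ^^ k) (\<lambda>t. nn_abel h (t * z\<^sup>2)) s" by (rule Suc.IH) simp
  also have "(\<lambda>t. nn_abel h (t * z\<^sup>2)) = (\<lambda>t. ennreal \<bar>z\<bar> * nn_abel (\<lambda>t. h (t * z\<^sup>2)) t)"
    using nn_abel_scale[OF Suc.prems assms(2)] by auto
  also have "(nn_abel ^^ k) \<dots> s = ennreal \<bar>z\<bar> * (nn_abel ^^ k) (nn_abel (\<lambda>t. h (t * z\<^sup>2))) s"
    by (subst nn_abel_pow_cmult) auto
  also have "(nn_abel ^^ k) (nn_abel (\<lambda>t. h (t * z\<^sup>2))) s = (nn_abel ^^ Suc k) (\<lambda>t. h (t * z\<^sup>2)) s"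
    by (simp add: funpow_swap1)
  finally show ?case by (simp add: mult.assoc[symmetric] ennreal_mult'[symmetric] mult.commute del: funpow.simps)
qed auto

lemma nn_abel_pow_Fubini:
  assumes "(\<lambda>(z, t). G z t) \<in> borel_measurable (borel \<Otimes>\<^sub>M borel)"
  shows "(nn_abel ^^ k) (\<lambda>t. \<integral>\<^sup>+z. G z t \<partial>lborel) s = (\<integral>\<^sup>+z. (nn_abel ^^ k) (G z) s \<partial>lborel)"
  using assms
proof (induction k arbitrary: G)
  case (Suc k)
  note [measurable] = Suc.prems
  have "(nn_abel ^^ Suc k) (\<lambda>t. \<integral>\<^sup>+z. G z t \<partial>lborel) s = (nn_abel ^^ k) (nn_abel (\<lambda>t. \<integral>\<^sup>+z. G z t \<partial>lborel)) s"
    by (simp add: funpow_swap1)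
  also have "nn_abel (\<lambda>t. \<integral>\<^sup>+z. G z t \<partial>lborel) = (\<lambda>t. \<integral>\<^sup>+z. nn_abel (G z) t \<partial>lborel)"
    unfolding nn_abel_def by (rule ext) (intro lborel_pair.Fubini', measurable)
  also have "(nn_abel ^^ k) \<dots> s = (\<integral>\<^sup>+z. (nn_abel ^^ k) (nn_abel (G z)) s \<partial>lborel)"
    by (rule Suc.IH) (unfold nn_abel_def, measurable)
  finally show ?case by (simp add: funpow_swap1)
qed auto

lemma nn_integral_power_Ioc:
  assumes "0 \<le> Y"
  shows "(\<integral>\<^sup>+z. ennreal (z ^ k) * indicator {0<..Y} z \<partial>lborel) = ennreal (Y ^ Suc k / Suc k)"
proof -
  have "(\<integral>\<^sup>+z. ennreal (z ^ k) * indicator {0<..Y} z \<partial>lborel) = (\<integral>\<^sup>+z. ennreal (z ^ k) * indicator {0..Y} z \<partial>lborel)"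
    by (intro nn_integral_cong_AE AE_I[where N="{0}"]) (auto simp: indicator_def split: if_splits)
  also have "\<dots> = ennreal (Y ^ Suc k / Suc k - 0 ^ Suc k / Suc k)"
    by (rule nn_integral_FTC_Icc) (use assms in \<open>auto intro!: derivative_eq_intros simp del: power_Suc\<close>)
  finally show ?thesis by simp
qed

text \<open>Substituting \<open>y = z w\<close> in each slice of height z and exchanging the integrals amounts to polar
  coordinates with \<open>t = \<bar>w\<bar>\<^sup>2 + s\<close>.\<close>

lemma polar_half:
  assumes [measurable]: "Y \<in> borel_measurable borel" and "\<And>t. Y t \<ge> 0"
    and P: "\<And>z t. z > 0 \<Longrightarrow> t \<ge> s \<Longrightarrow> P z (t * z\<^sup>2) \<longleftrightarrow> z \<le> Y t"
    and Pm: "\<And>z. z > 0 \<Longrightarrow> Measurable.pred borel (P z)"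
  shows "(\<integral>\<^sup>+z. (nn_abel ^^ k) (\<lambda>a. of_bool (P z a)) (s * z\<^sup>2) * indicator {0<..} z \<partial>lborel)
    = (nn_abel ^^ k) (\<lambda>t. ennreal (Y t ^ Suc k / Suc k)) s"
proof -
  let ?G = "\<lambda>z t. ennreal (z ^ k) * of_bool (0 < z \<and> z \<le> Y t)"
  have "(\<integral>\<^sup>+z. (nn_abel ^^ k) (\<lambda>a. of_bool (P z a)) (s * z\<^sup>2) * indicator {0<..} z \<partial>lborel)
     = (\<integral>\<^sup>+z. (nn_abel ^^ k) (?G z) s \<partial>lborel)"
  proof (intro nn_integral_cong)
    fix z :: real
    show "(nn_abel ^^ k) (\<lambda>a. of_bool (P z a)) (s * z\<^sup>2) * indicator {0<..} z = (nn_abel ^^ k) (?G z) s"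
    proof (cases "z > 0")
      case True
      note [measurable] = Pm[OF True]
      have "(nn_abel ^^ k) (\<lambda>a. of_bool (P z a)) (s * z\<^sup>2) = ennreal (\<bar>z\<bar> ^ k) * (nn_abel ^^ k) (\<lambda>t. of_bool (P z (t * z\<^sup>2))) s"
        using True by (intro nn_abel_pow_scale) auto
      also have "(nn_abel ^^ k) (\<lambda>t. of_bool (P z (t * z\<^sup>2))) s = (nn_abel ^^ k) (\<lambda>t. of_bool (0 < z \<and> z \<le> Y t)) s"
        by (rule nn_abel_pow_cong) (use P True in auto)
      also have "ennreal (\<bar>z\<bar> ^ k) * \<dots> = (nn_abel ^^ k) (?G z) s"
        using True by (subst nn_abel_pow_cmult) auto
      finally show ?thesis using True by simp
    next
      case False
      have "(nn_abel ^^ k) (?G z) s = (nn_abel ^^ k) (\<lambda>t. 0 * 0) s" by (rule nn_abel_pow_cong) (use False in auto)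
      also have "\<dots> = 0" by (subst nn_abel_pow_cmult) auto
      finally show ?thesis using False by simp
    qed
  qed
  also have "\<dots> = (nn_abel ^^ k) (\<lambda>t. \<integral>\<^sup>+z. ?G z t \<partial>lborel) s"
    by (rule nn_abel_pow_Fubini[symmetric]) measurable
  also have "(\<lambda>t. \<integral>\<^sup>+z. ?G z t \<partial>lborel) = (\<lambda>t. ennreal (Y t ^ Suc k / Suc k))"
    using nn_integral_power_Ioc[OF assms(2), of k] by (simp add: indicator_def)
  finally show ?thesis .
qed

text \<open>The substitution u = c x^2 on each half-line. As r vanishes beyond T, it can be carried
  out on compact intervals.\<close>

lemma nn_integral_abs_square:
  fixes r :: "real \<Rightarrow> real"
  defines "f \<equiv> \<lambda>u. ennreal (r u)"
  assumes [measurable]: "r \<in> borel_measurable borel" and r: "\<And>u. r u \<ge> 0" "\<And>u. u \<ge> T \<Longrightarrow> r u = 0" and c: "c > 0"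
  shows "(\<integral>\<^sup>+x. ennreal \<bar>x\<bar> * f (c * x\<^sup>2) \<partial>lborel) = ennreal (1 / c) * (\<integral>\<^sup>+u. f u * indicator {0..} u \<partial>lborel)"
proof -
  have f0: "\<And>u. u \<ge> T \<Longrightarrow> f u = 0" using r by (simp add: f_def)
  have [measurable]: "f \<in> borel_measurable borel" unfolding f_def by simp
  define X where "X = sqrt (max T 0 / c)"
  have X: "X \<ge> 0" "c * X\<^sup>2 = max T 0" using c by (auto simp: X_def)
  have "(\<integral>\<^sup>+u. f u * indicator {0..} u \<partial>lborel) = (\<integral>\<^sup>+u. f u * indicator {c * 0\<^sup>2..c * X\<^sup>2} u \<partial>lborel)"
    by (intro nn_integral_cong) (use f0 X in \<open>auto simp: indicator_def\<close>)
  also have "\<dots> = (\<integral>\<^sup>+u. ennreal (r u * indicator {c * 0\<^sup>2..c * X\<^sup>2} u) \<partial>lborel)"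
    by (intro nn_integral_cong) (auto simp: indicator_def f_def)
  also have "\<dots> = (\<integral>\<^sup>+x. ennreal (r (c * x\<^sup>2) * (2 * c * x) * indicator {0..X} x) \<partial>lborel)"
    by (rule nn_integral_substitution) (use c X in \<open>auto intro!: derivative_eq_intros continuous_intros simp: set_borel_measurable_def\<close>)
  also have "\<dots> = (\<integral>\<^sup>+x. f (c * x\<^sup>2) * ennreal (2 * c * x) * indicator {0..X} x \<partial>lborel)"
    using r c by (intro nn_integral_cong) (auto simp: indicator_def f_def ennreal_mult')
  also have "\<dots> = (\<integral>\<^sup>+x. ennreal (2 * c) * (ennreal \<bar>x\<bar> * f (c * x\<^sup>2) * indicator {0..} x) \<partial>lborel)"
  proof (intro nn_integral_cong)
    fix x :: real
    have "f (c * x\<^sup>2) = 0" if "x > X"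
    proof -
      have "c * X\<^sup>2 \<le> c * x\<^sup>2" using that X c by (intro mult_left_mono power_mono) auto
      then show ?thesis using X f0 by auto
    qed
    then show "f (c * x\<^sup>2) * ennreal (2 * c * x) * indicator {0..X} x = ennreal (2 * c) * (ennreal \<bar>x\<bar> * f (c * x\<^sup>2) * indicator {0..} x)"
      using c by (auto simp: indicator_def ennreal_mult' mult_ac)
  qed
  finally have 1: "(\<integral>\<^sup>+u. f u * indicator {0..} u \<partial>lborel) = ennreal (2 * c) * (\<integral>\<^sup>+x. ennreal \<bar>x\<bar> * f (c * x\<^sup>2) * indicator {0..} x \<partial>lborel)"
    by (simp add: nn_integral_cmult)
  have "(\<integral>\<^sup>+x. ennreal \<bar>x\<bar> * f (c * x\<^sup>2) * indicator {..0} x \<partial>lborel) = (\<integral>\<^sup>+x. ennreal \<bar>x\<bar> * f (c * x\<^sup>2) * indicator {0..} x \<partial>lborel)"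
    by (subst nn_integral_real_affine[of _ "-1" 0]) (auto simp: indicator_def)
  moreover have "(\<integral>\<^sup>+x. ennreal \<bar>x\<bar> * f (c * x\<^sup>2) \<partial>lborel) =
    (\<integral>\<^sup>+x. ennreal \<bar>x\<bar> * f (c * x\<^sup>2) * indicator {..0} x + ennreal \<bar>x\<bar> * f (c * x\<^sup>2) * indicator {0..} x \<partial>lborel)"
    by (intro nn_integral_cong) (auto simp: indicator_def)
  ultimately have 2: "(\<integral>\<^sup>+x. ennreal \<bar>x\<bar> * f (c * x\<^sup>2) \<partial>lborel) = 2 * (\<integral>\<^sup>+x. ennreal \<bar>x\<bar> * f (c * x\<^sup>2) * indicator {0..} x \<partial>lborel)"
    by (subst (asm) nn_integral_add) (auto simp: mult_2)
  have "ennreal (1 / c) * ennreal (2 * c) = 2" using c by (simp add: ennreal_mult'[symmetric])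
  then show ?thesis by (simp add: 1 2 mult.assoc[symmetric])
qed

lemma nn_integral_arctan: "(\<integral>\<^sup>+q. ennreal (1 / (1 + q\<^sup>2)) \<partial>lborel) = ennreal pi"
proof -
  have 1: "(\<integral>\<^sup>+q. ennreal (1 / (1 + q\<^sup>2)) * indicator {0..} q \<partial>lborel) = ennreal (pi / 2 - arctan 0)"
    by (rule nn_integral_FTC_atLeast[where F=arctan])
      (auto intro!: derivative_eq_intros tendsto_arctan_at_top simp: inverse_eq_divide)
  have 2: "(\<integral>\<^sup>+q. ennreal (1 / (1 + q\<^sup>2)) * indicator {..0} q \<partial>lborel) = (\<integral>\<^sup>+q. ennreal (1 / (1 + q\<^sup>2)) * indicator {0..} q \<partial>lborel)"
    by (subst nn_integral_real_affine[of _ "-1" 0]) (auto simp: indicator_def)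
  have "(\<integral>\<^sup>+q. ennreal (1 / (1 + q\<^sup>2)) \<partial>lborel) = (\<integral>\<^sup>+q. ennreal (1 / (1 + q\<^sup>2)) * indicator {..0} q + ennreal (1 / (1 + q\<^sup>2)) * indicator {0..} q \<partial>lborel)"
    by (intro nn_integral_cong_AE AE_I[where N="{0}"]) (auto simp: indicator_def split: if_splits)
  also have "\<dots> = ennreal (pi / 2) + ennreal (pi / 2)"
    by (subst nn_integral_add) (auto simp: 1 2)
  also have "\<dots> = ennreal pi" by (subst ennreal_plus[symmetric]) auto
  finally show ?thesis .
qed

text \<open>In place of polar coordinates in the plane, y = x q is substituted for fixed x \<noteq>
  0; after exchanging the integrals there remains the integral of 1/(1 + q^2), which is pi.\<close>

lemma nn_abel_nn_abel:
  fixes r :: "real \<Rightarrow> real"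
  defines "f \<equiv> \<lambda>u. ennreal (r u)"
  assumes [measurable]: "r \<in> borel_measurable borel" and r: "\<And>u. r u \<ge> 0" "\<And>u. u \<ge> T \<Longrightarrow> r u = 0"
  shows "nn_abel (nn_abel f) s = ennreal pi * (\<integral>\<^sup>+u. f (u + s) * indicator {0..} u \<partial>lborel)"
proof -
  have [measurable]: "f \<in> borel_measurable borel" unfolding f_def by simp
  have "nn_abel (nn_abel f) s = (\<integral>\<^sup>+x. \<integral>\<^sup>+y. f (y\<^sup>2 + (x\<^sup>2 + s)) \<partial>lborel \<partial>lborel)" by (simp add: nn_abel_def)
  also have "\<dots> = (\<integral>\<^sup>+x. \<integral>\<^sup>+q. ennreal \<bar>x\<bar> * f ((1 + q\<^sup>2) * x\<^sup>2 + s) \<partial>lborel \<partial>lborel)"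
  proof (intro nn_integral_cong_AE AE_I[where N="{0}"], safe)
    fix x :: real
    assume *: "(\<integral>\<^sup>+y. f (y\<^sup>2 + (x\<^sup>2 + s)) \<partial>lborel) \<noteq> (\<integral>\<^sup>+q. ennreal \<bar>x\<bar> * f ((1 + q\<^sup>2) * x\<^sup>2 + s) \<partial>lborel)"
    show "x = 0"
    proof (rule ccontr)
      assume "x \<noteq> 0"
      then have "(\<integral>\<^sup>+y. f (y\<^sup>2 + (x\<^sup>2 + s)) \<partial>lborel) = ennreal \<bar>x\<bar> * (\<integral>\<^sup>+q. f ((0 + x * q)\<^sup>2 + (x\<^sup>2 + s)) \<partial>lborel)"
        by (intro nn_integral_real_affine) auto
      also have "\<dots> = (\<integral>\<^sup>+q. ennreal \<bar>x\<bar> * f ((1 + q\<^sup>2) * x\<^sup>2 + s) \<partial>lborel)"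
        by (subst nn_integral_cmult[symmetric]) (auto simp: algebra_simps power_mult_distrib)
      finally show False using * by blast
    qed
  qed auto
  also have "\<dots> = (\<integral>\<^sup>+q. \<integral>\<^sup>+x. ennreal \<bar>x\<bar> * f ((1 + q\<^sup>2) * x\<^sup>2 + s) \<partial>lborel \<partial>lborel)"
    by (intro lborel_pair.Fubini') measurable
  also have "\<dots> = (\<integral>\<^sup>+q. ennreal (1 / (1 + q\<^sup>2)) * (\<integral>\<^sup>+u. f (u + s) * indicator {0..} u \<partial>lborel) \<partial>lborel)"
    unfolding f_def
    by (intro nn_integral_cong nn_integral_abs_square[where T="T - s"]) (use r in \<open>auto intro: add_pos_nonneg\<close>)
  also have "\<dots> = ennreal pi * (\<integral>\<^sup>+u. f (u + s) * indicator {0..} u \<partial>lborel)"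
    by (subst nn_integral_multc) (auto simp: nn_integral_arctan)
  finally show ?thesis .
qed

text \<open>For \<open>s > -1\<close> and h vanishing beyond 100 the integrand vanishes outside \<open>{-11..11}\<close>, so this is the
  integral over the whole line.\<close>

definition abel :: "(real \<Rightarrow> real) \<Rightarrow> real \<Rightarrow> real" where
  "abel h s = integral {-11..11} (\<lambda>x. h (x\<^sup>2 + s))"

text \<open>The limit l may be negative, so that transforms are controlled on a neighbourhood of s =
  0. The bound -1 ensures x^2 + s > 100 whenever |x| > 11, so nothing is lost by truncating the
  integral.\<close>

definition admissible :: "real \<Rightarrow> (real \<Rightarrow> real) \<Rightarrow> bool" where
  "admissible l h \<longleftrightarrow> -1 \<le> l \<and> continuous_on {l<..} h \<and> (\<forall>s>100. h s = 0)"

section \<open>The transform on signed continuous functions\<close>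

lemma abel_cong: "(\<And>t. t \<ge> s \<Longrightarrow> f t = g t) \<Longrightarrow> abel f s = abel g s"
  unfolding abel_def by (intro integral_cong) auto

lemma abel_pow_cong: "(\<And>t. t \<ge> s \<Longrightarrow> f t = g t) \<Longrightarrow> (abel ^^ k) f s = (abel ^^ k) g s"
proof (induction k arbitrary: s)
  case (Suc k)
  have "(abel ^^ k) f t = (abel ^^ k) g t" if "t \<ge> s" for t
    by (rule Suc.IH) (use Suc.prems that in auto)
  then show ?case by (auto intro: abel_cong)
qed auto

lemma abel_pow_cmult: "(abel ^^ k) (\<lambda>t. c * f t) = (\<lambda>t. c * (abel ^^ k) f t)"
  by (induction k) (auto simp: abel_def fun_eq_iff)

lemma admissible_integrand:
  assumes "admissible l h" "l < s"
  shows "continuous_on {a..b} (\<lambda>x. h (x\<^sup>2 + s))"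
proof (rule continuous_on_compose2[of "{l<..}" h])
  show "(\<lambda>x. x\<^sup>2 + s) ` {a..b} \<subseteq> {l<..}"
    using assms(2) by (auto intro: add_nonneg_pos order.strict_trans2)
qed (use assms in \<open>auto simp: admissible_def intro!: continuous_intros\<close>)

lemma admissible_abel:
  assumes "admissible l h" shows "admissible l (abel h)"
  unfolding admissible_def
proof (intro conjI allI impI)
  show "-1 \<le> l" using assms admissible_def by blast
  have "continuous_on ({l<..} \<times> cbox (-11) 11) (\<lambda>(s, x). h (x\<^sup>2 + s))"
    unfolding split_beta
  proof (rule continuous_on_compose2[of "{l<..}" h])
    show "(\<lambda>p. (snd p)\<^sup>2 + fst p) ` ({l<..} \<times> cbox (-11) 11) \<subseteq> {l<..}"
      by (auto intro: add_nonneg_pos order.strict_trans2)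
  qed (use assms in \<open>auto simp: admissible_def intro!: continuous_intros\<close>)
  then have "continuous_on {l<..} (\<lambda>s. integral (cbox (-11) 11) (\<lambda>x. h (x\<^sup>2 + s)))"
    by (rule integral_continuous_on_param)
  then show "continuous_on {l<..} (abel h)" by (simp add: abel_def[abs_def])
  fix s :: real assume "s > 100"
  then have "abel h s = abel (\<lambda>_. 0) s" using assms by (intro abel_cong) (auto simp: admissible_def)
  then show "abel h s = 0" by (simp add: abel_def)
qed

lemma abel_nonneg:
  assumes "admissible l h" "l < s" "\<And>t. t > l \<Longrightarrow> h t \<ge> 0"
  shows "abel h s \<ge> 0"
  unfolding abel_def
  by (intro integral_nonneg integrable_continuous_interval admissible_integrand[OF assms(1,2)])
    (use assms in \<open>auto intro!: assms(3) intro: add_nonneg_pos order.strict_trans2\<close>)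

lemma nn_abel_eq_abel:
  assumes "admissible l h" "l < s" "\<And>t. t > l \<Longrightarrow> h t \<ge> 0"
  shows "nn_abel (\<lambda>t. ennreal (h t)) s = ennreal (abel h s)"
proof -
  have "nn_abel (\<lambda>t. ennreal (h t)) s = (\<integral>\<^sup>+x. ennreal (h (x\<^sup>2 + s)) * indicator {-11..11} x \<partial>lborel)"
    unfolding nn_abel_def
  proof (intro nn_integral_cong)
    fix x :: real
    have "h (x\<^sup>2 + s) = 0" if "\<bar>x\<bar> > 11"
    proof -
      have "11\<^sup>2 < \<bar>x\<bar>\<^sup>2" using that by (intro power_strict_mono) auto
      then have "x\<^sup>2 + s > 100" using assms by (auto simp: admissible_def)
      then show ?thesis using assms admissible_def by blast
    qed
    then show "ennreal (h (x\<^sup>2 + s)) = ennreal (h (x\<^sup>2 + s)) * indicator {-11..11} x"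
      by (auto simp: indicator_def abs_if split: if_splits)
  qed
  also have "\<dots> = ennreal (abel h s)"
    unfolding abel_def
    by (intro nn_integral_has_integral_lebesgue' integrable_integral integrable_continuous_interval admissible_integrand[OF assms(1,2)])
      (use assms in \<open>auto intro!: assms(3) intro: add_nonneg_pos order.strict_trans2\<close>)
  finally show ?thesis .
qed

lemma nn_abel_pow_eq_abel:
  assumes "admissible l h" "l < s" "\<And>t. t > l \<Longrightarrow> h t \<ge> 0"
  shows "(nn_abel ^^ k) (\<lambda>t. ennreal (h t)) s = ennreal ((abel ^^ k) h s) \<and> (abel ^^ k) h s \<ge> 0"
  using assms(1,3)
proof (induction k arbitrary: h)
  case (Suc k)
  have "(nn_abel ^^ Suc k) (\<lambda>t. ennreal (h t)) s = (nn_abel ^^ k) (\<lambda>t. ennreal (abel h t)) s"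
    unfolding funpow_Suc_right o_def
    by (intro nn_abel_pow_cong nn_abel_eq_abel[OF Suc.prems(1)]) (use Suc.prems assms(2) in auto)
  also have "\<dots> = ennreal ((abel ^^ k) (abel h) s) \<and> (abel ^^ k) (abel h) s \<ge> 0"
    using abel_nonneg[OF Suc.prems(1) _ Suc.prems(2)] by (intro Suc.IH admissible_abel Suc.prems) auto
  finally show ?case by (simp add: funpow_swap1)
qed (use assms in auto)

lemma abel_diff:
  assumes "admissible l f" "admissible l g" "l < s" shows "abel (\<lambda>t. f t - g t) s = abel f s - abel g s"
  unfolding abel_def
  by (intro integral_diff integrable_continuous_interval admissible_integrand[of l] assms)

lemma abel_pow_diff:
  assumes "admissible l f" "admissible l g" "l < s"
  shows "(abel ^^ k) (\<lambda>t. f t - g t) s = (abel ^^ k) f s - (abel ^^ k) g s"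
  using assms
proof (induction k arbitrary: f g)
  case (Suc k)
  have "(abel ^^ Suc k) (\<lambda>t. f t - g t) s = (abel ^^ k) (\<lambda>t. abel f t - abel g t) s"
    unfolding funpow_Suc_right o_def
    by (intro abel_pow_cong abel_diff[of l]) (use Suc.prems in auto)
  also have "\<dots> = (abel ^^ k) (abel f) s - (abel ^^ k) (abel g) s"
    using Suc by (auto intro: admissible_abel)
  finally show ?case by (simp add: funpow_swap1)
qed auto

text \<open>Positive and negative parts carry signed functions over to nonnegative integrals;
  cutting them off at l makes them measurable on the whole line.\<close>

lemma admissible_pos_part:
  assumes "admissible l D"
  shows "admissible l (\<lambda>t. indicator {l<..} t * max 0 (D t))" "(\<lambda>t. indicator {l<..} t * max 0 (D t)) \<in> borel_measurable borel"
    and "admissible l (\<lambda>t. - D t)"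
proof -
  have c: "continuous_on {l<..} (\<lambda>t. max 0 (D t))"
    using assms by (auto simp: admissible_def intro!: continuous_intros)
  then show "admissible l (\<lambda>t. indicator {l<..} t * max 0 (D t))"
    using assms by (auto simp: admissible_def cong: continuous_on_cong_simp)
  show "(\<lambda>t. indicator {l<..} t * max 0 (D t)) \<in> borel_measurable borel"
    using borel_measurable_continuous_on_indicator[OF _ c] by simp
  show "admissible l (\<lambda>t. - D t)" using assms by (auto simp: admissible_def intro!: continuous_intros)
qed

text \<open>Transfers a known transform across a signed perturbation D; here
  \<open>ball_radius_pow\<close> is a variable for the unperturbed function. To avoid subtraction in
  \<open>ennreal\<close>, the negative part of D is added on one side and the positive part on the
  other, and finiteness of the known side permits the return to reals.\<close>

lemma nn_abel_pow_difference:
  assumes [measurable]: "Ya \<in> borel_measurable borel" "ball_radius_pow \<in> borel_measurable borel"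
    and nn: "\<And>t. Ya t \<ge> 0" "\<And>t. ball_radius_pow t \<ge> 0"
    and D: "admissible l D" "\<And>t. t \<ge> s \<Longrightarrow> Ya t = ball_radius_pow t + D t" "l < s"
    and b: "(nn_abel ^^ k) (\<lambda>t. ennreal (ball_radius_pow t)) s = ennreal b" "b \<ge> 0"
  shows "(nn_abel ^^ k) (\<lambda>t. ennreal (Ya t)) s = ennreal (b + (abel ^^ k) D s) \<and> b + (abel ^^ k) D s \<ge> 0"
proof -
  define P where "P t = indicator {l<..} t * max 0 (D t)" for t
  define N where "N t = indicator {l<..} t * max 0 (- D t)" for t
  have P: "admissible l P" and [measurable]: "P \<in> borel_measurable borel" and "\<And>t. P t \<ge> 0"
    unfolding P_def[abs_def] using admissible_pos_part[OF D(1)] by auto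
  have N: "admissible l N" and [measurable]: "N \<in> borel_measurable borel" and "\<And>t. N t \<ge> 0"
    unfolding N_def[abs_def] using admissible_pos_part[OF admissible_pos_part(3)[OF D(1)]] by auto
  let ?X = "(nn_abel ^^ k) (\<lambda>t. ennreal (Ya t)) s"
  define p where "p = (abel ^^ k) P s"
  define n where "n = (abel ^^ k) N s"
  have p: "(nn_abel ^^ k) (\<lambda>t. ennreal (P t)) s = ennreal p" "p \<ge> 0"
    using nn_abel_pow_eq_abel[OF P \<open>l < s\<close>] \<open>\<And>t. P t \<ge> 0\<close> by (auto simp: p_def)
  have n: "(nn_abel ^^ k) (\<lambda>t. ennreal (N t)) s = ennreal n" "n \<ge> 0"
    using nn_abel_pow_eq_abel[OF N \<open>l < s\<close>] \<open>\<And>t. N t \<ge> 0\<close> by (auto simp: n_def)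
  have "?X + ennreal n = (nn_abel ^^ k) (\<lambda>t. ennreal (Ya t) + ennreal (N t)) s"
    by (subst nn_abel_pow_add) (auto simp: n)
  also have "\<dots> = (nn_abel ^^ k) (\<lambda>t. ennreal (ball_radius_pow t) + ennreal (P t)) s"
  proof (rule nn_abel_pow_cong)
    fix t assume "s \<le> t"
    then have "Ya t + N t = ball_radius_pow t + P t" using D by (auto simp: N_def P_def max_def)
    then show "ennreal (Ya t) + ennreal (N t) = ennreal (ball_radius_pow t) + ennreal (P t)"
      using nn \<open>\<And>t. P t \<ge> 0\<close> \<open>\<And>t. N t \<ge> 0\<close> by (simp add: ennreal_plus[symmetric] del: ennreal_plus)
  qed
  also have "\<dots> = ennreal b + ennreal p" by (subst nn_abel_pow_add) (auto simp: p b)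
  finally have e: "?X + ennreal n = ennreal (b + p)" using p b by simp
  then have "?X \<noteq> top" by auto
  then obtain x where x: "?X = ennreal x" "x \<ge> 0" by (metis ennreal_cases)
  have "x + n = b + p" using e x p n b by (simp add: ennreal_plus[symmetric] del: ennreal_plus)
  moreover have "(abel ^^ k) D s = p - n"
  proof -
    have "(abel ^^ k) D s = (abel ^^ k) (\<lambda>t. P t - N t) s"
      by (rule abel_pow_cong) (use D in \<open>auto simp: P_def N_def max_def\<close>)
    then show ?thesis using abel_pow_diff[OF P N \<open>l < s\<close>] by (simp add: p_def n_def)
  qed
  ultimately have "x = b + (abel ^^ k) D s" by simp
  then show ?thesis using x by auto
qed

text \<open>The form of \<open>nn_abel_nn_abel\<close> over a bounded interval: since s > -1, the
  integrand vanishes for u beyond 101.\<close>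

lemma abel_abel_nonneg:
  assumes "admissible l f" "l < s" "\<And>t. t > l \<Longrightarrow> f t \<ge> 0"
  shows "abel (abel f) s = pi * integral {0..101} (\<lambda>u. f (u + s))"
proof -
  define r where "r t = indicator {l<..} t * max 0 (f t)" for t
  have r: "admissible l r" and [measurable]: "r \<in> borel_measurable borel" and "\<And>t. r t \<ge> 0"
    unfolding r_def[abs_def] using admissible_pos_part[OF assms(1)] by auto
  have rf: "r t = f t" if "t > l" for t using that assms by (auto simp: r_def)
  have cf: "continuous_on {0..101} (\<lambda>u. f (u + s))"
    by (rule continuous_on_compose2[of "{l<..}" f]) (use assms in \<open>auto simp: admissible_def intro!: continuous_intros\<close>)
  have "ennreal (abel (abel f) s) = ennreal ((abel ^^ 2) r s)"
  proof -
    have "(abel ^^ 2) f s = (abel ^^ 2) r s" by (rule abel_pow_cong) (use rf assms in auto)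
    then show ?thesis by (simp add: numeral_2_eq_2)
  qed
  also have "\<dots> = (nn_abel ^^ 2) (\<lambda>t. ennreal (r t)) s"
    using nn_abel_pow_eq_abel[OF r \<open>l < s\<close>] \<open>\<And>t. r t \<ge> 0\<close> by auto
  also have "\<dots> = ennreal pi * (\<integral>\<^sup>+u. ennreal (r (u + s)) * indicator {0..} u \<partial>lborel)"
    using nn_abel_nn_abel[of r 101 s] \<open>\<And>t. r t \<ge> 0\<close> r by (auto simp: numeral_2_eq_2 admissible_def)
  also have "(\<integral>\<^sup>+u. ennreal (r (u + s)) * indicator {0..} u \<partial>lborel) = (\<integral>\<^sup>+u. ennreal (f (u + s)) * indicator {0..101} u \<partial>lborel)"
    by (intro nn_integral_cong) (use rf assms in \<open>auto simp: indicator_def admissible_def r_def\<close>)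
  also have "\<dots> = ennreal (integral {0..101} (\<lambda>u. f (u + s)))"
    by (intro nn_integral_has_integral_lebesgue' integrable_integral integrable_continuous_interval cf) (use assms in auto)
  finally have "ennreal (abel (abel f) s) = ennreal (pi * integral {0..101} (\<lambda>u. f (u + s)))"
    by (simp add: ennreal_mult')
  moreover have "integral {0..101} (\<lambda>u. f (u + s)) \<ge> 0"
    by (intro integral_nonneg integrable_continuous_interval cf) (use assms in auto)
  moreover have "abel (abel f) s \<ge> 0"
    using abel_nonneg[OF assms(1) _ assms(3)] by (intro abel_nonneg[OF admissible_abel[OF assms(1)] \<open>l < s\<close>]) auto
  ultimately show ?thesis by simp
qed

text \<open>Two transforms integrate from s to infinity, up to the factor pi, and so undo one
  differentiation. The boundary term at 101 + s is zero because g vanishes beyond 100.\<close>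

lemma abel_abel_derivative:
  assumes "admissible l g'" "admissible l g" "l < s" "\<And>t. t > l \<Longrightarrow> (g has_real_derivative g' t) (at t)"
  shows "abel (abel (\<lambda>t. - g' t)) s = pi * g s"
proof -
  define P where "P t = indicator {l<..} t * max 0 (- g' t)" for t
  define N where "N t = indicator {l<..} t * max 0 (g' t)" for t
  have P: "admissible l P" and P0: "\<And>t. P t \<ge> 0"
    unfolding P_def[abs_def] using admissible_pos_part[OF admissible_pos_part(3)[OF assms(1)]] by auto
  have N: "admissible l N" and N0: "\<And>t. N t \<ge> 0"
    unfolding N_def[abs_def] using admissible_pos_part[OF assms(1)] by auto
  have c: "(\<lambda>u. h (u + s)) integrable_on {0..101}" if "admissible l h" for h
    by (rule integrable_continuous_interval, rule continuous_on_compose2[of "{l<..}" h])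
      (use assms that in \<open>auto simp: admissible_def intro!: continuous_intros\<close>)
  have "abel (abel (\<lambda>t. - g' t)) s = (abel ^^ 2) (\<lambda>t. - g' t) s" by (simp add: numeral_2_eq_2)
  also have "\<dots> = (abel ^^ 2) (\<lambda>t. P t - N t) s"
    by (rule abel_pow_cong) (use assms in \<open>auto simp: P_def N_def max_def\<close>)
  also have "\<dots> = abel (abel P) s - abel (abel N) s"
    using abel_pow_diff[OF P N \<open>l < s\<close>, of 2] by (simp add: numeral_2_eq_2)
  also have "\<dots> = pi * (integral {0..101} (\<lambda>u. P (u + s)) - integral {0..101} (\<lambda>u. N (u + s)))"
    using abel_abel_nonneg[OF P \<open>l < s\<close> P0] abel_abel_nonneg[OF N \<open>l < s\<close> N0] by (simp add: algebra_simps)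
  also have "\<dots> = pi * integral {0..101} (\<lambda>u. P (u + s) - N (u + s))"
    using c[OF P] c[OF N] by (simp add: integral_diff)
  also have "integral {0..101} (\<lambda>u. P (u + s) - N (u + s)) = integral {0..101} (\<lambda>u. - g' (u + s))"
    by (rule integral_cong) (use assms in \<open>auto simp: P_def N_def max_def\<close>)
  also have "((\<lambda>u. - g' (u + s)) has_integral (- g (101 + s) - - g (0 + s))) {0..101}"
  proof (rule fundamental_theorem_of_calculus)
    fix u :: real assume u: "u \<in> {0..101}"
    have "((\<lambda>u. - g (u + s)) has_real_derivative - g' (u + s)) (at u within {0..101})"
    proof (intro DERIV_minus)
      have "(g has_real_derivative g' (u + s)) (at (u + s))" using u assms by (intro assms(4)) auto
      then have "((\<lambda>u. g (u + s)) has_real_derivative g' (u + s)) (at u)" by (simp add: DERIV_shift)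
      then show "((\<lambda>u. g (u + s)) has_real_derivative g' (u + s)) (at u within {0..101})"
        by (rule has_field_derivative_at_within)
    qed
    then show "((\<lambda>u. - g (u + s)) has_vector_derivative - g' (u + s)) (at u within {0..101})"
      by (simp add: has_real_derivative_iff_has_vector_derivative)
  qed simp
  then have "integral {0..101} (\<lambda>u. - g' (u + s)) = g s"
    using assms by (subst integral_unique) (auto simp: admissible_def)
  finally show ?thesis .
qed

section \<open>The transform with parameters and its inversion\<close>

definition abel_par :: "(real \<times> 'p::euclidean_space \<Rightarrow> real) \<Rightarrow> real \<times> 'p \<Rightarrow> real" where
  "abel_par g z = abel (\<lambda>t. g (t, snd z)) (fst z)"

lemma abel_par_pow: "(abel_par ^^ k) g (s, p) = (abel ^^ k) (\<lambda>t. g (t, p)) s"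
  by (induction k arbitrary: s) (auto simp: abel_par_def)

text \<open>As the interval of integration is fixed, s and the parameter are treated alike, by
  smoothness of parameter integrals.\<close>

lemma Cinf_abel_par:
  assumes "Cinf ({l<..} \<times> P) g" "open P"
  shows "Cinf ({l<..} \<times> P) (abel_par g)"
proof -
  define h where "h = (\<lambda>(z, x). g (x\<^sup>2 + fst z, snd z))"
  have o: "open ({l<..} \<times> P \<times> (UNIV :: real set))" using assms by (auto intro!: open_Times)
  have fs: "bounded_linear (\<lambda>z :: (real \<times> 'a) \<times> real. fst (fst z))" "bounded_linear (\<lambda>z :: (real \<times> 'a) \<times> real. snd z)"
    "bounded_linear (\<lambda>z :: (real \<times> 'a) \<times> real. snd (fst z) \<bullet> c)" for c
    by (auto intro!: bounded_linear_intros)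
  have "Cinf (({l<..} \<times> P) \<times> UNIV) h"
    unfolding h_def split_beta
  proof (rule Cinf_compose_Pair[OF assms(1)])
    show o: "open (({l<..} \<times> P) \<times> (UNIV :: real set))" using assms by (auto intro!: open_Times)
    show "Cinf (({l<..} \<times> P) \<times> UNIV) (\<lambda>x. ((snd x)\<^sup>2 + fst (fst x)) \<bullet> c)" if "c \<in> Basis" for c
      using that by (simp) (intro Cinf_add Cinf_power Cinf_linear fs o)
    show "Cinf (({l<..} \<times> P) \<times> (UNIV :: real set)) (\<lambda>x. snd (fst x) \<bullet> c)" for c
      by (rule Cinf_linear[OF o fs(3)])
    show "((snd x)\<^sup>2 + fst (fst x), snd (fst x)) \<in> {l<..} \<times> P" if "x \<in> ({l<..} \<times> P) \<times> UNIV" for x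
      using that by (auto intro: add_nonneg_pos order.strict_trans2)
  qed
  from Cinf_integral[OF this, of "{l<..} \<times> P" "-11" 11]
  show ?thesis
    using assms(2) by (simp add: h_def abel_par_def[abs_def] abel_def open_Times)
qed

lemma Cinf_abel_par_pow: "Cinf ({l<..} \<times> P) g \<Longrightarrow> open P \<Longrightarrow> Cinf ({l<..} \<times> P) ((abel_par ^^ k) g)"
  by (induction k) (auto intro: Cinf_abel_par)

definition neg_deriv :: "(real \<times> 'p::euclidean_space \<Rightarrow> real) \<Rightarrow> real \<times> 'p \<Rightarrow> real" where
  "neg_deriv g z = - partial g (1, 0) z"

lemma Cinf_neg_deriv: "Cinf W g \<Longrightarrow> Cinf W (neg_deriv g)"
  unfolding neg_deriv_def by (intro Cinf_minus Cinf_partial) (auto simp: Basis_prod_def)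

lemma Cinf_neg_deriv_pow: "Cinf W g \<Longrightarrow> Cinf W ((neg_deriv ^^ k) g)"
  by (induction k) (auto intro: Cinf_neg_deriv)

lemma partial_eq_0:
  assumes "open S" "z \<in> S" "\<And>w. w \<in> S \<Longrightarrow> g w = c" shows "partial g b z = 0"
proof -
  have "((\<lambda>w. c) has_derivative (\<lambda>h. 0)) (at z)" by simp
  then have "(g has_derivative (\<lambda>h. 0)) (at z)"
    by (rule has_derivative_transform_within_open[OF _ assms(1,2)]) (use assms in auto)
  from frechet_derivative_at[OF this] show ?thesis by metis
qed

lemma neg_deriv_vanish:
  assumes "open P" "\<And>s p. s > 100 \<Longrightarrow> p \<in> P \<Longrightarrow> g (s, p) = 0" "s > 100" "p \<in> P"
  shows "neg_deriv g (s, p) = 0"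
  unfolding neg_deriv_def using assms by (subst partial_eq_0[of "{100<..} \<times> P" _ _ 0]) (auto intro!: open_Times)

lemma neg_deriv_pow_vanish:
  assumes "open P" "\<And>s p. s > 100 \<Longrightarrow> p \<in> P \<Longrightarrow> g (s, p) = 0" "s > 100" "p \<in> P"
  shows "(neg_deriv ^^ k) g (s, p) = 0"
  using assms(3,4)
proof (induction k arbitrary: s p)
  case (Suc k)
  then show ?case
    using neg_deriv_vanish[of P "(neg_deriv ^^ k) g" s p] assms(1) by simp
qed (use assms in auto)

lemma admissible_slice:
  assumes "Cinf ({l<..} \<times> P) g" "\<And>s p. s > 100 \<Longrightarrow> p \<in> P \<Longrightarrow> g (s, p) = 0" "p \<in> P" "-1 \<le> l"
  shows "admissible l (\<lambda>t. g (t, p))"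
  unfolding admissible_def
proof (intro conjI)
  show "continuous_on {l<..} (\<lambda>t. g (t, p))"
    by (rule continuous_on_compose2[OF Cinf_continuous[OF assms(1)]]) (use assms(3) in \<open>auto intro!: continuous_intros\<close>)
qed (use assms in auto)

lemma has_real_derivative_slice:
  assumes "Cinf ({l<..} \<times> P) g" "p \<in> P" "t > l"
  shows "((\<lambda>t. g (t, p)) has_real_derivative - neg_deriv g (t, p)) (at t)"
proof -
  have D: "(g has_derivative frechet_derivative g (at (t, p))) (at (t, p))"
    by (rule Cinf_has_derivative[OF assms(1)]) (use assms in auto)
  have 1: "((\<lambda>t. g (t, p)) has_derivative (\<lambda>h. frechet_derivative g (at (t, p)) (h, 0))) (at t)"
    using has_derivative_compose[OF has_derivative_Pair[OF has_derivative_ident has_derivative_const] D] .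
  have "frechet_derivative g (at (t, p)) (h, 0) = partial g (1, 0) (t, p) * h" for h
    using linear_scale[OF has_derivative_linear[OF D], of h "(1, 0)"] by (simp add: mult.commute)
  then have 2: "(\<lambda>h. frechet_derivative g (at (t, p)) (h, 0)) = (*) (- neg_deriv g (t, p))"
    unfolding neg_deriv_def minus_minus by (rule ext)
  from 1[unfolded 2] show ?thesis unfolding has_field_derivative_def .
qed

text \<open>Powers of the transform commute, so two of the transforms can be kept for last: the
  induction hypothesis for \<open>neg_deriv g\<close> yields pi^k times that function, and
  \<open>abel_abel_derivative\<close> undoes the remaining derivative.\<close>

lemma abel_par_inverse:
  assumes g: "Cinf ({l<..} \<times> P) g" "\<And>s p. s > 100 \<Longrightarrow> p \<in> P \<Longrightarrow> g (s, p) = 0"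
    and "open P" "-1 \<le> l" "s > l" "p \<in> P"
  shows "(abel_par ^^ k) ((abel_par ^^ k) ((neg_deriv ^^ k) g)) (s, p) = pi ^ k * g (s, p)"
  using g \<open>s > l\<close>
proof (induction k arbitrary: g s)
  case (Suc k)
  let ?T = "\<lambda>f. (abel_par ^^ k) ((abel_par ^^ k) f)"
  have dg: "Cinf ({l<..} \<times> P) (neg_deriv g)" "\<And>s p. s > 100 \<Longrightarrow> p \<in> P \<Longrightarrow> neg_deriv g (s, p) = 0"
    using Cinf_neg_deriv[OF Suc.prems(1)] neg_deriv_vanish[of P g, OF \<open>open P\<close>] Suc.prems(2) by auto
  have "(abel_par ^^ Suc k) ((abel_par ^^ Suc k) ((neg_deriv ^^ Suc k) g)) (s, p) = (abel ^^ 2) (\<lambda>t. ?T ((neg_deriv ^^ k) (neg_deriv g)) (t, p)) s"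
  proof -
    have "(neg_deriv ^^ Suc k) g = (neg_deriv ^^ k) (neg_deriv g)" by (simp add: funpow_swap1)
    moreover have "(abel_par ^^ Suc k) ((abel_par ^^ Suc k) x) = abel_par (abel_par (?T x))" for x :: "real \<times> 'a \<Rightarrow> real"
    proof -
      have "(abel_par ^^ Suc k) ((abel_par ^^ Suc k) x) = abel_par ((abel_par ^^ k) (abel_par ((abel_par ^^ k) x)))" by simp
      also have "(abel_par ^^ k) (abel_par ((abel_par ^^ k) x)) = abel_par (?T x)" by (rule funpow_swap1[symmetric])
      finally show ?thesis .
    qed
    ultimately show ?thesis by (simp add: abel_par_def numeral_2_eq_2)
  qed
  also have "\<dots> = (abel ^^ 2) (\<lambda>t. pi ^ k * neg_deriv g (t, p)) s"
    by (rule abel_pow_cong) (use Suc.IH[OF dg] Suc.prems in auto)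
  also have "\<dots> = pi ^ k * (abel ^^ 2) (\<lambda>t. neg_deriv g (t, p)) s" by (simp add: abel_pow_cmult)
  also have "(abel ^^ 2) (\<lambda>t. neg_deriv g (t, p)) s = abel (abel (\<lambda>t. - (- neg_deriv g (t, p)))) s"
    by (simp add: numeral_2_eq_2)
  also have "\<dots> = pi * g (s, p)"
    by (rule abel_abel_derivative[where l=l and g="\<lambda>t. g (t, p)"])
      (use admissible_slice[OF dg \<open>p \<in> P\<close> \<open>-1 \<le> l\<close>] admissible_slice[OF Suc.prems(1,2) \<open>p \<in> P\<close> \<open>-1 \<le> l\<close>] Suc.prems
        has_real_derivative_slice[OF Suc.prems(1) \<open>p \<in> P\<close>] admissible_pos_part(3) in auto)
  finally show ?case by simp
qed auto

section \<open>Sections of bodies of revolution\<close>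

text \<open>The profile takes the squared distance from the axis, the argument in which the
  transform acts.\<close>

definition rotbody :: "'n::finite \<Rightarrow> (real \<Rightarrow> real \<Rightarrow> bool) \<Rightarrow> (real^'n) set" where
  "rotbody k P = {x. P (x $ k) ((norm x)\<^sup>2 - (x $ k)\<^sup>2)}"

lemma norm_sq_minus: "(norm (x :: real^'n))\<^sup>2 - (x $ k)\<^sup>2 = (\<Sum>i\<in>-{k}. (x $ i)\<^sup>2)"
proof -
  have "(norm x)\<^sup>2 = (\<Sum>i\<in>UNIV. (x $ i)\<^sup>2)"
    by (simp only: power2_norm_eq_inner inner_vec_def) (simp add: power2_eq_square)
  also have "\<dots> = (x $ k)\<^sup>2 + (\<Sum>i\<in>-{k}. (x $ i)\<^sup>2)"
    by (subst sum.remove[of _ k]) (auto simp: Compl_eq_Diff_UNIV)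
  finally show ?thesis by simp
qed

lemma orthogonal_fix_nth:
  assumes "orthogonal_transformation T" "T (axis k 1) = axis k (1::real)"
  shows "T x $ k = x $ k"
proof -
  have "T x $ k = T x \<bullet> T (axis k 1)" unfolding assms(2) by (simp add: inner_axis)
  also have "\<dots> = x $ k" using assms(1) by (simp add: orthogonal_transformation_def inner_axis)
  finally show ?thesis .
qed

lemma rotbody_invariant:
  assumes "orthogonal_transformation T" "T (axis k 1) = axis k (1::real)"
  shows "T x \<in> rotbody k P \<longleftrightarrow> x \<in> rotbody k P"
  using orthogonal_fix_nth[OF assms, of x] assms(1) by (simp add: rotbody_def orthogonal_transformation)

lemma rotbody_image:
  assumes "orthogonal_transformation T" "T (axis k 1) = axis k (1::real)"
  shows "T ` rotbody k P = rotbody k P"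
  using rotbody_invariant[OF assms] orthogonal_transformation_surj[OF assms(1)]
  by (auto simp: surj_def) (metis imageI)

lemma body_of_revolution_rotbody: "body_of_revolution (axis k 1) (rotbody k P)"
  unfolding body_of_revolution_def using rotbody_image by blast

section \<open>Prisms over hyperplane sections\<close>

definition prism :: "'a::euclidean_space \<Rightarrow> 'a set \<Rightarrow> 'a set" where
  "prism u A = {a + s *\<^sub>R u | a s. a \<in> A \<and> s \<in> {0..1}}"

lemma hyp_volume_prism: "hyp_volume u A = measure lebesgue (prism u A)"
  by (simp add: hyp_volume_def prism_def)

lemma hyperplane_at_eq: "norm u = 1 \<Longrightarrow> hyperplane_at u t = {x. x \<bullet> u = t}"
proof (intro set_eqI iffI)
  fix x assume u: "norm u = 1"
  have uu: "u \<bullet> u = 1" using u by (simp add: dot_square_norm)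
  { assume "x \<in> hyperplane_at u t" then show "x \<in> {x. x \<bullet> u = t}"
      using uu by (auto simp: hyperplane_at_def inner_add_left) }
  { assume "x \<in> {x. x \<bullet> u = t}"
    then have "x = (x - t *\<^sub>R u) + t *\<^sub>R u \<and> (x - t *\<^sub>R u) \<bullet> u = 0" using uu by (simp add: inner_diff_left)
    then show "x \<in> hyperplane_at u t" unfolding hyperplane_at_def by blast }
qed

lemma prism_image: "prism u A = (\<lambda>(a, s). a + s *\<^sub>R u) ` (A \<times> {0..1})"
  unfolding prism_def by force

lemma compact_prism:
  assumes "compact A" shows "compact (prism u A)"
proof -
  show ?thesis
    unfolding prism_image by (intro compact_continuous_image compact_Times assms compact_Icc) (auto simp: split_beta intro!: continuous_intros)
qed

lemma compact_section: "compact K \<Longrightarrow> norm u = 1 \<Longrightarrow> compact (K \<inter> hyperplane_at u t)"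
proof (intro compact_Int_closed)
  assume "norm u = 1"
  moreover have "closed {x. x \<bullet> u = t}"
    using closed_hyperplane[of u t] by (simp add: inner_commute)
  ultimately show "closed (hyperplane_at u t)" by (simp add: hyperplane_at_eq)
qed auto

text \<open>Serves to replace the normal by a vector in the span of the axis and one further
  coordinate direction.\<close>

lemma prism_orthogonal:
  assumes T: "orthogonal_transformation T" and "T ` K = K" "norm u = 1"
  shows "prism (T u) (K \<inter> hyperplane_at (T u) t) = T ` prism u (K \<inter> hyperplane_at u t)"
proof -
  have lin: "linear T" using T orthogonal_transformation_linear by blast
  have nT: "norm (T u) = 1" using T assms by (simp add: orthogonal_transformation)
  have ip: "T a \<bullet> T u = a \<bullet> u" for a using T by (simp add: orthogonal_transformation_def)
  have "K \<inter> hyperplane_at (T u) t = T ` (K \<inter> hyperplane_at u t)"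
  proof (intro set_eqI iffI)
    fix x assume x: "x \<in> K \<inter> hyperplane_at (T u) t"
    then obtain a where "a \<in> K" "x = T a" using \<open>T ` K = K\<close> by blast
    then show "x \<in> T ` (K \<inter> hyperplane_at u t)"
      using x ip by (auto simp: hyperplane_at_eq nT assms(3))
  next
    fix x assume "x \<in> T ` (K \<inter> hyperplane_at u t)"
    then show "x \<in> K \<inter> hyperplane_at (T u) t"
      using \<open>T ` K = K\<close> ip by (auto simp: hyperplane_at_eq nT assms(3))
  qed
  moreover have "prism (T u) (T ` A) = T ` prism u A" for A
  proof -
    have "T (a + s *\<^sub>R u) = T a + s *\<^sub>R T u" for a s using lin by (simp add: linear_add linear_scale)
    then have "(\<lambda>(a, s). a + s *\<^sub>R T u) ` (T ` A \<times> {0..1}) = T ` (\<lambda>(a, s). a + s *\<^sub>R u) ` (A \<times> {0..1})"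
      by (force simp: image_iff)
    then show ?thesis unfolding prism_image .
  qed
  ultimately show ?thesis by simp
qed

section \<open>Reflections that fix the axis\<close>

definition reflect :: "'a::euclidean_space \<Rightarrow> 'a \<Rightarrow> 'a" where
  "reflect v x = x - (2 * (x \<bullet> v) / (v \<bullet> v)) *\<^sub>R v"

lemma orthogonal_reflect: "orthogonal_transformation (reflect v)"
proof (cases "v = 0")
  case True
  then have "reflect v = id" by (auto simp: reflect_def)
  then show ?thesis by (simp add: orthogonal_transformation_id[unfolded id_def[symmetric]] orthogonal_transformation_def linear_id)
next
  case False
  show ?thesis
    unfolding orthogonal_transformation_def
  proof (intro conjI allI)
    show "linear (reflect v)"
      by (rule linearI)
        (simp_all add: reflect_def inner_add_left distrib_left add_divide_distrib scaleR_add_left scaleR_diff_right)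
    fix x y
    show "reflect v x \<bullet> reflect v y = x \<bullet> y"
    proof -
      define c where "c x = 2 * (x \<bullet> v) / (v \<bullet> v)" for x
      have c: "c x * (v \<bullet> v) = 2 * (x \<bullet> v)" for x using False by (simp add: c_def)
      have "reflect v x \<bullet> reflect v y = x \<bullet> y - c y * (x \<bullet> v) - c x * (y \<bullet> v) + c y * (c x * (v \<bullet> v))"
        unfolding reflect_def c_def[symmetric]
        by (simp add: inner_diff_left inner_diff_right inner_commute[of v y] algebra_simps)
      also have "\<dots> = x \<bullet> y" unfolding c by (simp add: c_def)
      finally show ?thesis .
    qed
  qed
qed

lemma reflect_swap:
  assumes "norm a = norm b" shows "reflect (a - b) b = a"
proof (cases "a = b")
  case False
  have "a \<bullet> a = b \<bullet> b" using assms by (simp add: dot_square_norm)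
  then have "(a - b) \<bullet> (a - b) = - 2 * (b \<bullet> (a - b))"
    by (simp add: inner_diff_left inner_diff_right inner_commute)
  moreover have "(a - b) \<bullet> (a - b) \<noteq> 0" using False by simp
  ultimately have "2 * (b \<bullet> (a - b)) / ((a - b) \<bullet> (a - b)) = -1" by (simp add: field_simps)
  then show ?thesis by (simp add: reflect_def)
qed (simp add: reflect_def)

text \<open>The reflection exchanging the component of u orthogonal to the axis with the vector of
  equal length along coordinate j fixes the axis, because both vectors are orthogonal to it.\<close>

lemma exists_rotation_to_plane:
  fixes u :: "real^'n"
  assumes "norm u = 1" "j \<noteq> k"
  obtains T :: "real^'n \<Rightarrow> real^'n" where "orthogonal_transformation T" "T (axis k 1) = axis k 1"
    "u = T ((u $ k) *\<^sub>R axis k 1 + sqrt (1 - (u $ k)\<^sup>2) *\<^sub>R axis j 1)"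
proof -
  define w where "w = u - (u $ k) *\<^sub>R axis k 1"
  define b :: "real^'n" where "b = sqrt (1 - (u $ k)\<^sup>2) *\<^sub>R axis j 1"
  have wk: "w \<bullet> axis k 1 = 0" by (simp add: w_def inner_diff_left inner_axis)
  have bk: "b \<bullet> axis k 1 = 0" using assms by (simp add: b_def inner_axis_axis)
  have "w \<bullet> w = 1 - (u $ k)\<^sup>2"
  proof -
    have "u \<bullet> u = 1" using assms(1) by (simp add: dot_square_norm)
    then show ?thesis
      unfolding w_def inner_diff_left inner_diff_right
      by (simp add: inner_axis inner_axis' inner_axis_axis power2_eq_square)
  qed
  moreover have "(u $ k)\<^sup>2 \<le> 1"
    using component_le_norm_cart[of u k] assms(1) by (simp add: abs_square_le_1)
  ultimately have n: "norm w = norm b" by (simp add: b_def norm_eq_sqrt_inner[of w])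
  let ?T = "reflect (w - b)"
  have Tk: "?T (axis k 1) = axis k 1"
    using wk bk by (simp add: reflect_def inner_diff_right inner_commute)
  have "linear ?T" using orthogonal_reflect orthogonal_transformation_linear by blast
  then have "?T ((u $ k) *\<^sub>R axis k 1 + b) = (u $ k) *\<^sub>R axis k 1 + w"
    using reflect_swap[OF n] Tk by (simp add: linear_add linear_scale)
  also have "\<dots> = u" by (simp add: w_def)
  finally show ?thesis using that[OF orthogonal_reflect[of "w - b"] Tk] by (simp add: b_def)
qed

text \<open>The library computes the measure of linear images only for well-ordered index types, hence this
  well-ordered copy of a finite type.\<close>

typedef (overloaded) 'a ranked = "UNIV :: 'a set" morphisms unrank mk_ranked
  by auto

instance ranked :: (finite) finite
proof
  have "(UNIV :: 'a ranked set) = mk_ranked ` UNIV" by (metis UNIV_I mk_ranked_cases surj_def)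
  then show "finite (UNIV :: 'a ranked set)" by (metis finite_class.finite_UNIV finite_imageI)
qed

definition rank_nat :: "'a::finite ranked \<Rightarrow> nat" where
  "rank_nat = (SOME f. inj f)"

lemma inj_rank_nat: "inj (rank_nat :: 'a::finite ranked \<Rightarrow> nat)"
  proof -
  have "\<exists>f :: 'a ranked \<Rightarrow> nat. inj f" by (metis finite_class.finite_UNIV finite_imp_inj_to_nat_seg)
  then show ?thesis unfolding rank_nat_def by (rule someI_ex)
qed

instantiation ranked :: (finite) wellorder
begin
definition "x \<le> y \<longleftrightarrow> rank_nat x \<le> rank_nat (y :: 'a ranked)"
definition "x < y \<longleftrightarrow> rank_nat x < rank_nat (y :: 'a ranked)"
instance
proof
  fix P :: "'a ranked \<Rightarrow> bool" and a
  assume *: "\<And>x. (\<And>y. y < x \<Longrightarrow> P y) \<Longrightarrow> P x"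
  show "P a"
    by (induction a rule: measure_induct_rule[of rank_nat]) (use * in \<open>auto simp: less_ranked_def\<close>)
qed (use injD[OF inj_rank_nat] in \<open>auto simp: less_eq_ranked_def less_ranked_def\<close>)
end

definition relabel :: "real^'n \<Rightarrow> real^('n ranked)" where
  "relabel x = (\<chi> i. x $ unrank i)"

definition unlabel :: "real^('n ranked) \<Rightarrow> real^'n" where
  "unlabel x = (\<chi> i. x $ mk_ranked i)"

lemma unlabel_relabel [simp]: "unlabel (relabel x) = x"
  by (simp add: relabel_def unlabel_def vec_eq_iff mk_ranked_inverse)

lemma linear_relabel: "linear relabel"
  by (intro linearI) (auto simp: relabel_def vec_eq_iff)

lemma linear_unlabel: "linear unlabel"
  by (intro linearI) (auto simp: unlabel_def vec_eq_iff)

lemma bij_mk_ranked: "bij mk_ranked"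
  by (metis UNIV_I bijI' mk_ranked_cases mk_ranked_inject)

text \<open>Between different index types there is no determinant to evaluate; the pushforward of
  Lebesgue measure is identified by its values on boxes.\<close>

lemma measure_relabel:
  fixes S :: "(real^'n) set"
  assumes "compact S" shows "measure lebesgue (relabel ` S) = measure lebesgue S"
proof -
  have m [measurable]: "(relabel :: real^'n \<Rightarrow> _) \<in> borel_measurable borel"
    by (intro borel_measurable_continuous_onI linear_continuous_on linear_conv_bounded_linear[THEN iffD1] linear_relabel)
  have d: "(lborel :: (real^('n ranked)) measure) = distr (lborel :: (real^'n) measure) borel relabel"
  proof (rule lborel_eqI)
    fix l u :: "real^('n ranked)"
    assume le: "\<And>b. b \<in> Basis \<Longrightarrow> l \<bullet> b \<le> u \<bullet> b"
    have le': "l $ i \<le> u $ i" for i using le[of "axis i 1"] by (simp add: inner_axis axis_in_Basis_iff)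
    have "relabel -` box l u = box (unlabel l) (unlabel u)"
    proof -
      have "(\<forall>i. l $ i < x $ unrank i \<and> x $ unrank i < u $ i) \<longleftrightarrow>
        (\<forall>i. l $ mk_ranked i < x $ i \<and> x $ i < u $ mk_ranked i)" for x :: "real^'n"
        by (metis mk_ranked_inverse unrank_inverse UNIV_I)
      then show ?thesis by (auto simp: mem_box_cart relabel_def unlabel_def)
    qed
    then have "emeasure (distr (lborel :: (real^'n) measure) borel relabel) (box l u) = emeasure lborel (box (unlabel l) (unlabel u :: real^'n))"
      by (subst emeasure_distr) auto
    also have "\<dots> = (\<Prod>b\<in>Basis. (unlabel u - unlabel l :: real^'n) \<bullet> b)"
      by (rule emeasure_lborel_box) (auto simp: Basis_vec_def inner_axis unlabel_def le')
    also have "(\<Prod>b\<in>Basis. (unlabel u - unlabel l :: real^'n) \<bullet> b) = (\<Prod>i\<in>UNIV. u $ mk_ranked i - l $ mk_ranked (i::'n))"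
      by (subst Basis_vec_def, simp, subst prod.UNION_disjoint) (auto simp: axis_eq_axis inner_axis unlabel_def)
    also have "\<dots> = (\<Prod>i\<in>UNIV. u $ i - l $ (i :: 'n ranked))"
      by (rule prod.reindex_bij_betw[OF bij_mk_ranked])
    also have "\<dots> = (\<Prod>b\<in>Basis. (u - l) \<bullet> b)"
      by (subst Basis_vec_def, simp, subst prod.UNION_disjoint) (auto simp: axis_eq_axis inner_axis)
    finally show "emeasure (distr (lborel :: (real^'n) measure) borel relabel) (box l u) = (\<Prod>b\<in>Basis. (u - l) \<bullet> b)" .
  qed simp
  have c: "compact (relabel ` S)"
    by (intro compact_continuous_image linear_continuous_on linear_conv_bounded_linear[THEN iffD1] linear_relabel assms)
  have "relabel -` (relabel ` S) = S" by (metis inj_on_def inj_vimage_image_eq unlabel_relabel)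
  then have "emeasure lborel (relabel ` S) = emeasure lborel S"
    using c by (subst d, subst emeasure_distr) (auto simp: borel_compact)
  then show ?thesis using c assms by (simp add: measure_def borel_compact)
qed

text \<open>Only a factor independent of S is needed: K and L are compared for the same normal, so
  the determinant never has to be computed.\<close>

lemma measure_linear_image_factor:
  fixes M :: "real^'n \<Rightarrow> real^'n"
  assumes "linear M"
  shows "\<exists>C\<ge>0. \<forall>S. compact S \<longrightarrow> measure lebesgue (M ` S) = C * measure lebesgue S"
proof (intro exI conjI allI impI)
  let ?M = "relabel \<circ> M \<circ> unlabel"
  show "0 \<le> \<bar>det (matrix ?M)\<bar>" by simp
  fix S :: "(real^'n) set" assume S: "compact S"
  have lin: "linear ?M" by (intro linear_compose linear_unlabel linear_relabel assms)
  have cont: "continuous_on A f" if "linear f" for A and f :: "real^'n \<Rightarrow> real^'b"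
    using that by (simp add: linear_continuous_on linear_conv_bounded_linear)
  have "measure lebesgue (M ` S) = measure lebesgue (relabel ` M ` S)"
    by (rule measure_relabel[symmetric]) (intro compact_continuous_image cont assms S)
  also have "relabel ` M ` S = ?M ` relabel ` S" by (simp add: image_image)
  also have "measure lebesgue \<dots> = \<bar>det (matrix ?M)\<bar> * measure lebesgue (relabel ` S)"
    by (intro measure_linear_image lin lmeasurable_compact compact_continuous_image cont linear_relabel S)
  finally show "measure lebesgue (M ` S) = \<bar>det (matrix ?M)\<bar> * measure lebesgue S"
    using measure_relabel[OF S] by simp
qed

text \<open>The shear and rotation taking this set to the prism over a hyperplane section depend only on the
  normal vector; coordinate j runs along the height of the prism.\<close>

definition slab :: "'n::finite \<Rightarrow> 'n \<Rightarrow> (real \<Rightarrow> real \<Rightarrow> bool) \<Rightarrow> real \<Rightarrow> real \<Rightarrow> (real^'n) set" where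
  "slab k j P \<alpha> \<beta> = {x. 0 \<le> x $ j \<and> x $ j \<le> 1 \<and> P (x $ k) ((\<alpha> - \<beta> * x $ k)\<^sup>2 + (\<Sum>i\<in>-{k,j}. (x $ i)\<^sup>2))}"

text \<open>The volume of the section x_j = \<alpha> - \<beta> z up to a factor: z runs along the
  axis, and the remaining d coordinates are integrated out radially.\<close>

definition sec_vol :: "nat \<Rightarrow> (real \<Rightarrow> real \<Rightarrow> bool) \<Rightarrow> real \<Rightarrow> real \<Rightarrow> ennreal" where
  "sec_vol d P \<alpha> \<beta> = (\<integral>\<^sup>+z. (nn_abel ^^ d) (\<lambda>a. of_bool (P z a)) ((\<alpha> - \<beta> * z)\<^sup>2) \<partial>lborel)"

lemma rotbody_fun_upd:
  assumes "j \<noteq> k"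
  shows "x + (y - x $ j) *\<^sub>R axis j 1 \<in> rotbody k P \<longleftrightarrow> P (x $ k) (y\<^sup>2 + (\<Sum>i\<in>-{k,j}. (x $ i)\<^sup>2))"
proof -
  have "- {k} = insert j (- {k, j})" using assms by auto
  then have "(\<Sum>i\<in>-{k}. ((x + (y - x $ j) *\<^sub>R axis j 1) $ i)\<^sup>2) = y\<^sup>2 + (\<Sum>i\<in>-{k,j}. (x $ i)\<^sup>2)"
    by (simp add: axis_def)
  then show ?thesis using assms by (simp add: rotbody_def norm_sq_minus axis_def)
qed

lemma compact_subset_closed:
  "closed (S :: 'a::t2_space set) \<Longrightarrow> compact C \<Longrightarrow> S \<subseteq> C \<Longrightarrow> compact S"
  by (metis compact_Int_closed inf.absorb_iff2)

lemma compact_slab: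
  assumes "compact (rotbody k P)" "j \<noteq> k" shows "compact (slab k j P \<alpha> \<beta>)"
proof -
  define g where "g x = x + ((\<alpha> - \<beta> * x $ k) - x $ j) *\<^sub>R axis j 1" for x :: "real^'a"
  have eq: "slab k j P \<alpha> \<beta> = {x. 0 \<le> x $ j} \<inter> {x. x $ j \<le> 1} \<inter> g -` rotbody k P"
    using rotbody_fun_upd[OF assms(2)] by (auto simp: slab_def g_def)
  have "continuous_on UNIV g" unfolding g_def by (intro continuous_intros)
  then have cl: "closed (slab k j P \<alpha> \<beta>)"
    unfolding eq by (intro closed_Int closed_vimage compact_imp_closed assms closed_Collect_le continuous_intros) auto
  have "compact ((\<lambda>(a, s). a + (s - a $ j) *\<^sub>R axis j 1) ` (rotbody k P \<times> {0..1}))"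
    by (intro compact_continuous_image compact_Times assms compact_Icc) (auto simp: split_beta intro!: continuous_intros)
  moreover have "slab k j P \<alpha> \<beta> \<subseteq> (\<lambda>(a, s). a + (s - a $ j) *\<^sub>R axis j 1) ` (rotbody k P \<times> {0..1})"
  proof
    fix x assume "x \<in> slab k j P \<alpha> \<beta>"
    then have "g x \<in> rotbody k P" "x $ j \<in> {0..1}" by (auto simp: eq)
    moreover have "x = g x + (x $ j - g x $ j) *\<^sub>R axis j 1"
      by (simp add: g_def axis_def algebra_simps flip: scaleR_add_left)
    ultimately show "x \<in> (\<lambda>(a, s). a + (s - a $ j) *\<^sub>R axis j 1) ` (rotbody k P \<times> {0..1})"
      by (intro image_eqI[of _ _ "(g x, x $ j)"]) auto
  qed
  ultimately show ?thesis by (rule compact_subset_closed[OF cl])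
qed

text \<open>Tonelli: the axial coordinate is split off first, then coordinate j, which contributes
  the length 1; the other n - 2 coordinates enter only through their sum of squares.\<close>

lemma emeasure_slab:
  fixes k j :: "'n::finite"
  assumes [measurable]: "Measurable.pred (borel \<Otimes>\<^sub>M borel) (\<lambda>(z, a). P z a)" and "j \<noteq> k"
    and comp: "compact (rotbody k P)"
  shows "emeasure lborel (slab k j P \<alpha> \<beta>) = sec_vol (CARD('n) - 2) P \<alpha> \<beta>"
proof -
  interpret product_sigma_finite "\<lambda>_. lborel :: real measure" ..
  let ?e = "\<lambda>i. axis i 1 :: real^'n"
  define f :: "real \<Rightarrow> real \<Rightarrow> real \<Rightarrow> ennreal" where "f z s t = of_bool (P z ((\<alpha> - \<beta> * z)\<^sup>2 + t)) * (of_bool (0 \<le> s \<and> s \<le> 1) :: ennreal)" for z s t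
  have [measurable]: "(\<lambda>p. f (f1 p) (f2 p) (f3 p)) \<in> borel_measurable M"
    if [measurable]: "f1 \<in> borel_measurable M" "f2 \<in> borel_measurable M" "f3 \<in> borel_measurable M" for f1 f2 f3 and M :: "'z measure"
    unfolding f_def by measurable
  have inj: "inj_on ?e A" for A by (auto simp: inj_on_def axis_eq_axis)
  let ?I = "?e ` (-{k,j})"
  have B: "(Basis :: (real^'n) set) = insert (?e k) (insert (?e j) ?I)"
    by (auto simp: Basis_vec_def)
  have nk: "?e k \<notin> insert (?e j) ?I" "?e j \<notin> ?I" using \<open>j \<noteq> k\<close> by (auto simp: axis_eq_axis)
  have sets: "slab k j P \<alpha> \<beta> \<in> sets borel"
    using compact_slab[OF comp \<open>j \<noteq> k\<close>] by (simp add: borel_compact)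
  have "emeasure lborel (slab k j P \<alpha> \<beta>) = (\<integral>\<^sup>+x. indicator (slab k j P \<alpha> \<beta>) x \<partial>lborel)"
    using sets by simp
  also have "\<dots> = (\<integral>\<^sup>+x. f (x $ k) (x $ j) (\<Sum>i\<in>-{k,j}. (x $ i)\<^sup>2) \<partial>lborel)"
    by (intro nn_integral_cong) (auto simp: f_def slab_def indicator_def)
  also have "\<dots> = (\<integral>\<^sup>+\<omega>. f (\<omega> (?e k)) (\<omega> (?e j)) (\<Sum>i\<in>-{k,j}. (\<omega> (?e i))\<^sup>2) \<partial>Pi\<^sub>M Basis (\<lambda>_. lborel))"
  proof -
    have comp: "(\<Sum>b\<in>Basis. \<omega> b *\<^sub>R b) $ i = \<omega> (?e i)" for \<omega> and i :: 'n
    proof -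
      have "(\<Sum>b\<in>Basis. \<omega> b *\<^sub>R b) $ i = (\<Sum>b\<in>Basis. \<omega> b *\<^sub>R b) \<bullet> ?e i" by (simp add: inner_axis)
      also have "\<dots> = \<omega> (?e i)" by (rule inner_sum_left_Basis) (simp add: axis_in_Basis_iff)
      finally show ?thesis .
    qed
    have [measurable]: "(\<lambda>x :: real^'n. x $ i) \<in> borel_measurable borel" for i by simp
    show ?thesis
      by (subst lborel_eq, subst nn_integral_distr) (simp_all only: comp, measurable)
  qed
  also have "\<dots> = (\<integral>\<^sup>+z. \<integral>\<^sup>+\<omega>. f ((fun_upd \<omega> (?e k) z) (?e k)) ((fun_upd \<omega> (?e k) z) (?e j)) (\<Sum>i\<in>-{k,j}. ((fun_upd \<omega> (?e k) z) (?e i))\<^sup>2)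
       \<partial>Pi\<^sub>M (insert (?e j) ?I) (\<lambda>_. lborel) \<partial>lborel)"
    unfolding B using nk by (intro product_nn_integral_insert_rev) auto
  also have "\<dots> = (\<integral>\<^sup>+z. \<integral>\<^sup>+s. \<integral>\<^sup>+\<omega>. f z s (\<Sum>b\<in>?I. (\<omega> b)\<^sup>2) \<partial>Pi\<^sub>M ?I (\<lambda>_. lborel) \<partial>lborel \<partial>lborel)"
  proof -
    show "(\<integral>\<^sup>+z. \<integral>\<^sup>+\<omega>. f ((fun_upd \<omega> (?e k) z) (?e k)) ((fun_upd \<omega> (?e k) z) (?e j)) (\<Sum>i\<in>-{k,j}. ((fun_upd \<omega> (?e k) z) (?e i))\<^sup>2)
       \<partial>Pi\<^sub>M (insert (?e j) ?I) (\<lambda>_. lborel) \<partial>lborel)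
     = (\<integral>\<^sup>+z. \<integral>\<^sup>+s. \<integral>\<^sup>+\<omega>. f z s (\<Sum>b\<in>?I. (\<omega> b)\<^sup>2) \<partial>Pi\<^sub>M ?I (\<lambda>_. lborel) \<partial>lborel \<partial>lborel)"
    proof (intro nn_integral_cong)
      fix z :: real
      have "(\<integral>\<^sup>+\<omega>. f ((fun_upd \<omega> (?e k) z) (?e k)) ((fun_upd \<omega> (?e k) z) (?e j)) (\<Sum>i\<in>-{k,j}. ((fun_upd \<omega> (?e k) z) (?e i))\<^sup>2)
         \<partial>Pi\<^sub>M (insert (?e j) ?I) (\<lambda>_. lborel)) = (\<integral>\<^sup>+\<omega>. f z (\<omega> (?e j)) (\<Sum>b\<in>?I. (\<omega> b)\<^sup>2) \<partial>Pi\<^sub>M (insert (?e j) ?I) (\<lambda>_. lborel))"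
        using \<open>j \<noteq> k\<close> by (intro nn_integral_cong) (auto simp: axis_eq_axis sum.reindex[OF inj])
      also have "\<dots> = (\<integral>\<^sup>+s. \<integral>\<^sup>+\<omega>. f z ((fun_upd \<omega> (?e j) s) (?e j)) (\<Sum>b\<in>?I. ((fun_upd \<omega> (?e j) s) b)\<^sup>2) \<partial>Pi\<^sub>M ?I (\<lambda>_. lborel) \<partial>lborel)"
        using nk by (intro product_nn_integral_insert_rev) auto
      also have "\<dots> = (\<integral>\<^sup>+s. \<integral>\<^sup>+\<omega>. f z s (\<Sum>b\<in>?I. (\<omega> b)\<^sup>2) \<partial>Pi\<^sub>M ?I (\<lambda>_. lborel) \<partial>lborel)"
        by (intro nn_integral_cong) (use \<open>j \<noteq> k\<close> in \<open>auto simp: axis_eq_axis split: if_splits intro!: arg_cong[where f="f _ _"] sum.cong\<close>)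
      finally show "(\<integral>\<^sup>+\<omega>. f ((fun_upd \<omega> (?e k) z) (?e k)) ((fun_upd \<omega> (?e k) z) (?e j)) (\<Sum>i\<in>-{k,j}. ((fun_upd \<omega> (?e k) z) (?e i))\<^sup>2)
         \<partial>Pi\<^sub>M (insert (?e j) ?I) (\<lambda>_. lborel)) = \<dots>" by simp
    qed
  qed
  also have "\<dots> = (\<integral>\<^sup>+z. \<integral>\<^sup>+s. (nn_abel ^^ card ?I) (\<lambda>a. of_bool (P z a)) ((\<alpha> - \<beta> * z)\<^sup>2) * indicator {0..1::real} s \<partial>lborel \<partial>lborel)"
  proof (intro nn_integral_cong, goal_cases)
    case (1 z s)
    have [measurable]: "Measurable.pred borel (P z)" by measurable
    show ?case
      unfolding f_def
      by (subst nn_integral_multc) (auto simp: indicator_def nn_integral_PiM_radial[where h="\<lambda>a. of_bool (P z a)"])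
  qed
  also have "\<dots> = sec_vol (card ?I) P \<alpha> \<beta>"
    unfolding sec_vol_def by (intro nn_integral_cong) (simp add: nn_integral_cmult)
  also have "card ?I = CARD('n) - 2"
    using \<open>j \<noteq> k\<close> by (simp add: card_image[OF inj] Compl_eq_Diff_UNIV card_Diff_subset)
  finally show ?thesis .
qed

text \<open>The order of quantifiers is the point: C depends on u alone and is thus common to both
  bodies and all offsets c. In the plane of the axis and coordinate j the hyperplane is the line x_j
  = c/sn - (u_k/sn) x_k, whence the two arguments of \<open>sec_vol\<close>.\<close>

lemma hyp_volume_rotbody:
  fixes u :: "real^'n"
  assumes "j \<noteq> k" and u: "norm u = 1" and uk: "\<bar>u $ k\<bar> < 1"
  defines "sn \<equiv> sqrt (1 - (u $ k)\<^sup>2)"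
  shows "\<exists>C\<ge>0. \<forall>P c. Measurable.pred (borel \<Otimes>\<^sub>M borel) (\<lambda>(z, a). P z a) \<longrightarrow> compact (rotbody k P) \<longrightarrow>
    hyp_volume u (rotbody k P \<inter> hyperplane_at u c) = C * enn2real (sec_vol (CARD('n) - 2) P (c / sn) (u $ k / sn))"
proof -
  \<comment> \<open>For x in the slab, x_j is the height s in the prism, and up to a translation by
    c/sn along j the map sends x to the prism point a + s u'.\<close>
  let ?M = "\<lambda>x::real^'n. x + (x $ j * u $ k) *\<^sub>R axis k 1 + (- (u $ k / sn) * x $ k + x $ j * sn - x $ j) *\<^sub>R axis j 1"
  have linM: "linear ?M" by (intro linearI) (auto simp: vec_eq_iff axis_def algebra_simps)
  define u' :: "real^'n" where "u' = (u $ k) *\<^sub>R axis k 1 + sn *\<^sub>R axis j 1"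
  obtain T where T: "orthogonal_transformation T" "T (axis k 1) = axis k 1" "u = T u'"
    using exists_rotation_to_plane[OF u \<open>j \<noteq> k\<close>] by (auto simp: u'_def sn_def)
  have u': "norm u' = 1" using T u by (simp add: orthogonal_transformation)
  have "(u $ k)\<^sup>2 < 1" using uk by (simp add: abs_square_less_1)
  then have sn: "sn > 0" by (simp add: sn_def)
  have linT: "linear T" using T(1) orthogonal_transformation_linear by blast
  obtain C where C: "C \<ge> 0" "\<And>S. compact S \<Longrightarrow> measure lebesgue ((T \<circ> ?M) ` S) = C * measure lebesgue S"
    using measure_linear_image_factor[OF linear_compose[OF linM linT]] by blast
  show ?thesis
  proof (intro exI[of _ C] conjI allI impI C(1))
  fix P c assume Pm: "Measurable.pred (borel \<Otimes>\<^sub>M borel) (\<lambda>(z, a). P z a)" and comp: "compact (rotbody k P)"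
  have "hyp_volume u (rotbody k P \<inter> hyperplane_at u c) = measure lebesgue (T ` prism u' (rotbody k P \<inter> hyperplane_at u' c))"
    unfolding T(3) hyp_volume_prism prism_orthogonal[OF T(1) rotbody_image[OF T(1,2)] u'] ..
  also have "prism u' (rotbody k P \<inter> hyperplane_at u' c) = (+) ((c / sn) *\<^sub>R axis j 1) ` (?M ` slab k j P (c / sn) (u $ k / sn))"
  proof -
    have inn: "a \<bullet> u' = u $ k * a $ k + sn * a $ j" for a
      by (simp add: u'_def inner_add_right inner_axis mult.commute)
    have "x \<in> prism u' (rotbody k P \<inter> hyperplane_at u' c) \<longleftrightarrow> x \<in> (+) ((c / sn) *\<^sub>R axis j 1) ` (?M ` slab k j P (c / sn) (u $ k / sn))" for x
    proof
      assume "x \<in> prism u' (rotbody k P \<inter> hyperplane_at u' c)"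
      then obtain a s where a: "x = a + s *\<^sub>R u'" "a \<in> rotbody k P" "u $ k * a $ k + sn * a $ j = c" "0 \<le> s" "s \<le> 1"
        by (auto simp: prism_def hyperplane_at_eq[OF u'] inn)
      define y where "y = a + (s - a $ j) *\<^sub>R axis j 1"
      have aj: "a $ j = c / sn - u $ k / sn * a $ k" using a(3) sn by (simp add: field_simps)
      have yk: "y $ k = a $ k" "y $ j = s" and yi: "i \<in> -{k,j} \<Longrightarrow> y $ i = a $ i" for i
        using \<open>j \<noteq> k\<close> by (auto simp: y_def axis_def)
      have "a = y + (a $ j - y $ j) *\<^sub>R axis j 1" by (simp add: yk) (simp add: y_def algebra_simps flip: scaleR_add_left)
      then have "P (y $ k) ((a $ j)\<^sup>2 + (\<Sum>i\<in>-{k,j}. (y $ i)\<^sup>2))"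
        using a(2) rotbody_fun_upd[OF \<open>j \<noteq> k\<close>, of y "a $ j"] by simp
      then have "y \<in> slab k j P (c / sn) (u $ k / sn)" using a aj by (simp add: slab_def yk)
      moreover have "x = (c / sn) *\<^sub>R axis j 1 + ?M y"
        unfolding vec_eq_iff
      proof
        fix i show "x $ i = ((c / sn) *\<^sub>R axis j 1 + ?M y) $ i"
          using \<open>j \<noteq> k\<close> sn aj by (auto simp: a(1) u'_def axis_def y_def algebra_simps)
      qed
      ultimately show "x \<in> (+) ((c / sn) *\<^sub>R axis j 1) ` (?M ` slab k j P (c / sn) (u $ k / sn))" by blast
    next
      assume "x \<in> (+) ((c / sn) *\<^sub>R axis j 1) ` (?M ` slab k j P (c / sn) (u $ k / sn))"
      then obtain y where y: "y \<in> slab k j P (c / sn) (u $ k / sn)" "x = (c / sn) *\<^sub>R axis j 1 + ?M y" by blast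
      define a where "a = y + ((c / sn - u $ k / sn * y $ k) - y $ j) *\<^sub>R axis j 1"
      have "a \<in> rotbody k P" unfolding a_def rotbody_fun_upd[OF \<open>j \<noteq> k\<close>] using y by (simp add: slab_def)
      moreover have "u $ k * a $ k + sn * a $ j = c"
        using \<open>j \<noteq> k\<close> sn by (simp add: a_def axis_def field_simps)
      moreover have "x = a + (y $ j) *\<^sub>R u'"
        unfolding vec_eq_iff
      proof
        fix i show "x $ i = (a + (y $ j) *\<^sub>R u') $ i"
          using \<open>j \<noteq> k\<close> sn by (auto simp: y(2) u'_def axis_def a_def algebra_simps)
      qed
      moreover have "y $ j \<in> {0..1}" using y by (simp add: slab_def)
      ultimately show "x \<in> prism u' (rotbody k P \<inter> hyperplane_at u' c)"
        by (auto simp: prism_def hyperplane_at_eq[OF u'] inn)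
    qed
    then show ?thesis by blast
  qed
  also have "T ` \<dots> = (+) (T ((c / sn) *\<^sub>R axis j 1)) ` ((T \<circ> ?M) ` slab k j P (c / sn) (u $ k / sn))"
    unfolding image_image o_def linear_add[OF linT, of "(c / sn) *\<^sub>R axis j 1"] ..
  also have "measure lebesgue \<dots> = measure lebesgue ((T \<circ> ?M) ` slab k j P (c / sn) (u $ k / sn))"
    by (rule measure_translation)
  also have "\<dots> = C * measure lebesgue (slab k j P (c / sn) (u $ k / sn))"
    by (intro C(2) compact_slab comp \<open>j \<noteq> k\<close>)
  also have "measure lebesgue (slab k j P (c / sn) (u $ k / sn)) = enn2real (sec_vol (CARD('n) - 2) P (c / sn) (u $ k / sn))"
    using emeasure_slab[OF Pm \<open>j \<noteq> k\<close> comp] compact_slab[OF comp \<open>j \<noteq> k\<close>]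
    by (simp add: measure_def borel_compact)
  finally show "hyp_volume u (rotbody k P \<inter> hyperplane_at u c) = C * enn2real (sec_vol (CARD('n) - 2) P (c / sn) (u $ k / sn))" .
  qed
qed

section \<open>Quasi-concavity of the section volume\<close>

lemma nn_abel_pow_shift: "(nn_abel ^^ d) h (t + s) = (nn_abel ^^ d) (\<lambda>a. h (a + s)) t"
  by (induction d arbitrary: t) (auto simp: nn_abel_def add.assoc[symmetric])

text \<open>The length along the axis of the slice of the section at squared distance a from the
  plane of the axis and coordinate j.\<close>

definition level_len :: "(real \<Rightarrow> real \<Rightarrow> bool) \<Rightarrow> real \<Rightarrow> real \<Rightarrow> real \<Rightarrow> ennreal" where
  "level_len P \<beta> \<alpha> a = (\<integral>\<^sup>+z. of_bool (P z (a + (\<alpha> - \<beta> * z)\<^sup>2)) \<partial>lborel)"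

lemma level_len_measurable [measurable]:
  assumes [measurable]: "Measurable.pred (borel \<Otimes>\<^sub>M borel) (\<lambda>(z, a). P z a)"
  shows "level_len P \<beta> \<alpha> \<in> borel_measurable borel"
  unfolding level_len_def by measurable

lemma sec_vol_level_len:
  assumes [measurable]: "Measurable.pred (borel \<Otimes>\<^sub>M borel) (\<lambda>(z, a). P z a)"
  shows "sec_vol d P \<alpha> \<beta> = (nn_abel ^^ d) (level_len P \<beta> \<alpha>) 0"
proof -
  have "sec_vol d P \<alpha> \<beta> = (\<integral>\<^sup>+z. (nn_abel ^^ d) (\<lambda>a. of_bool (P z (a + (\<alpha> - \<beta> * z)\<^sup>2))) 0 \<partial>lborel)"
    unfolding sec_vol_def
  proof (intro nn_integral_cong)
    fix z
    show "(nn_abel ^^ d) (\<lambda>a. of_bool (P z a)) ((\<alpha> - \<beta> * z)\<^sup>2) = (nn_abel ^^ d) (\<lambda>a. of_bool (P z (a + (\<alpha> - \<beta> * z)\<^sup>2))) 0"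
      using nn_abel_pow_shift[of d "\<lambda>a. of_bool (P z a)" 0 "(\<alpha> - \<beta> * z)\<^sup>2"] by (simp only: add_0_left)
  qed
  also have "\<dots> = (nn_abel ^^ d) (level_len P \<beta> \<alpha>) 0"
    unfolding level_len_def[abs_def] by (rule nn_abel_pow_Fubini[symmetric]) measurable
  finally show ?thesis .
qed

text \<open>With at least one integration, the value of h at the single point 0 sits on a null
  set.\<close>

lemma nn_abel_pow_eq_0:
  assumes "\<And>a. a > 0 \<Longrightarrow> h a = 0" shows "(nn_abel ^^ Suc d) h 0 = 0"
proof -
  have z: "(nn_abel ^^ d) h t = 0" if "t > 0" for t
  proof -
    have "(nn_abel ^^ d) h t = (nn_abel ^^ d) (\<lambda>_. 0 * 0) t" by (rule nn_abel_pow_cong) (use assms that in auto)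
    also have "\<dots> = 0" by (subst nn_abel_pow_cmult) auto
    finally show ?thesis .
  qed
  have "(nn_abel ^^ Suc d) h 0 = (\<integral>\<^sup>+x. 0 \<partial>(lborel :: real measure))"
    unfolding funpow.simps o_def nn_abel_def[of _ 0]
    by (intro nn_integral_cong_AE AE_I[where N="{0}"]) (auto intro!: z)
  then show ?thesis by simp
qed

text \<open>Convexity of the inverse d-th power, derived from Bernoulli's inequality for C/A and
  C/B. It compensates for rescaling the two sections to a common extent.\<close>

lemma weighted_power_mean:
  fixes A B l :: real
  assumes "A > 0" "B > 0" "0 \<le> l" "l \<le> 1"
  defines "C \<equiv> (1 - l) * A + l * B"
  shows "1 \<le> C ^ d * ((1 - l) / A ^ d + l / B ^ d)"
proof -
  have C: "C > 0"
    unfolding C_def using assms by (cases "l = 0") (auto intro!: add_nonneg_pos)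
  have bern: "1 + real d * (C / X - 1) \<le> (C / X) ^ d" if "X > 0" for X
    using Bernoulli_inequality[of "C / X - 1" d] C that by simp
  have "A * B \<le> C * ((1 - l) * B + l * A)"
  proof -
    have "C * ((1 - l) * B + l * A) - A * B = l * (1 - l) * (A - B)\<^sup>2"
      unfolding C_def by (simp add: algebra_simps power2_eq_square)
    moreover have "\<dots> \<ge> 0" using assms by simp
    ultimately show ?thesis by linarith
  qed
  then have 1: "1 \<le> (1 - l) * (C / A) + l * (C / B)"
    using assms(1,2) by (simp add: field_simps)
  have "1 \<le> 1 + real d * ((1 - l) * (C / A) + l * (C / B) - 1)" using 1 by simp
  also have "\<dots> = (1 - l) * (1 + real d * (C / A - 1)) + l * (1 + real d * (C / B - 1))"
    by (simp add: algebra_simps)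
  also have "\<dots> \<le> (1 - l) * (C / A) ^ d + l * (C / B) ^ d"
    using assms by (intro add_mono mult_left_mono bern) auto
  also have "\<dots> = C ^ d * ((1 - l) / A ^ d + l / B ^ d)" by (simp add: power_divide algebra_simps)
  finally show ?thesis .
qed

text \<open>The Brunn-Minkowski argument: after rescaling the two sections so that their largest slices match,
  the one-dimensional inequality is applied to the lengths of their level sets, which are intervals.\<close>

lemma section_quasi_concave:
  fixes k j i :: "'n::finite"
  assumes Pm [measurable]: "Measurable.pred (borel \<Otimes>\<^sub>M borel) (\<lambda>(z, a). P z a)"
    and dist: "j \<noteq> k" "i \<noteq> k" "i \<noteq> j"
    and K: "convex (rotbody k P)" "compact (rotbody k P)"
    and l: "0 \<le> l" "l \<le> 1"
  shows "min (sec_vol (Suc d) P \<alpha>0 \<beta>) (sec_vol (Suc d) P \<alpha>1 \<beta>) \<le> sec_vol (Suc d) P ((1 - l) * \<alpha>0 + l * \<alpha>1) \<beta>"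
proof -
  \<comment> \<open>By rotational symmetry convexity is needed only in the span of three coordinate
    directions; s is the distance from the plane of the axis and coordinate j.\<close>
  define pt :: "real \<Rightarrow> real \<Rightarrow> real \<Rightarrow> real^'n" where
    "pt z x s = z *\<^sub>R axis k 1 + x *\<^sub>R axis j 1 + s *\<^sub>R axis i 1" for z x s
  have pt: "pt z x s \<in> rotbody k P \<longleftrightarrow> P z (s\<^sup>2 + x\<^sup>2)" for z x s
  proof -
    have "(norm (pt z x s))\<^sup>2 = z\<^sup>2 + x\<^sup>2 + s\<^sup>2"
      using dist unfolding power2_norm_eq_inner pt_def
      by (simp add: inner_add_left inner_add_right inner_axis_axis power2_eq_square)
    moreover have "pt z x s $ k = z" using dist by (simp add: pt_def axis_def)
    ultimately show ?thesis by (simp add: rotbody_def add.commute)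
  qed
  define I where "I \<alpha> s = {z. pt z (\<alpha> - \<beta> * z) s \<in> rotbody k P}" for \<alpha> s
  have level_I: "level_len P \<beta> \<alpha> (s\<^sup>2) = emeasure lborel (I \<alpha> s)" for \<alpha> s
  proof -
    have [measurable]: "I \<alpha> s \<in> sets borel" unfolding I_def pt by measurable
    have "level_len P \<beta> \<alpha> (s\<^sup>2) = (\<integral>\<^sup>+z. indicator (I \<alpha> s) z \<partial>lborel)"
      unfolding level_len_def by (intro nn_integral_cong) (auto simp: I_def pt indicator_def)
    then show ?thesis by simp
  qed
  have ptc: "continuous_on UNIV (\<lambda>p. pt (fst p) (\<alpha> - \<beta> * fst p) (snd p))" for \<alpha>
    unfolding pt_def by (intro continuous_intros)
  obtain R where R: "\<And>x. x \<in> rotbody k P \<Longrightarrow> norm x \<le> R" using compact_imp_bounded[OF K(2)] by (auto simp: bounded_iff)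
  define S where "S \<alpha> = {p. snd p \<ge> 0} \<inter> (\<lambda>p. pt (fst p) (\<alpha> - \<beta> * fst p) (snd p)) -` rotbody k P" for \<alpha>
  have compS: "compact (S \<alpha>)" for \<alpha>
  proof (rule compact_subset_closed)
    show "closed (S \<alpha>)" unfolding S_def
      by (intro closed_Int closed_vimage ptc compact_imp_closed K closed_Collect_le continuous_intros)
    show "compact ({-R..R} \<times> {-R..R})" by (intro compact_Times compact_Icc)
    show "S \<alpha> \<subseteq> {-R..R} \<times> {-R..R}"
    proof
      fix p assume p: "p \<in> S \<alpha>"
      let ?x = "pt (fst p) (\<alpha> - \<beta> * fst p) (snd p)"
      have "?x $ k = fst p" "?x $ i = snd p" using dist by (auto simp: pt_def axis_def)
      then have "\<bar>fst p\<bar> \<le> R" "\<bar>snd p\<bar> \<le> R"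
        using component_le_norm_cart[of ?x k] component_le_norm_cart[of ?x i] R[of ?x] p by (auto simp: S_def)
      then show "p \<in> {-R..R} \<times> {-R..R}" by (cases p) (auto simp: abs_le_iff)
    qed
  qed
  \<comment> \<open>Nonzero volume forces a nonempty slice at some s > 0, and compactness gives a
    largest such s, the scale by which the section is normalised.\<close>
  have level_top: "\<exists>A>0. I \<alpha> A \<noteq> {} \<and> (\<forall>s>A. I \<alpha> s = {})" if nz: "sec_vol (Suc d) P \<alpha> \<beta> \<noteq> 0" for \<alpha>
  proof -
    have ex: "\<exists>s>0. I \<alpha> s \<noteq> {}"
    proof (rule ccontr)
      assume "\<not> ?thesis"
      then have "level_len P \<beta> \<alpha> a = 0" if "a > 0" for a
        using level_I[of \<alpha> "sqrt a"] that by auto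
      then show False using nn_abel_pow_eq_0 nz by (simp add: sec_vol_level_len[OF Pm] del: funpow.simps)
    qed
    then obtain s0 z0 where s0: "s0 > 0" "(z0, s0) \<in> S \<alpha>" by (auto simp: S_def I_def)
    obtain p where p: "p \<in> S \<alpha>" "\<And>q. q \<in> S \<alpha> \<Longrightarrow> snd q \<le> snd p"
    proof -
      have "S \<alpha> \<noteq> {}" using s0 by blast
      moreover have "continuous_on (S \<alpha>) snd" by (intro continuous_intros)
      ultimately show ?thesis using continuous_attains_sup[OF compS, of \<alpha> snd] that by blast
    qed
    have "snd p > 0" using p(2)[OF s0(2)] s0 by simp
    moreover have "fst p \<in> I \<alpha> (snd p)" using p(1) by (simp add: S_def I_def)
    moreover have "I \<alpha> s = {}" if "s > snd p" for s
    proof (rule ccontr)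
      assume "I \<alpha> s \<noteq> {}"
      then obtain z where "(z, s) \<in> S \<alpha>" using \<open>s > snd p\<close> \<open>snd p > 0\<close> by (fastforce simp: S_def I_def)
      then show False using p(2)[of "(z, s)"] that by simp
    qed
    ultimately show ?thesis by blast
  qed
  have comb: "(1 - r) * z0 + r * z1 \<in> I ((1 - r) * a0 + r * a1) ((1 - r) * s0 + r * s1)"
    if "z0 \<in> I a0 s0" "z1 \<in> I a1 s1" "0 \<le> r" "r \<le> 1" for r z0 z1 a0 a1 s0 s1
  proof -
    have "(1 - r) *\<^sub>R pt z0 (a0 - \<beta> * z0) s0 + r *\<^sub>R pt z1 (a1 - \<beta> * z1) s1 \<in> rotbody k P"
      using that by (intro convexD_alt K) (auto simp: I_def)
    moreover have "(1 - r) *\<^sub>R pt z0 (a0 - \<beta> * z0) s0 + r *\<^sub>R pt z1 (a1 - \<beta> * z1) s1 =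
      pt ((1 - r) * z0 + r * z1) (((1 - r) * a0 + r * a1) - \<beta> * ((1 - r) * z0 + r * z1)) ((1 - r) * s0 + r * s1)"
      unfolding pt_def by (simp add: algebra_simps)
    ultimately show ?thesis by (simp add: I_def)
  qed
  have conn: "connected (I \<alpha> s)" for \<alpha> s
  proof (intro convex_connected convexI)
    fix x y u v :: real assume xy: "x \<in> I \<alpha> s" "y \<in> I \<alpha> s" "0 \<le> u" "0 \<le> v" "u + v = 1"
    have u: "u = 1 - v" using xy(5) by simp
    have "(1 - v) * r + v * r = r" for r :: real by (simp add: algebra_simps)
    then show "u *\<^sub>R x + v *\<^sub>R y \<in> I \<alpha> s"
      using comb[OF xy(1,2,4)] xy(3) unfolding u by simp
  qed
  have Icc: "\<exists>a b. a \<le> b \<and> I \<alpha> s = {a..b}" if "0 \<le> s" "s \<le> A" "I \<alpha> A \<noteq> {}" "A > 0" for \<alpha> s A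
  proof -
    obtain z where z: "z \<in> I \<alpha> A" using \<open>I \<alpha> A \<noteq> {}\<close> by blast
    \<comment> \<open>The slice at s is nonempty: by symmetry z lies in the slices at -A and at A,
      and s is between them.\<close>
    have "z \<in> I \<alpha> (-A)" using z by (simp add: I_def pt)
    with z have "z \<in> I \<alpha> s"
      using comb[of z \<alpha> "-A" z \<alpha> A "(s + A) / (2 * A)"] that by (simp add: field_simps)
    moreover note conn[of \<alpha> s]
    moreover have "compact (I \<alpha> s)"
    proof -
      have "I \<alpha> s = fst ` (S \<alpha> \<inter> {p. snd p = s})" 
      proof (intro set_eqI iffI)
        fix z assume "z \<in> I \<alpha> s"
        then have "(z, s) \<in> S \<alpha> \<inter> {p. snd p = s}" using \<open>0 \<le> s\<close> by (simp add: I_def S_def)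
        then show "z \<in> fst ` (S \<alpha> \<inter> {p. snd p = s})" by (metis fst_conv image_eqI)
      qed (auto simp: I_def S_def)
      moreover have "compact (S \<alpha> \<inter> {p. snd p = s})"
        by (intro compact_Int_closed compS closed_Collect_eq continuous_intros)
      ultimately show ?thesis by (auto intro!: compact_continuous_image continuous_intros)
    qed
    ultimately obtain a b where ab: "I \<alpha> s = {a..b}" using connected_compact_interval_1 by metis
    then show ?thesis using \<open>z \<in> I \<alpha> s\<close> by auto
  qed
  show ?thesis
  proof (cases "sec_vol (Suc d) P \<alpha>0 \<beta> = 0 \<or> sec_vol (Suc d) P \<alpha>1 \<beta> = 0")
    case True
    then show ?thesis by (auto simp: min_def)
  next
    case False
    obtain A where A: "A > 0" "I \<alpha>0 A \<noteq> {}" "\<And>s. s > A \<Longrightarrow> I \<alpha>0 s = {}" using level_top False by metis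
    obtain B where B: "B > 0" "I \<alpha>1 B \<noteq> {}" "\<And>s. s > B \<Longrightarrow> I \<alpha>1 s = {}" using level_top False by metis
    define C where "C = (1 - l) * A + l * B"
    have C: "C > 0"
      unfolding C_def using A B l by (cases "l = 0") (auto intro!: add_nonneg_pos)
    define \<alpha>l where "\<alpha>l = (1 - l) * \<alpha>0 + l * \<alpha>1"
    \<comment> \<open>With a = s^2, slices are compared at the proportional distances s A, s B and s
      C. For s > 1 the slices on the left are empty; otherwise they are intervals, and averaging
      endpoints gives the one-dimensional inequality.\<close>
    have main: "ennreal (1 - l) * level_len P \<beta> \<alpha>0 (a * A\<^sup>2) + ennreal l * level_len P \<beta> \<alpha>1 (a * B\<^sup>2) \<le> level_len P \<beta> \<alpha>l (a * C\<^sup>2)"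
      if a: "a \<ge> 0" for a
    proof -
      define s where "s = sqrt a"
      have s: "s \<ge> 0" "a * X\<^sup>2 = (s * X)\<^sup>2" for X using a by (auto simp: s_def power_mult_distrib)
      show ?thesis
      proof (cases "s > 1")
        case True
        then have "s * A > A" "s * B > B" using A(1) B(1) by auto
        then show ?thesis using A B by (simp add: s level_I)
      next
        case False
        obtain a0 b0 where I0: "a0 \<le> b0" "I \<alpha>0 (s * A) = {a0..b0}"
          using Icc[of "s * A" A \<alpha>0] A s(1) False by (auto simp: mult_left_le_one_le)
        obtain a1 b1 where I1: "a1 \<le> b1" "I \<alpha>1 (s * B) = {a1..b1}"
          using Icc[of "s * B" B \<alpha>1] B s(1) False by (auto simp: mult_left_le_one_le)
        have sub: "{(1 - l) * a0 + l * a1..(1 - l) * b0 + l * b1} \<subseteq> I \<alpha>l (s * C)"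
        proof
          fix x assume x: "x \<in> {(1 - l) * a0 + l * a1..(1 - l) * b0 + l * b1}"
          have e: "(1 - l) * (s * A) + l * (s * B) = s * C" by (simp add: C_def algebra_simps)
          have "(1 - l) * a0 + l * a1 \<in> I \<alpha>l (s * C)" "(1 - l) * b0 + l * b1 \<in> I \<alpha>l (s * C)"
            using comb[of a0 \<alpha>0 "s * A" a1 \<alpha>1 "s * B" l] comb[of b0 \<alpha>0 "s * A" b1 \<alpha>1 "s * B" l] I0 I1 l
            unfolding e \<alpha>l_def[symmetric] by auto
          then have "{(1 - l) * a0 + l * a1..(1 - l) * b0 + l * b1} \<subseteq> I \<alpha>l (s * C)"
            by (rule connected_contains_Icc[OF conn])
          then show "x \<in> I \<alpha>l (s * C)" using x by blast
        qed
        have "ennreal (1 - l) * level_len P \<beta> \<alpha>0 (a * A\<^sup>2) + ennreal l * level_len P \<beta> \<alpha>1 (a * B\<^sup>2)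
          = ennreal ((1 - l) * (b0 - a0) + l * (b1 - a1))"
          using I0 I1 l by (simp add: s level_I ennreal_mult ennreal_plus)
        also have "\<dots> = emeasure lborel {(1 - l) * a0 + l * a1..(1 - l) * b0 + l * b1}"
        proof (subst emeasure_lborel_Icc)
          show "(1 - l) * a0 + l * a1 \<le> (1 - l) * b0 + l * b1"
            using I0 I1 l by (intro add_mono mult_left_mono) auto
        qed (simp add: algebra_simps)
        also have "\<dots> \<le> emeasure lborel (I \<alpha>l (s * C))"
        proof (rule emeasure_mono[OF sub])
          show "I \<alpha>l (s * C) \<in> sets lborel" unfolding I_def pt by measurable
        qed
        finally show ?thesis by (simp add: s level_I)
      qed
    qed
    \<comment> \<open>Volumes after scaling to extent D; undoing the scaling costs one factor D for
      each of the \<open>Suc d\<close> coordinates.\<close>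
    define X where "X \<alpha> D = (nn_abel ^^ Suc d) (\<lambda>a. level_len P \<beta> \<alpha> (a * D\<^sup>2)) 0" for \<alpha> D
    have Sec: "sec_vol (Suc d) P \<alpha> \<beta> = ennreal (D ^ Suc d) * X \<alpha> D" if "D > 0" for \<alpha> D
      using nn_abel_pow_scale[of "level_len P \<beta> \<alpha>" D "Suc d" 0] that by (simp add: sec_vol_level_len[OF Pm] X_def del: funpow.simps)
    have "ennreal (1 - l) * X \<alpha>0 A + ennreal l * X \<alpha>1 B
      = (nn_abel ^^ Suc d) (\<lambda>a. ennreal (1 - l) * level_len P \<beta> \<alpha>0 (a * A\<^sup>2) + ennreal l * level_len P \<beta> \<alpha>1 (a * B\<^sup>2)) 0"
      unfolding X_def by (simp add: nn_abel_pow_add nn_abel_pow_cmult del: funpow.simps)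
    also have "\<dots> \<le> X \<alpha>l C" unfolding X_def by (rule nn_abel_pow_mono) (rule main)
    finally have XC: "ennreal (1 - l) * X \<alpha>0 A + ennreal l * X \<alpha>1 B \<le> X \<alpha>l C" .
    define m where "m = min (sec_vol (Suc d) P \<alpha>0 \<beta>) (sec_vol (Suc d) P \<alpha>1 \<beta>)"
    have inv: "ennreal (1 / D ^ Suc d) * m \<le> X \<alpha> D" if "D > 0" "m \<le> sec_vol (Suc d) P \<alpha> \<beta>" for D \<alpha>
    proof -
      have "ennreal (1 / D ^ Suc d) * m \<le> ennreal (1 / D ^ Suc d) * (ennreal (D ^ Suc d) * X \<alpha> D)"
        using that Sec[OF that(1), of \<alpha>] by (intro mult_left_mono) auto
      also have "\<dots> = X \<alpha> D"
        using that(1) by (simp add: mult.assoc[symmetric] ennreal_mult'[symmetric] del: power_Suc)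
      finally show ?thesis .
    qed
    have "m = ennreal 1 * m" by simp
    also have "\<dots> \<le> ennreal (C ^ Suc d * ((1 - l) / A ^ Suc d + l / B ^ Suc d)) * m"
      unfolding C_def by (intro mult_right_mono ennreal_leI weighted_power_mean A B l) simp
    also have "\<dots> = ennreal (C ^ Suc d) * (ennreal (1 - l) * (ennreal (1 / A ^ Suc d) * m) + ennreal l * (ennreal (1 / B ^ Suc d) * m))"
    proof -
      have "ennreal (C ^ Suc d * ((1 - l) / A ^ Suc d + l / B ^ Suc d))
        = ennreal (C ^ Suc d) * (ennreal (1 - l) * ennreal (1 / A ^ Suc d) + ennreal l * ennreal (1 / B ^ Suc d))"
        using A B C l by (simp add: ennreal_mult[symmetric] ennreal_plus[symmetric] del: ennreal_plus power_Suc)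
      then show ?thesis by (simp add: distrib_right mult.assoc del: power_Suc)
    qed
    also have "\<dots> \<le> ennreal (C ^ Suc d) * (ennreal (1 - l) * X \<alpha>0 A + ennreal l * X \<alpha>1 B)"
      by (intro mult_left_mono add_mono inv A B) (auto simp: m_def)
    also have "\<dots> \<le> ennreal (C ^ Suc d) * X \<alpha>l C" by (intro mult_left_mono XC) auto
    also have "\<dots> = sec_vol (Suc d) P \<alpha>l \<beta>" using Sec[OF C] by simp
    finally show ?thesis by (simp add: m_def \<alpha>l_def)
  qed
qed

section \<open>Half sections and sections of the ball\<close>

lemma nn_abel_pow_pair_measurable:
  assumes "(\<lambda>(z, a). G z a) \<in> borel_measurable (borel \<Otimes>\<^sub>M borel)"
  shows "(\<lambda>(z, s). (nn_abel ^^ d) (G z) s) \<in> borel_measurable (borel \<Otimes>\<^sub>M borel)"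
  using assms
proof (induction d arbitrary: G)
  case (Suc d)
  note [measurable] = Suc.prems
  have "(\<lambda>(z, s). (nn_abel ^^ d) (nn_abel (G z)) s) \<in> borel_measurable (borel \<Otimes>\<^sub>M borel)"
    by (rule Suc.IH) (unfold nn_abel_def, measurable)
  then show ?case by (simp add: funpow_swap1)
qed auto

lemma nn_abel_pow_section_measurable:
  assumes [measurable]: "Measurable.pred (borel \<Otimes>\<^sub>M borel) (\<lambda>(z, a). P z a)" "q \<in> borel_measurable borel"
  shows "(\<lambda>z. (nn_abel ^^ d) (\<lambda>a. of_bool (P z a)) (q z)) \<in> borel_measurable borel"
proof -
  have "(\<lambda>(z, a). of_bool (P z a) :: ennreal) \<in> borel_measurable (borel \<Otimes>\<^sub>M borel)" by measurable
  from nn_abel_pow_pair_measurable[OF this, of d]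
  show ?thesis using measurable_compose[of "\<lambda>z. (z, q z)" borel "borel \<Otimes>\<^sub>M borel"] by fastforce
qed

text \<open>For \<beta> \<noteq> 0 the section is described by \<sigma> = \<beta>^2 and the height t
  = \<alpha>/\<beta> at which it meets the axis. At \<sigma> = 0 the value does not depend on t, the
  degeneracy that is divided out later.\<close>

definition sec_vol_at :: "nat \<Rightarrow> (real \<Rightarrow> real \<Rightarrow> bool) \<Rightarrow> real \<Rightarrow> real \<Rightarrow> ennreal" where
  "sec_vol_at d P \<sigma> t = (\<integral>\<^sup>+z. (nn_abel ^^ d) (\<lambda>a. of_bool (P z a)) (\<sigma> * (z - t)\<^sup>2) \<partial>lborel)"

definition half_vol :: "nat \<Rightarrow> (real \<Rightarrow> real \<Rightarrow> bool) \<Rightarrow> real \<Rightarrow> ennreal" where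
  "half_vol d P \<sigma> = (\<integral>\<^sup>+z. (nn_abel ^^ d) (\<lambda>a. of_bool (P z a)) (\<sigma> * z\<^sup>2) * indicator {0<..} z \<partial>lborel)"

lemma sec_vol_sec_vol_at: "sec_vol d P (\<beta> * t) \<beta> = sec_vol_at d P (\<beta>\<^sup>2) t"
proof -
  have "(\<beta> * t - \<beta> * z)\<^sup>2 = \<beta>\<^sup>2 * (z - t)\<^sup>2" for z
    by (simp add: algebra_simps power2_eq_square)
  then show ?thesis by (simp add: sec_vol_def sec_vol_at_def)
qed

text \<open>Polar coordinates about height t treat the two sides of the centre separately.\<close>

lemma sec_vol_at_halves:
  assumes [measurable]: "Measurable.pred (borel \<Otimes>\<^sub>M borel) (\<lambda>(z, a). P z a)"
  shows "sec_vol_at d P \<sigma> t = half_vol d (\<lambda>z. P (t + z)) \<sigma> + half_vol d (\<lambda>z. P (t - z)) \<sigma>"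
proof -
  define g where "g z = (nn_abel ^^ d) (\<lambda>a. of_bool (P z a)) (\<sigma> * (z - t)\<^sup>2)" for z
  have [measurable]: "g \<in> borel_measurable borel"
    unfolding g_def by (rule nn_abel_pow_section_measurable[OF assms]) measurable
  have "sec_vol_at d P \<sigma> t = (\<integral>\<^sup>+z. g (t + 1 * z) \<partial>lborel)"
    unfolding sec_vol_at_def g_def[symmetric] using nn_integral_real_affine[of g 1 t] by simp
  also have "\<dots> = (\<integral>\<^sup>+z. g (t + z) * indicator {0<..} z + g (t + z) * indicator {..<0} z \<partial>lborel)"
    by (intro nn_integral_cong_AE AE_I[where N="{0}"]) (auto simp: indicator_def split: if_splits)
  also have "\<dots> = (\<integral>\<^sup>+z. g (t + z) * indicator {0<..} z \<partial>lborel) + (\<integral>\<^sup>+z. g (t + z) * indicator {..<0} z \<partial>lborel)"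
    by (intro nn_integral_add) auto
  also have "(\<integral>\<^sup>+z. g (t + z) * indicator {..<0} z \<partial>lborel) = (\<integral>\<^sup>+z. g (t - z) * indicator {0<..} z \<partial>lborel)"
    by (subst nn_integral_real_affine[of _ "-1" 0]) (auto simp: indicator_def)
  finally show ?thesis by (simp add: half_vol_def g_def)
qed

lemma sec_vol_at_zero: "sec_vol_at d P 0 t = sec_vol_at d P 0 0"
  by (simp add: sec_vol_at_def)

lemma nn_abel_pow_pos:
  assumes "s < c" shows "(nn_abel ^^ d) (\<lambda>a. of_bool (a \<le> c)) s \<noteq> 0"
  using assms
proof (induction d arbitrary: s)
  case (Suc d)
  define r where "r = sqrt (c - s)"
  have r: "r > 0" using Suc.prems by (simp add: r_def)
  have *: "(nn_abel ^^ d) (\<lambda>a. of_bool (a \<le> c)) (x\<^sup>2 + s) \<noteq> 0" if "x \<in> {0<..<r}" for x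
  proof -
    have "x\<^sup>2 < r\<^sup>2" using that by (intro power_strict_mono) auto
    then show ?thesis using Suc.prems by (intro Suc.IH) (simp add: r_def)
  qed
  have m: "(\<lambda>x. (nn_abel ^^ d) (\<lambda>a. of_bool (a \<le> c)) (x\<^sup>2 + s)) \<in> borel_measurable lborel" by measurable
  show ?case
  proof
    assume "(nn_abel ^^ Suc d) (\<lambda>a. of_bool (a \<le> c)) s = 0"
    then have "AE x in lborel. (nn_abel ^^ d) (\<lambda>a. of_bool (a \<le> c)) (x\<^sup>2 + s) = 0"
      using nn_integral_0_iff_AE[OF m] by (simp add: nn_abel_def[of _ s])
    then have "AE x in lborel. x \<notin> {0<..<r}" by eventually_elim (use * in blast)
    then have "emeasure lborel {0<..<r} = 0"
    proof (subst (asm) AE_iff_measurable[OF _ refl])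
      have "{x \<in> space lborel. \<not> x \<notin> {0<..<r}} = {0<..<r}" by auto
      then show "{x \<in> space lborel. \<not> x \<notin> {0<..<r}} \<in> sets lborel"
        and "emeasure lborel {x \<in> space lborel. \<not> x \<notin> {0<..<r}} = 0 \<Longrightarrow> emeasure lborel {0<..<r} = 0"
        by simp_all
    qed
    then show False using r emeasure_lborel_Ioo[of 0 r] by (simp add: greaterThanLessThan_eq ennreal_eq_0_iff)
  qed
qed auto

text \<open>The volume of the unit ball of dimension d + 1.\<close>

definition ball_const :: "nat \<Rightarrow> real" where
  "ball_const d = enn2real ((nn_abel ^^ Suc d) (\<lambda>a. of_bool (a \<le> 1)) 0)"

lemma ball_const: "(nn_abel ^^ Suc d) (\<lambda>a. of_bool (a \<le> 1)) 0 = ennreal (ball_const d)" "ball_const d > 0"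
proof -
  let ?X = "(nn_abel ^^ Suc d) (\<lambda>a. of_bool (a \<le> 1)) 0"
  define h where "h a = max 0 (2 - a)" for a :: real
  have h: "admissible (-1) h" by (auto simp: admissible_def h_def intro!: continuous_intros)
  have "?X \<le> (nn_abel ^^ Suc d) (\<lambda>a. ennreal (h a)) 0"
    by (rule nn_abel_pow_mono) (auto simp: h_def)
  also have "\<dots> < top" using nn_abel_pow_eq_abel[OF h, of 0 "Suc d"] by (simp add: h_def del: funpow.simps)
  finally have "?X < top" .
  then show 1: "?X = ennreal (ball_const d)" by (simp add: ball_const_def del: funpow.simps)
  have "?X \<noteq> 0" by (rule nn_abel_pow_pos) simp
  then show "ball_const d > 0" using 1 by (metis ennreal_eq_0_iff not_le)
qed

definition ballP :: "real \<Rightarrow> real \<Rightarrow> bool" where "ballP z a \<longleftrightarrow> a + z\<^sup>2 \<le> 1"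

text \<open>The squared distance of the hyperplane from the origin is \<sigma> t^2 / (1 + \<sigma>);
  the factor (1 + \<sigma>)^(-1/2) arises because the section is measured in the coordinates (z, y)
  rather than within the hyperplane.\<close>

definition ball_vol :: "nat \<Rightarrow> real \<Rightarrow> real \<Rightarrow> real" where
  "ball_vol d \<sigma> t = ball_const d * (1 + \<sigma>) powr (-1/2) * (1 - \<sigma> * t\<^sup>2 / (1 + \<sigma>)) powr ((real d + 1) / 2)"

lemma complete_square_aux:
  fixes m t :: real assumes "m \<noteq> 0"
  shows "(m - 1) * t\<^sup>2 - m * ((m - 1) * t / m)\<^sup>2 = (m - 1) * t\<^sup>2 / m"
  using assms by (simp add: field_simps power2_eq_square)

lemma sec_vol_at_ball:
  assumes "\<sigma> \<ge> 0" "1 - \<sigma> * t\<^sup>2 / (1 + \<sigma>) > 0"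
  shows "sec_vol_at d ballP \<sigma> t = ennreal (ball_vol d \<sigma> t)"
proof -
  define R where "R = sqrt (1 - \<sigma> * t\<^sup>2 / (1 + \<sigma>))"
  have R: "R > 0" "R\<^sup>2 = 1 - \<sigma> * t\<^sup>2 / (1 + \<sigma>)" using assms by (auto simp: R_def)
  define c where "c = 1 / sqrt (1 + \<sigma>)"
  have c: "c > 0" "(1 + \<sigma>) * c\<^sup>2 = 1" using assms by (auto simp: c_def power_divide)
  \<comment> \<open>The height of the centre of the section, found by completing the square.\<close>
  define z0 where "z0 = \<sigma> * t / (1 + \<sigma>)"
  have [measurable]: "Measurable.pred (borel \<Otimes>\<^sub>M borel) (\<lambda>(z, a). ballP z a)" unfolding ballP_def by measurable
  define g where "g z = (nn_abel ^^ d) (\<lambda>a. of_bool (a \<le> R\<^sup>2)) ((1 + \<sigma>) * (z - z0)\<^sup>2)" for z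
  have [measurable]: "g \<in> borel_measurable borel" unfolding g_def by measurable
  have "(nn_abel ^^ d) (\<lambda>a. of_bool (ballP z a)) (\<sigma> * (z - t)\<^sup>2) = g z" for z
  proof -
    have eq: "a + \<sigma> * (z - t)\<^sup>2 + z\<^sup>2 = a + (1 + \<sigma>) * (z - z0)\<^sup>2 + \<sigma> * t\<^sup>2 / (1 + \<sigma>)" for a
    proof -
      have "(1 + \<sigma>) * z0 = \<sigma> * t" using assms by (simp add: z0_def)
      moreover have "\<sigma> * t\<^sup>2 - (1 + \<sigma>) * z0\<^sup>2 = \<sigma> * t\<^sup>2 / (1 + \<sigma>)"
        unfolding z0_def using complete_square_aux[of "1 + \<sigma>" t] assms by simp
      moreover have "a + \<sigma> * (z - t)\<^sup>2 + z\<^sup>2 = a + (1 + \<sigma>) * (z - z0)\<^sup>2 + (\<sigma> * t\<^sup>2 - (1 + \<sigma>) * z0\<^sup>2) + 2 * z * ((1 + \<sigma>) * z0 - \<sigma> * t)"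
        by (simp add: power2_eq_square algebra_simps)
      ultimately show ?thesis by simp
    qed
    have "(nn_abel ^^ d) (\<lambda>a. of_bool (ballP z a)) (0 + \<sigma> * (z - t)\<^sup>2) = (nn_abel ^^ d) (\<lambda>a. of_bool (ballP z (a + \<sigma> * (z - t)\<^sup>2))) 0"
      by (rule nn_abel_pow_shift)
    also have "\<dots> = (nn_abel ^^ d) (\<lambda>a. of_bool (a + (1 + \<sigma>) * (z - z0)\<^sup>2 \<le> R\<^sup>2)) 0"
      by (rule nn_abel_pow_cong) (simp only: ballP_def eq R(2), simp add: algebra_simps)
    also have "\<dots> = g z" unfolding g_def using nn_abel_pow_shift[of d "\<lambda>a. of_bool (a \<le> R\<^sup>2)" 0 "(1 + \<sigma>) * (z - z0)\<^sup>2"]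
      by (simp only: add_0_left)
    finally show ?thesis by (simp only: add_0_left)
  qed
  then have "sec_vol_at d ballP \<sigma> t = (\<integral>\<^sup>+z. g z \<partial>lborel)" by (simp add: sec_vol_at_def)
  also have "\<dots> = ennreal c * (\<integral>\<^sup>+w. g (z0 + c * w) \<partial>lborel)"
    using nn_integral_real_affine[of g c z0] c by simp
  also have "(\<integral>\<^sup>+w. g (z0 + c * w) \<partial>lborel) = (nn_abel ^^ Suc d) (\<lambda>a. of_bool (a \<le> R\<^sup>2)) (0 * R\<^sup>2)"
    using c(2) by (simp add: g_def nn_abel_def[of _ 0] power_mult_distrib mult.assoc[symmetric])
  also have "\<dots> = ennreal (\<bar>R\<bar> ^ Suc d) * (nn_abel ^^ Suc d) (\<lambda>a. of_bool (a * R\<^sup>2 \<le> R\<^sup>2)) 0"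
    using R by (intro nn_abel_pow_scale) auto
  also have "(\<lambda>a. of_bool (a * R\<^sup>2 \<le> R\<^sup>2) :: ennreal) = (\<lambda>a. of_bool (a \<le> 1))"
    using R(1) by (auto simp: fun_eq_iff)
  also have "ennreal c * (ennreal (\<bar>R\<bar> ^ Suc d) * (nn_abel ^^ Suc d) (\<lambda>a. of_bool (a \<le> 1)) 0) = ennreal (ball_vol d \<sigma> t)"
  proof -
    have "c = (1 + \<sigma>) powr (-1/2)" using assms by (simp add: c_def powr_half_sqrt powr_minus_divide[of _ "1/2", simplified])
    moreover have "\<bar>R\<bar> ^ Suc d = (1 - \<sigma> * t\<^sup>2 / (1 + \<sigma>)) powr ((real d + 1) / 2)"
    proof -
      have "\<bar>R\<bar> ^ Suc d = R powr (real (Suc d))" using R by (simp only: powr_realpow abs_of_pos)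
      also have "R powr (real (Suc d)) = ((R\<^sup>2) powr (1/2)) powr (real (Suc d))" using R(1) by (simp add: powr_half_sqrt)
      also have "\<dots> = (R\<^sup>2) powr ((real d + 1) / 2)" unfolding powr_powr by (simp add: add.commute)
      finally show ?thesis unfolding R(2) .
    qed
    ultimately show ?thesis
      unfolding ball_const(1) using ball_const(2)[of d] by (simp add: ennreal_mult'[symmetric] ball_vol_def mult_ac)
  qed
  finally show ?thesis .
qed

lemma sec_vol_at_mono: "(\<And>z a. P z a \<Longrightarrow> Q z a) \<Longrightarrow> sec_vol_at d P \<sigma> t \<le> sec_vol_at d Q \<sigma> t"
  unfolding sec_vol_at_def by (intro nn_integral_mono nn_abel_pow_mono) auto

lemma sec_vol_at_ball_le:
  assumes "\<sigma> \<ge> 0" shows "sec_vol_at d ballP \<sigma> t \<le> sec_vol_at d ballP \<sigma> 0"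
proof -
  define z0 where "z0 = \<sigma> * t / (1 + \<sigma>)"
  have [measurable]: "Measurable.pred (borel \<Otimes>\<^sub>M borel) (\<lambda>(z, a). ballP z a)" unfolding ballP_def by measurable
  have eq: "ballP z (a + \<sigma> * (z - t)\<^sup>2) \<Longrightarrow> ballP (z - z0) (a + \<sigma> * (z - z0)\<^sup>2)" for z a
  proof -
    assume "ballP z (a + \<sigma> * (z - t)\<^sup>2)"
    moreover have "a + \<sigma> * (z - t)\<^sup>2 + z\<^sup>2 = a + \<sigma> * (z - z0)\<^sup>2 + (z - z0)\<^sup>2 + \<sigma> * t\<^sup>2 / (1 + \<sigma>)"
    proof -
      have "(1 + \<sigma>) * z0 = \<sigma> * t" using assms by (simp add: z0_def)
      moreover have "\<sigma> * t\<^sup>2 - (1 + \<sigma>) * z0\<^sup>2 = \<sigma> * t\<^sup>2 / (1 + \<sigma>)"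
        unfolding z0_def using complete_square_aux[of "1 + \<sigma>" t] assms by simp
      moreover have "a + \<sigma> * (z - t)\<^sup>2 + z\<^sup>2 = a + \<sigma> * (z - z0)\<^sup>2 + (z - z0)\<^sup>2 + (\<sigma> * t\<^sup>2 - (1 + \<sigma>) * z0\<^sup>2) + 2 * z * ((1 + \<sigma>) * z0 - \<sigma> * t)"
        by (simp add: power2_eq_square algebra_simps)
      ultimately show ?thesis by simp
    qed
    moreover have "\<sigma> * t\<^sup>2 / (1 + \<sigma>) \<ge> 0" using assms by simp
    ultimately show ?thesis by (simp add: ballP_def)
  qed
  have sh: "(nn_abel ^^ d) (\<lambda>a. of_bool (ballP z a)) s = (nn_abel ^^ d) (\<lambda>a. of_bool (ballP z (a + s))) 0" for z s
    using nn_abel_pow_shift[of d "\<lambda>a. of_bool (ballP z a)" 0 s] by (simp only: add_0_left)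
  define g where "g z = (nn_abel ^^ d) (\<lambda>a. of_bool (ballP z a)) (\<sigma> * (z - 0)\<^sup>2)" for z
  have gm: "g \<in> borel_measurable borel"
    unfolding g_def by (rule nn_abel_pow_section_measurable) measurable
  have "sec_vol_at d ballP \<sigma> t \<le> (\<integral>\<^sup>+z. g (z - z0) \<partial>lborel)"
    unfolding sec_vol_at_def g_def
  proof (intro nn_integral_mono)
    fix z
    show "(nn_abel ^^ d) (\<lambda>a. of_bool (ballP z a)) (\<sigma> * (z - t)\<^sup>2) \<le> (nn_abel ^^ d) (\<lambda>a. of_bool (ballP (z - z0) a)) (\<sigma> * (z - z0 - 0)\<^sup>2)"
      unfolding sh[of _ "\<sigma> * _"] by (rule nn_abel_pow_mono) (use eq in auto)
  qed
  also have "\<dots> = (\<integral>\<^sup>+z. g z \<partial>lborel)"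
    using nn_integral_real_affine[OF gm, of 1 "-z0"] by simp
  finally show ?thesis by (simp add: sec_vol_at_def g_def)
qed

section \<open>Sections of the flattened ball\<close>

text \<open>The band lies strictly above the equator, so the equatorial section stays that of the
  ball, and it leaves a margin below 1/4 for the heights about which polar coordinates are
  taken.\<close>

definition bump :: "real \<Rightarrow> real" where
  "bump = (SOME f. Cinf UNIV f \<and> (\<forall>x. f x \<ge> 0) \<and> (\<forall>x. f x > 0 \<longleftrightarrow> 1/4 < x \<and> x < 1/2))"

lemma bump: "Cinf UNIV bump" "bump x \<ge> 0" "bump x > 0 \<longleftrightarrow> 1/4 < x \<and> x < 1/2"
proof -
  have "\<exists>f. Cinf UNIV f \<and> (\<forall>x. f x \<ge> 0) \<and> (\<forall>x. f x > 0 \<longleftrightarrow> 1/4 < x \<and> x < (1/2::real))"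
    by (rule bump_exists) simp
  from someI_ex[OF this, folded bump_def] show "Cinf UNIV bump" "bump x \<ge> 0" "bump x > 0 \<longleftrightarrow> 1/4 < x \<and> x < 1/2" by blast+
qed

lemma bump_zero: "x \<le> 1/4 \<or> 1/2 \<le> x \<Longrightarrow> bump x = 0"
  using bump(2,3)[of x] by (auto simp: order_less_le)

section \<open>Derivatives and bounds of the bump function\<close>

lemma Cinf_real_deriv:
  fixes f :: "real \<Rightarrow> real"
  assumes "Cinf U f" "x \<in> U" shows "(f has_real_derivative partial f 1 x) (at x)"
proof -
  have D: "(f has_derivative frechet_derivative f (at x)) (at x)" by (rule Cinf_has_derivative[OF assms])
  have "frechet_derivative f (at x) h = partial f 1 x * h" for h
    using linear_scale[OF has_derivative_linear[OF D], of h 1] by (simp add: mult.commute)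
  then have 2: "frechet_derivative f (at x) = (*) (partial f 1 x)" by (rule ext)
  show ?thesis unfolding has_field_derivative_def 2[symmetric] by (rule D)
qed

definition "bump_deriv = partial bump 1"
definition "bump_deriv2 = partial bump_deriv 1"

lemma Cinf_bump_deriv: "Cinf UNIV bump_deriv" "Cinf UNIV bump_deriv2"
  unfolding bump_deriv_def bump_deriv2_def by (auto intro!: Cinf_partial bump)

lemma bump_derivs: "(bump has_real_derivative bump_deriv x) (at x)" "(bump_deriv has_real_derivative bump_deriv2 x) (at x)"
  unfolding bump_deriv2_def using Cinf_real_deriv[OF bump(1)] Cinf_real_deriv[OF Cinf_bump_deriv(1)] by (auto simp: bump_deriv_def)

lemma bump_deriv2_zero: "x \<notin> {1/4..1/2} \<Longrightarrow> bump_deriv2 x = 0"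
proof -
  have o: "open (- {1/4..1/2 :: real})" by auto
  have "bump_deriv y = 0" if "y \<in> - {1/4..1/2}" for y
    unfolding bump_deriv_def by (rule partial_eq_0[OF o that, of _ 0]) (use bump_zero in force)
  then show "x \<notin> {1/4..1/2} \<Longrightarrow> bump_deriv2 x = 0"
    unfolding bump_deriv2_def by (intro partial_eq_0[OF o, of _ _ 0]) auto
qed

lemma bump_bound: "\<exists>B>0. \<forall>x. \<bar>bump x\<bar> \<le> B \<and> \<bar>bump_deriv2 x\<bar> \<le> B"
proof -
  have "bounded (bump ` {0..1})" "bounded (bump_deriv2 ` {0..1})"
    by (intro compact_imp_bounded compact_continuous_image compact_Icc
        continuous_on_subset[OF Cinf_continuous[OF bump(1)]] continuous_on_subset[OF Cinf_continuous[OF Cinf_bump_deriv(2)]]; simp)+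
  then obtain B1 B2 where B: "\<And>x. x \<in> {0..1} \<Longrightarrow> \<bar>bump x\<bar> \<le> B1" "\<And>x. x \<in> {0..1} \<Longrightarrow> \<bar>bump_deriv2 x\<bar> \<le> B2"
    unfolding bounded_iff by (metis imageI real_norm_def)
  have "\<bar>bump x\<bar> \<le> \<bar>B1\<bar>" "\<bar>bump_deriv2 x\<bar> \<le> \<bar>B2\<bar>" for x
    using B[of x] bump_zero[of x] bump_deriv2_zero[of x] by (cases "x \<in> {0..1}"; force)+
  then have "\<bar>bump x\<bar> \<le> 1 + \<bar>B1\<bar> + \<bar>B2\<bar> \<and> \<bar>bump_deriv2 x\<bar> \<le> 1 + \<bar>B1\<bar> + \<bar>B2\<bar>" for x
    by (smt (verit))
  then show ?thesis by (intro exI[of _ "1 + \<bar>B1\<bar> + \<bar>B2\<bar>"]) auto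
qed

definition "bump_max = (SOME B. B > 0 \<and> (\<forall>x. \<bar>bump x\<bar> \<le> B \<and> \<bar>bump_deriv2 x\<bar> \<le> B))"

lemma bump_max: "bump_max > 0" "\<bar>bump x\<bar> \<le> bump_max" "\<bar>bump_deriv2 x\<bar> \<le> bump_max"
proof -
  have "bump_max > 0 \<and> (\<forall>x. \<bar>bump x\<bar> \<le> bump_max \<and> \<bar>bump_deriv2 x\<bar> \<le> bump_max)"
    unfolding bump_max_def by (rule someI_ex[OF bump_bound])
  then show "bump_max > 0" "\<bar>bump x\<bar> \<le> bump_max" "\<bar>bump_deriv2 x\<bar> \<le> bump_max" by auto
qed

text \<open>Keeps e times the bump and e times its second derivative within 1/4, so that the
  quadratic terms dominate in all convexity estimates for K.\<close>

definition "eps_max = 1 / (4 * bump_max)"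

lemma eps_max_pos: "eps_max > 0" using bump_max by (simp add: eps_max_def)

lemma eps_max_bound:
  assumes "\<bar>e\<bar> < eps_max" shows "\<bar>e * bump x\<bar> \<le> 1/4" "\<bar>e * bump_deriv2 x\<bar> \<le> 1/4"
proof -
  have "\<bar>e\<bar> * B \<le> 1/4" if "B \<le> bump_max" "B \<ge> 0" for B
  proof -
    have "\<bar>e\<bar> * B \<le> eps_max * bump_max" using assms that by (intro mult_mono) auto
    then show ?thesis using bump_max by (simp add: eps_max_def)
  qed
  then show "\<bar>e * bump x\<bar> \<le> 1/4" "\<bar>e * bump_deriv2 x\<bar> \<le> 1/4"
    using bump_max(2,3)[of x] by (auto simp: abs_mult)
qed

text \<open>Chords starting at 0 rule out a second crossing, and the mean value theorem with an
  increasing derivative makes the slope at the root positive. The radius of K about a point of the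
  axis and its radial function about the origin are both such roots.\<close>

lemma convex_root:
  fixes g g' g'' :: "real \<Rightarrow> real"
  assumes d: "\<And>x. (g has_real_derivative g' x) (at x)" "\<And>x. (g' has_real_derivative g'' x) (at x)"
    and pos: "\<And>x. g'' x > 0" and g0: "g 0 < 0" and gb: "g b > 0" and b: "b > 0"
  shows "\<exists>y. 0 < y \<and> y < b \<and> g y = 0 \<and> (\<forall>s\<ge>0. s < y \<longrightarrow> g s < 0) \<and> (\<forall>s>y. g s > 0) \<and> g' y > 0"
proof -
  have "continuous_on {0..b} g" using d(1) by (auto intro!: continuous_at_imp_continuous_on DERIV_isCont)
  then obtain y where y: "0 \<le> y" "y \<le> b" "g y = 0" using IVT'[of g 0 0 b] g0 gb b by auto
  then have y0: "0 < y" "y < b" using g0 gb by (auto simp: order_less_le)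
  have conv: "convex_on UNIV g"
    by (rule f''_ge0_imp_convex[of UNIV g g' g'']) (use d pos in \<open>auto simp: less_imp_le\<close>)
  have neg: "g s < 0" if "0 \<le> s" "s < y" for s
  proof -
    have "g ((1 - s / y) *\<^sub>R 0 + (s / y) *\<^sub>R y) \<le> (1 - s / y) * g 0 + (s / y) * g y"
      by (rule convex_onD[OF conv]) (use that in auto)
    also have "\<dots> < 0" using that y g0 by (simp add: mult_pos_neg)
    finally show ?thesis using y0 by simp
  qed
  have ps: "g s > 0" if "s > y" for s
  proof (rule ccontr)
    assume "\<not> g s > 0"
    have "g ((1 - y / s) *\<^sub>R 0 + (y / s) *\<^sub>R s) \<le> (1 - y / s) * g 0 + (y / s) * g s"
      by (rule convex_onD[OF conv]) (use that y0 in auto)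
    also have "\<dots> < 0"
      using that y0 g0 \<open>\<not> g s > 0\<close> by (intro add_neg_nonpos mult_pos_neg mult_nonneg_nonpos) auto
    finally show False using y0 that y by simp
  qed
  obtain z where z: "0 < z" "z < y" "g y - g 0 = (y - 0) * g' z" using MVT2[of 0 y g g'] d y0 by auto
  then have "y * g' z > 0" using g0 y by simp
  then have "g' z > 0" using y0 zero_less_mult_pos by blast
  also have "g' z < g' y" using DERIV_pos_imp_increasing[of z y g'] z d pos by blast
  finally show ?thesis using y y0 neg ps by blast
qed

text \<open>The boundary equation of K in polar coordinates about (t, 0): y is the height above the
  centre and \<tau> y^2 the squared distance from the axis.\<close>

definition K_eq :: "real \<Rightarrow> real \<Rightarrow> real \<Rightarrow> real \<Rightarrow> real" where
  "K_eq \<tau> t e y = (t + y)\<^sup>2 + \<tau> * y\<^sup>2 + e * bump (t + y) - 1"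

definition K_eq' :: "real \<Rightarrow> real \<Rightarrow> real \<Rightarrow> real \<Rightarrow> real" where
  "K_eq' \<tau> t e y = 2 * (t + y) + 2 * \<tau> * y + e * bump_deriv (t + y)"

lemma bump_shift_derivs:
  "((\<lambda>y. bump (t + y)) has_real_derivative bump_deriv (t + y)) (at y)"
  "((\<lambda>y. bump_deriv (t + y)) has_real_derivative bump_deriv2 (t + y)) (at y)"
  using DERIV_shift[of bump "bump_deriv (t + y)" y t] DERIV_shift[of bump_deriv "bump_deriv2 (t + y)" y t] bump_derivs[of "t + y"]
  by (auto simp: add.commute)

lemma K_eq_deriv: "(K_eq \<tau> t e has_real_derivative K_eq' \<tau> t e y) (at y)"
  unfolding K_eq_def K_eq'_def
  by (auto intro!: derivative_eq_intros bump_shift_derivs simp: power2_eq_square)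

text \<open>The bound on t keeps the centre of the polar coordinates below the flattened band.\<close>

definition K_dom :: "(real \<times> real \<times> real) set" where
  "K_dom = {-1/2<..} \<times> {-1/8<..<1/8} \<times> {-eps_max<..<eps_max}"

lemma K_eq_root_ex:
  assumes "(\<tau>, t, e) \<in> K_dom"
  shows "\<exists>y. 0 < y \<and> y < 2 \<and> K_eq \<tau> t e y = 0 \<and> (\<forall>s\<ge>0. s < y \<longrightarrow> K_eq \<tau> t e s < 0) \<and> (\<forall>s>y. K_eq \<tau> t e s > 0) \<and> K_eq' \<tau> t e y > 0"
proof (rule convex_root[OF K_eq_deriv])
  have a: "\<tau> > -1/2" "-1/8 < t" "t < 1/8" "\<bar>e\<bar> < eps_max" using assms by (auto simp: K_dom_def abs_less_iff)
  show "(K_eq' \<tau> t e has_real_derivative 2 + 2 * \<tau> + e * bump_deriv2 (t + x)) (at x)" for x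
    unfolding K_eq'_def by (auto intro!: derivative_eq_intros bump_shift_derivs)
  \<comment> \<open>\<tau> > -1/2 leaves more than 1, of which the bump takes at most 1/4.\<close>
  show "2 + 2 * \<tau> + e * bump_deriv2 (t + x) > 0" for x using eps_max_bound(2)[OF a(4), of "t + x"] a by linarith
  have "t\<^sup>2 < 1" using a by (simp add: abs_square_less_1)
  then show "K_eq \<tau> t e 0 < 0" using bump_zero[of t] a by (simp add: K_eq_def)
  \<comment> \<open>The worst case at y = 2 is (15/8)^2 - 4/2 - 1/4 - 1, still positive.\<close>
  have "(15/8)\<^sup>2 \<le> (t + 2)\<^sup>2" using a by (intro power_mono) auto
  then show "K_eq \<tau> t e 2 > 0" using eps_max_bound(1)[OF a(4), of "t + 2"] a by (simp add: K_eq_def power2_eq_square)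
qed auto

definition is_root :: "real \<Rightarrow> real \<Rightarrow> real \<Rightarrow> real \<Rightarrow> bool" where
  "is_root \<tau> t e y \<longleftrightarrow> 0 < y \<and> y < 2 \<and> K_eq \<tau> t e y = 0 \<and> (\<forall>s\<ge>0. s < y \<longrightarrow> K_eq \<tau> t e s < 0) \<and>
    (\<forall>s>y. K_eq \<tau> t e s > 0) \<and> K_eq' \<tau> t e y > 0"

definition K_radius :: "real \<times> real \<times> real \<Rightarrow> real" where
  "K_radius p = (SOME y. is_root (fst p) (fst (snd p)) (snd (snd p)) y)"

lemma K_radius:
  assumes "(\<tau>, t, e) \<in> K_dom"
  shows "0 < K_radius (\<tau>, t, e)" "K_radius (\<tau>, t, e) < 2" "K_eq \<tau> t e (K_radius (\<tau>, t, e)) = 0"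
    "\<And>s. 0 \<le> s \<Longrightarrow> s < K_radius (\<tau>, t, e) \<Longrightarrow> K_eq \<tau> t e s < 0"
    "\<And>s. s > K_radius (\<tau>, t, e) \<Longrightarrow> K_eq \<tau> t e s > 0" "K_eq' \<tau> t e (K_radius (\<tau>, t, e)) > 0"
proof -
  have "\<exists>y. is_root \<tau> t e y" unfolding is_root_def by (rule K_eq_root_ex[OF assms])
  then have "is_root \<tau> t e (K_radius (\<tau>, t, e))" unfolding K_radius_def fst_conv snd_conv by (rule someI_ex)
  then show "0 < K_radius (\<tau>, t, e)" "K_radius (\<tau>, t, e) < 2" "K_eq \<tau> t e (K_radius (\<tau>, t, e)) = 0"
    "\<And>s. 0 \<le> s \<Longrightarrow> s < K_radius (\<tau>, t, e) \<Longrightarrow> K_eq \<tau> t e s < 0"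
    "\<And>s. s > K_radius (\<tau>, t, e) \<Longrightarrow> K_eq \<tau> t e s > 0" "K_eq' \<tau> t e (K_radius (\<tau>, t, e)) > 0"
    unfolding is_root_def by blast+
qed

lemma K_radius_unique:
  assumes "(\<tau>, t, e) \<in> K_dom" "y > 0" "K_eq \<tau> t e y = 0" shows "K_radius (\<tau>, t, e) = y"
  using K_radius(4)[OF assms(1), of y] K_radius(5)[OF assms(1), of y] assms by fastforce

lemma partial_slice_snd:
  fixes H :: "'a::euclidean_space \<times> real \<Rightarrow> real"
  assumes "Cinf W H" "(x, y) \<in> W" "((\<lambda>s. H (x, s)) has_real_derivative d) (at y)"
  shows "partial H (0, 1) (x, y) = d"
proof -
  have D: "(H has_derivative frechet_derivative H (at (x, y))) (at (x, y))" by (rule Cinf_has_derivative[OF assms(1,2)])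
  have "((\<lambda>s. H (x, s)) has_derivative (\<lambda>h. frechet_derivative H (at (x, y)) (0, h))) (at y)"
    using has_derivative_compose[OF has_derivative_Pair[OF has_derivative_const has_derivative_ident] D] .
  then have "(\<lambda>h. frechet_derivative H (at (x, y)) (0, h)) = (*) d"
    using assms(3) unfolding has_field_derivative_def by (rule has_derivative_unique)
  then show ?thesis by (metis mult.right_neutral)
qed

lemma open_K_dom: "open K_dom" by (auto simp: K_dom_def intro!: open_Times)

lemma Cinf_K_radius: "Cinf K_dom K_radius"
proof -
  define H :: "(real \<times> real \<times> real) \<times> real \<Rightarrow> real" where
    "H z = K_eq (fst (fst z)) (fst (snd (fst z))) (snd (snd (fst z))) (snd z)" for z
  have H: "Cinf UNIV H"
    unfolding H_def K_eq_def
    by (intro Cinf_diff Cinf_add Cinf_mult Cinf_power Cinf_const Cinf_compose_real[OF bump(1)] Cinf_linear bounded_linear_intros) auto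
  show ?thesis
  proof (rule implicit_Cinf_sign[where H=H and a=0 and b=2])
    show "Cinf (K_dom \<times> {0<..<2}) H" by (rule Cinf_subset[OF H]) (auto intro: open_Times open_K_dom)
    fix x assume "x \<in> K_dom"
    moreover obtain \<tau> t e where x: "x = (\<tau>, t, e)" by (cases x)
    ultimately have u: "(\<tau>, t, e) \<in> K_dom" by simp
    note y = K_radius[OF u, folded x]
    show "K_radius x \<in> {0<..<2}" using y by auto
    show "H (x, s) < 0" if "0 < s" "s < K_radius x" for s using y(4)[of s] that by (simp add: H_def x)
    show "H (x, s) > 0" if "K_radius x < s" "s < 2" for s using y(5)[of s] that by (simp add: H_def x)
    show "H (x, K_radius x) = 0" using y(3) by (simp add: H_def x)
    have "partial H (0, 1) (x, K_radius x) = K_eq' \<tau> t e (K_radius x)"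
      by (rule partial_slice_snd[OF H]) (auto simp: H_def x K_eq_deriv)
    then show "partial H (0, 1) (x, K_radius x) \<noteq> 0" using y(6) by simp
  qed (rule open_K_dom)
qed

text \<open>The radial integral of the volume element minus that of the ball; in contrast to either
  term it vanishes for large \<tau>.\<close>

definition radius_defect :: "nat \<Rightarrow> real \<times> real \<times> real \<Rightarrow> real" where
  "radius_defect d p = (K_radius p ^ Suc d - K_radius (fst p, fst (snd p), 0) ^ Suc d) / real (Suc d)"

lemma K_dom_zero: "(\<tau>, t, e) \<in> K_dom \<Longrightarrow> (\<tau>, t, 0) \<in> K_dom"
  using eps_max_pos by (auto simp: K_dom_def)

lemma Cinf_K_radius_ball: "Cinf K_dom (\<lambda>p. K_radius (fst p, fst (snd p), 0))"
  by (rule Cinf_compose[OF Cinf_K_radius open_K_dom])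
    (use K_dom_zero in \<open>auto simp: Basis_prod_def intro!: Cinf_linear Cinf_const open_K_dom bounded_linear_intros\<close>)

lemma Cinf_radius_defect: "Cinf K_dom (radius_defect d)"
  unfolding radius_defect_def[abs_def]
  by (intro Cinf_divide Cinf_diff Cinf_power Cinf_K_radius Cinf_K_radius_ball Cinf_const open_K_dom) auto

lemma radius_defect_zero: "radius_defect d (\<tau>, t, 0) = 0" by (simp add: radius_defect_def)

text \<open>For \<open>\<tau> > 100\<close> the boundary point lies within 1/10 of the centre, hence below the flattened band.\<close>

lemma radius_defect_vanish:
  assumes "(\<tau>, t, e) \<in> K_dom" "\<tau> > 100" shows "radius_defect d (\<tau>, t, e) = 0"
proof -
  define y where "y = K_radius (\<tau>, t, 0)"
  have y: "y > 0" "K_eq \<tau> t 0 y = 0" using K_radius[OF K_dom_zero[OF assms(1)]] by (auto simp: y_def)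
  have "y < 1/10"
  proof (rule ccontr)
    assume "\<not> ?thesis"
    then have "(1/10)\<^sup>2 \<le> y\<^sup>2" by (intro power_mono) auto
    then have "100 * (1/10)\<^sup>2 < \<tau> * y\<^sup>2" using assms(2) by (intro mult_less_le_imp_less) auto
    moreover have "\<tau> * y\<^sup>2 \<le> 1" using y(2) by (simp add: K_eq_def) (smt (verit) zero_le_power2)
    ultimately show False by (simp add: power2_eq_square)
  qed
  then have "t + y < 1/4" using assms(1) by (simp add: K_dom_def)
  then have "K_eq \<tau> t e y = 0" using y(2) bump_zero[of "t + y"] by (simp add: K_eq_def)
  then have "K_radius (\<tau>, t, e) = y" by (rule K_radius_unique[OF assms(1) y(1)])
  then show ?thesis by (simp add: radius_defect_def y_def)
qed

definition K_profile :: "real \<Rightarrow> real \<Rightarrow> real \<Rightarrow> bool" where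
  "K_profile e z a \<longleftrightarrow> a + z\<^sup>2 + e * bump z \<le> 1"

lemma bump_measurable [measurable]: "bump \<in> borel_measurable borel"
  by (intro borel_measurable_continuous_onI Cinf_continuous bump)

lemma K_profile_measurable [measurable]: "Measurable.pred (borel \<Otimes>\<^sub>M borel) (\<lambda>(z, a). K_profile e z a)"
  unfolding K_profile_def by measurable

lemma K_profile_zero: "K_profile 0 = ballP" by (simp add: fun_eq_iff K_profile_def ballP_def)

lemma admissible_radius_defect:
  assumes "\<bar>t\<bar> < 1/8" "\<bar>e\<bar> < eps_max"
  shows "admissible (-1/2) (\<lambda>\<tau>. radius_defect d (\<tau>, t, e))"
proof (rule admissible_slice[where g="radius_defect d" and p="(t, e)"])
  show "Cinf ({-1/2<..} \<times> ({-1/8<..<1/8} \<times> {-eps_max<..<eps_max})) (radius_defect d)" using Cinf_radius_defect by (simp add: K_dom_def)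
  show "radius_defect d (s, p) = 0" if "s > 100" "p \<in> {-1/8<..<1/8} \<times> {-eps_max<..<eps_max}" for s p
    using radius_defect_vanish[of s "fst p" "snd p" d] that by (auto simp: K_dom_def)
qed (use assms in \<open>auto simp: abs_less_iff\<close>)

text \<open>Polar coordinates for the part above the centre. Setting Y to 0 below -1/2 makes it
  measurable everywhere, and the transform at \<sigma> \<ge> 0 does not see those values.\<close>

lemma half_vol_K_profile:
  assumes "0 \<le> \<sigma>" "\<bar>t\<bar> < 1/8" "\<bar>e\<bar> < eps_max"
  defines "Y \<equiv> \<lambda>\<tau>. if \<tau> > -1/2 then K_radius (\<tau>, t, e) else 0"
  shows "half_vol d (\<lambda>z. K_profile e (t + z)) \<sigma> = (nn_abel ^^ d) (\<lambda>\<tau>. ennreal (Y \<tau> ^ Suc d / Suc d)) \<sigma>"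
    and "Y \<in> borel_measurable borel" "\<And>\<tau>. Y \<tau> \<ge> 0"
proof -
  have u: "(\<tau>, t, e) \<in> K_dom" if "\<tau> > -1/2" for \<tau> using assms that by (auto simp: K_dom_def abs_less_iff)
  have "continuous_on {-1/2<..} (\<lambda>\<tau>. K_radius (\<tau>, t, e))"
    by (rule continuous_on_compose2[OF Cinf_continuous[OF Cinf_K_radius]]) (use u in \<open>auto intro!: continuous_intros\<close>)
  from borel_measurable_continuous_on_indicator[OF _ this]
  have "(\<lambda>\<tau>. indicator {-1/2<..} \<tau> *\<^sub>R K_radius (\<tau>, t, e)) \<in> borel_measurable borel" by simp
  moreover have "(\<lambda>\<tau>. indicator {-1/2<..} \<tau> *\<^sub>R K_radius (\<tau>, t, e)) = Y" by (auto simp: Y_def fun_eq_iff)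
  ultimately show m: "Y \<in> borel_measurable borel" by simp
  show nn: "Y \<tau> \<ge> 0" for \<tau> using K_radius(1)[OF u] by (auto simp: Y_def less_imp_le)
  show "half_vol d (\<lambda>z. K_profile e (t + z)) \<sigma> = (nn_abel ^^ d) (\<lambda>\<tau>. ennreal (Y \<tau> ^ Suc d / Suc d)) \<sigma>"
    unfolding half_vol_def
  proof (rule polar_half[OF m nn])
    fix z \<tau> :: real assume z: "z > 0" "\<tau> \<ge> \<sigma>"
    then have t: "\<tau> > -1/2" using assms by simp
    have "K_profile e (t + z) (\<tau> * z\<^sup>2) \<longleftrightarrow> K_eq \<tau> t e z \<le> 0" by (simp add: K_profile_def K_eq_def algebra_simps)
    also have "\<dots> \<longleftrightarrow> z \<le> Y \<tau>"
      using K_radius(3)[OF u[OF t]] K_radius(4,5)[OF u[OF t], of z] z t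
      by (cases z "K_radius (\<tau>, t, e)" rule: linorder_cases) (auto simp: Y_def)
    finally show "K_profile e (t + z) (\<tau> * z\<^sup>2) \<longleftrightarrow> z \<le> Y \<tau>" .
  next
    fix z show "Measurable.pred borel (K_profile e (t + z))" unfolding K_profile_def by measurable
  qed
qed

section \<open>Section volumes of K relative to the ball\<close>

definition K_corr :: "nat \<Rightarrow> real \<times> real \<times> real \<Rightarrow> real" where "K_corr d = (abel_par ^^ d) (radius_defect d)"

text \<open>Below the centre K and the ball coincide, so the volumes differ by the transform of the
  radius defect of the upper half. Nonnegativity is recorded because \<open>ennreal\<close> would
  hide a negative value.\<close>

lemma sec_vol_at_K_profile:
  assumes "0 \<le> \<sigma>" "\<bar>t\<bar> < 1/8" "\<bar>e\<bar> < eps_max"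
  shows "sec_vol_at d (K_profile e) \<sigma> t = ennreal (ball_vol d \<sigma> t + K_corr d (\<sigma>, t, e))" "ball_vol d \<sigma> t + K_corr d (\<sigma>, t, e) \<ge> 0"
proof -
  let ?Y = "\<lambda>e \<tau>. if \<tau> > -1/2 then K_radius (\<tau>, t, e) else 0"
  have z0: "\<bar>0\<bar> < eps_max" using eps_max_pos by simp
  note UK = half_vol_K_profile[OF assms] and UB = half_vol_K_profile[OF assms(1,2) z0]
  define lo where "lo = half_vol d (\<lambda>z. ballP (t - z)) \<sigma>"
  have lo: "half_vol d (\<lambda>z. K_profile e (t - z)) \<sigma> = lo"
    unfolding lo_def half_vol_def
  proof (intro nn_integral_cong)
    fix z :: real
    have "K_profile e (t - z) = ballP (t - z)" if "z > 0"
    proof -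
      have "t - z \<le> 1/4" using that assms(2) by linarith
      then have "bump (t - z) = 0" by (intro bump_zero disjI1)
      then show ?thesis by (simp add: K_profile_def ballP_def fun_eq_iff)
    qed
    then show "(nn_abel ^^ d) (\<lambda>a. of_bool (K_profile e (t - z) a)) (\<sigma> * z\<^sup>2) * indicator {0<..} z =
      (nn_abel ^^ d) (\<lambda>a. of_bool (ballP (t - z) a)) (\<sigma> * z\<^sup>2) * indicator {0<..} z"
      by (auto simp: indicator_def)
  qed
  have "\<sigma> * t\<^sup>2 / (1 + \<sigma>) < 1"
  proof -
    have "t\<^sup>2 \<le> 1" using assms by (simp add: abs_square_le_1)
    then have "\<sigma> * t\<^sup>2 \<le> \<sigma> * 1" using assms by (intro mult_left_mono) auto
    then show ?thesis using assms by simp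
  qed
  then have ball: "sec_vol_at d ballP \<sigma> t = ennreal (ball_vol d \<sigma> t)" using assms by (intro sec_vol_at_ball) auto
  have [measurable]: "Measurable.pred (borel \<Otimes>\<^sub>M borel) (\<lambda>(z, a). ballP z a)" unfolding ballP_def by measurable
  have hb: "ennreal (ball_vol d \<sigma> t) = half_vol d (\<lambda>z. K_profile 0 (t + z)) \<sigma> + lo"
    unfolding ball[symmetric] lo_def K_profile_zero by (rule sec_vol_at_halves) measurable
  have hk: "sec_vol_at d (K_profile e) \<sigma> t = half_vol d (\<lambda>z. K_profile e (t + z)) \<sigma> + lo"
    unfolding lo[symmetric] by (rule sec_vol_at_halves) measurable
  have "half_vol d (\<lambda>z. K_profile 0 (t + z)) \<sigma> \<noteq> top" "lo \<noteq> top" using hb by auto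
  then obtain b l where b: "half_vol d (\<lambda>z. K_profile 0 (t + z)) \<sigma> = ennreal b" "b \<ge> 0" and l: "lo = ennreal l" "l \<ge> 0"
    by (metis ennreal_cases)
  have bl: "ball_vol d \<sigma> t = b + l"
  proof -
    have "ennreal (ball_vol d \<sigma> t) = ennreal (b + l)" using hb b l by simp
    moreover have "ball_vol d \<sigma> t \<ge> 0" using ball_const(2)[of d] by (simp add: ball_vol_def)
    ultimately show ?thesis using b(2) l(2) by (metis add_nonneg_nonneg ennreal_inj)
  qed
  have "(nn_abel ^^ d) (\<lambda>\<tau>. ennreal (?Y e \<tau> ^ Suc d / Suc d)) \<sigma> = ennreal (b + (abel ^^ d) (\<lambda>\<tau>. radius_defect d (\<tau>, t, e)) \<sigma>)
    \<and> b + (abel ^^ d) (\<lambda>\<tau>. radius_defect d (\<tau>, t, e)) \<sigma> \<ge> 0"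
  proof (rule nn_abel_pow_difference[where ball_radius_pow="\<lambda>\<tau>. ?Y 0 \<tau> ^ Suc d / Suc d"])
    show "(nn_abel ^^ d) (\<lambda>\<tau>. ennreal (?Y 0 \<tau> ^ Suc d / Suc d)) \<sigma> = ennreal b" using UB(1) b by simp
    show "admissible (-1/2) (\<lambda>\<tau>. radius_defect d (\<tau>, t, e))" by (rule admissible_radius_defect[OF assms(2,3)])
    show "(\<lambda>\<tau>. ?Y e \<tau> ^ Suc d / Suc d) \<in> borel_measurable borel" "(\<lambda>\<tau>. ?Y 0 \<tau> ^ Suc d / Suc d) \<in> borel_measurable borel"
      using UK(2) UB(2) by measurable
    show "?Y e \<tau> ^ Suc d / Suc d \<ge> 0" "?Y 0 \<tau> ^ Suc d / Suc d \<ge> 0" for \<tau>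
      using UK(3)[of \<tau>] UB(3)[of \<tau>] by (simp_all only: zero_le_power divide_nonneg_nonneg of_nat_0_le_iff)
    show "?Y e \<tau> ^ Suc d / Suc d = ?Y 0 \<tau> ^ Suc d / Suc d + radius_defect d (\<tau>, t, e)" if "\<tau> \<ge> \<sigma>" for \<tau>
      using that assms by (simp add: radius_defect_def diff_divide_distrib)
  qed (use assms b in auto)
  then have *: "half_vol d (\<lambda>z. K_profile e (t + z)) \<sigma> = ennreal (b + K_corr d (\<sigma>, t, e))" "b + K_corr d (\<sigma>, t, e) \<ge> 0"
    unfolding UK(1) K_corr_def abel_par_pow by auto
  show "sec_vol_at d (K_profile e) \<sigma> t = ennreal (ball_vol d \<sigma> t + K_corr d (\<sigma>, t, e))" "ball_vol d \<sigma> t + K_corr d (\<sigma>, t, e) \<ge> 0"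
    using * l hk bl by (simp_all add: ennreal_plus[symmetric] add_ac del: ennreal_plus)
qed

definition K_dom_snd :: "(real \<times> real) set" where "K_dom_snd = {-1/8<..<1/8} \<times> {-eps_max<..<eps_max}"

lemma open_K_dom_snd: "open K_dom_snd" by (auto simp: K_dom_snd_def intro!: open_Times)
lemma K_dom_K_dom_snd: "K_dom = {-1/2<..} \<times> K_dom_snd" by (simp add: K_dom_def K_dom_snd_def)

lemma Cinf_K_corr: "Cinf K_dom (K_corr d)"
  unfolding K_corr_def K_dom_K_dom_snd by (rule Cinf_abel_par_pow[OF Cinf_radius_defect[unfolded K_dom_K_dom_snd] open_K_dom_snd])

lemma abel_pow_zero: "(\<And>t. t \<ge> s \<Longrightarrow> f t = 0) \<Longrightarrow> (abel ^^ k) f s = 0"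
proof -
  assume "\<And>t. t \<ge> s \<Longrightarrow> f t = 0"
  then have "(abel ^^ k) f s = (abel ^^ k) (\<lambda>t. 0 * f t) s" by (intro abel_pow_cong) auto
  then show "(abel ^^ k) f s = 0" unfolding abel_pow_cmult by simp
qed

lemma K_corr_zero: "K_corr d (\<sigma>, t, 0) = 0"
  unfolding K_corr_def abel_par_pow by (rule abel_pow_zero) (rule radius_defect_zero)

lemma K_corr_vanish: "(\<sigma>, p) \<in> K_dom \<Longrightarrow> \<sigma> > 100 \<Longrightarrow> K_corr d (\<sigma>, p) = 0"
  unfolding K_corr_def abel_par_pow
  by (cases p, intro abel_pow_zero) (auto simp: K_dom_def intro!: radius_defect_vanish)

section \<open>The derivative of the section volume in the height\<close>

lemma partial_t_slice:
  fixes f :: "real \<times> real \<times> real \<Rightarrow> real"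
  assumes "Cinf W f" "(\<sigma>, t, e) \<in> W"
  shows "((\<lambda>s. f (\<sigma>, s, e)) has_real_derivative partial f (0, 1, 0) (\<sigma>, t, e)) (at t)"
proof -
  have D: "(f has_derivative frechet_derivative f (at (\<sigma>, t, e))) (at (\<sigma>, t, e))" by (rule Cinf_has_derivative[OF assms])
  have 1: "((\<lambda>s. f (\<sigma>, s, e)) has_derivative (\<lambda>h. frechet_derivative f (at (\<sigma>, t, e)) (0, h, 0))) (at t)"
    using has_derivative_compose[OF has_derivative_Pair[OF has_derivative_const has_derivative_Pair[OF has_derivative_ident has_derivative_const]] D] .
  have "frechet_derivative f (at (\<sigma>, t, e)) (0, h, 0) = partial f (0, 1, 0) (\<sigma>, t, e) * h" for h
    using linear_scale[OF has_derivative_linear[OF D], of h "(0, 1, 0)"] by (simp add: mult.commute)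
  then have 2: "(\<lambda>h. frechet_derivative f (at (\<sigma>, t, e)) (0, h, 0)) = (*) (partial f (0, 1, 0) (\<sigma>, t, e))" by (rule ext)
  show ?thesis unfolding has_field_derivative_def 2[symmetric] by (rule 1)
qed

lemma partial_t_zero:
  assumes "Cinf K_dom f" "(\<sigma>, t, e) \<in> K_dom" "\<And>s. \<bar>s\<bar> < 1/8 \<Longrightarrow> f (\<sigma>, s, e) = c"
  shows "partial f (0, 1, 0) (\<sigma>, t, e) = 0"
proof -
  have "((\<lambda>s. c) has_real_derivative 0) (at t)" by simp
  then have "((\<lambda>s. f (\<sigma>, s, e)) has_real_derivative 0) (at t)"
    by (rule has_field_derivative_transform_within_open[of _ _ _ "{-1/8<..<1/8}"])
      (use assms in \<open>auto simp: K_dom_def abs_less_iff\<close>)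
  then show ?thesis using partial_t_slice[OF assms(1,2)] DERIV_unique by blast
qed

definition K_corr_dt :: "nat \<Rightarrow> real \<times> real \<times> real \<Rightarrow> real" where "K_corr_dt d = partial (K_corr d) (0, 1, 0)"

lemma Cinf_K_corr_dt: "Cinf K_dom (K_corr_dt d)"
  unfolding K_corr_dt_def by (intro Cinf_partial Cinf_K_corr) (auto simp: Basis_prod_def)

lemma ball_vol_zero: "ball_vol d 0 t = ball_const d" by (simp add: ball_vol_def)

lemma K_corr_dt_at_zero:
  assumes "(0, t, e) \<in> K_dom" shows "K_corr_dt d (0, t, e) = 0"
  unfolding K_corr_dt_def
proof (rule partial_t_zero[OF Cinf_K_corr assms])
  fix s :: real assume s: "\<bar>s\<bar> < 1/8"
  have e: "\<bar>e\<bar> < eps_max" using assms by (auto simp: K_dom_def abs_less_iff)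
  have "ennreal (ball_const d + K_corr d (0, s, e)) = ennreal (ball_const d + K_corr d (0, 0, e))"
    using sec_vol_at_K_profile(1)[of 0 s e d] sec_vol_at_K_profile(1)[of 0 0 e d] s e sec_vol_at_zero[of d "K_profile e" s] by (simp add: ball_vol_zero)
  then show "K_corr d (0, s, e) = K_corr d (0, 0, e)"
    using sec_vol_at_K_profile(2)[of 0 s e d] sec_vol_at_K_profile(2)[of 0 0 e d] s e by (simp add: ball_vol_zero)
qed

lemma K_corr_dt_zero: "(\<sigma>, t, 0) \<in> K_dom \<Longrightarrow> K_corr_dt d (\<sigma>, t, 0) = 0"
  unfolding K_corr_dt_def by (rule partial_t_zero[OF Cinf_K_corr, of _ _ _ _ 0]) (auto simp: K_corr_zero)

lemma K_corr_dt_vanish: "(\<sigma>, t, e) \<in> K_dom \<Longrightarrow> \<sigma> > 100 \<Longrightarrow> K_corr_dt d (\<sigma>, t, e) = 0"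
  unfolding K_corr_dt_def by (rule partial_t_zero[OF Cinf_K_corr, of _ _ _ _ 0]) (auto simp: K_dom_def abs_less_iff intro!: K_corr_vanish)

text \<open>The t-derivative of the section volume vanishes at \<open>\<sigma> = 0\<close>, where hyperplanes are parallel to the
  axis; this is its smooth quotient by \<open>\<sigma>\<close>.\<close>

definition K_corr_slope :: "nat \<Rightarrow> real \<times> real \<times> real \<Rightarrow> real" where
  "K_corr_slope d p = integral {0..1} (\<lambda>l. - neg_deriv (K_corr_dt d) (l * fst p, snd p))"

lemma K_dom_scale: "(\<sigma>, p) \<in> K_dom \<Longrightarrow> 0 \<le> l \<Longrightarrow> l \<le> 1 \<Longrightarrow> (l * \<sigma>, p) \<in> K_dom"
proof -
  assume a: "(\<sigma>, p) \<in> K_dom" "0 \<le> l" "l \<le> 1"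
  have "l * \<sigma> > -1/2"
  proof (cases "\<sigma> \<ge> 0")
    case True
    then have "l * \<sigma> \<ge> 0" using a by simp
    then show ?thesis by simp
  next
    case False
    then have "l * \<sigma> \<ge> 1 * \<sigma>" using a by (intro mult_right_mono_neg) auto
    then show ?thesis using a by (simp add: K_dom_def)
  qed
  then show ?thesis using a by (simp add: K_dom_def)
qed

lemma Cinf_K_corr_slope: "Cinf K_dom (K_corr_slope d)"
proof -
  define W :: "((real \<times> real \<times> real) \<times> real) set" where "W = (\<lambda>z. (snd z * fst (fst z), snd (fst z))) -` K_dom"
  have W: "open W" unfolding W_def by (intro open_vimage open_K_dom continuous_intros)
  have "Cinf W (\<lambda>z. - neg_deriv (K_corr_dt d) (snd z * fst (fst z), snd (fst z)))"
  proof (rule Cinf_compose_Pair[OF Cinf_minus[OF Cinf_neg_deriv[OF Cinf_K_corr_dt]] W])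
    show "Cinf W (\<lambda>x. (snd x * fst (fst x)) \<bullet> c)" if "c \<in> Basis" for c :: real
    proof -
      have "c = 1" using that by simp
      moreover have "Cinf W (\<lambda>x. snd x)" "Cinf W (\<lambda>x. fst (fst x))"
        by (intro Cinf_linear W bounded_linear_intros)+
      ultimately show ?thesis by (simp add: Cinf_mult)
    qed
    show "Cinf W (\<lambda>x. snd (fst x) \<bullet> c)" for c by (intro Cinf_linear W bounded_linear_intros)
  qed (auto simp: W_def)
  from Cinf_integral[OF this open_K_dom, of 0 1]
  show ?thesis unfolding K_corr_slope_def[abs_def] using K_dom_scale by (auto simp: W_def)
qed

text \<open>Hadamard's lemma: the fundamental theorem of calculus along l \<sigma>, where the
  endpoint \<sigma> = 0 contributes nothing.\<close>

lemma K_corr_slope_times: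
  assumes "(\<sigma>, t, e) \<in> K_dom" shows "\<sigma> * K_corr_slope d (\<sigma>, t, e) = K_corr_dt d (\<sigma>, t, e)"
proof -
  have "((\<lambda>l. \<sigma> * - neg_deriv (K_corr_dt d) (l * \<sigma>, t, e)) has_integral (K_corr_dt d (1 * \<sigma>, t, e) - K_corr_dt d (0 * \<sigma>, t, e))) {0..1}"
  proof (rule fundamental_theorem_of_calculus)
    fix l :: real assume "l \<in> {0..1}"
    then have u: "(l * \<sigma>, t, e) \<in> K_dom" using K_dom_scale[OF assms] by auto
    have d: "((\<lambda>s. K_corr_dt d (s, t, e)) has_real_derivative - neg_deriv (K_corr_dt d) (l * \<sigma>, t, e)) (at (l * \<sigma>))"
      by (rule has_real_derivative_slice[OF Cinf_K_corr_dt[unfolded K_dom_K_dom_snd]]) (use u in \<open>auto simp: K_dom_K_dom_snd\<close>)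
    have "((\<lambda>l. l * \<sigma>) has_real_derivative \<sigma>) (at l)" by (auto intro!: derivative_eq_intros)
    from DERIV_chain2[OF d this]
    have "((\<lambda>l. K_corr_dt d (l * \<sigma>, t, e)) has_real_derivative \<sigma> * - neg_deriv (K_corr_dt d) (l * \<sigma>, t, e)) (at l)"
      by (simp add: mult.commute)
    then show "((\<lambda>l. K_corr_dt d (l * \<sigma>, t, e)) has_vector_derivative \<sigma> * - neg_deriv (K_corr_dt d) (l * \<sigma>, t, e)) (at l within {0..1})"
      unfolding has_real_derivative_iff_has_vector_derivative[symmetric] by (rule has_field_derivative_at_within)
  qed simp
  from integral_unique[OF this]
  have "\<sigma> * K_corr_slope d (\<sigma>, t, e) = K_corr_dt d (\<sigma>, t, e) - K_corr_dt d (0, t, e)" by (simp add: K_corr_slope_def)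
  moreover have "(0, t, e) \<in> K_dom" using assms by (simp add: K_dom_def)
  ultimately show ?thesis using K_corr_dt_at_zero by simp
qed

lemma K_corr_slope_vanish:
  assumes "(\<sigma>, t, e) \<in> K_dom" "\<sigma> > 100" shows "K_corr_slope d (\<sigma>, t, e) = 0"
  using K_corr_slope_times[OF assms(1), of d] K_corr_dt_vanish[OF assms, of d] assms(2) by auto

lemma K_corr_slope_zero:
  assumes "(\<sigma>, t, 0) \<in> K_dom" shows "K_corr_slope d (\<sigma>, t, 0) = 0"
proof -
  have "- neg_deriv (K_corr_dt d) (l * \<sigma>, t, 0) = 0" if "l \<in> {0..1}" for l
  proof -
    have u: "(l * \<sigma>, t, 0) \<in> K_dom" using K_dom_scale[OF assms] that by auto
    have d: "((\<lambda>s. K_corr_dt d (s, t, 0)) has_real_derivative - neg_deriv (K_corr_dt d) (l * \<sigma>, t, 0)) (at (l * \<sigma>))"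
      by (rule has_real_derivative_slice[OF Cinf_K_corr_dt[unfolded K_dom_K_dom_snd]]) (use u in \<open>auto simp: K_dom_K_dom_snd\<close>)
    have "((\<lambda>s. 0) has_real_derivative 0) (at (l * \<sigma>))" by simp
    then have "((\<lambda>s. K_corr_dt d (s, t, 0)) has_real_derivative 0) (at (l * \<sigma>))"
      by (rule has_field_derivative_transform_within_open[of _ _ _ "{-1/2<..}"])
        (use u in \<open>auto simp: K_dom_def intro!: K_corr_dt_zero\<close>)
    then show ?thesis using d DERIV_unique by blast
  qed
  then have "K_corr_slope d (\<sigma>, t, 0) = integral {0..1} (\<lambda>l::real. 0)"
    unfolding K_corr_slope_def by (intro integral_cong) auto
  then show ?thesis by simp
qed

text \<open>The t-derivative of \<open>ball_vol\<close> divided by \<sigma>, with the factor t in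
  front to show its zero at t = 0.\<close>

definition ball_slope :: "nat \<Rightarrow> real \<Rightarrow> real \<Rightarrow> real" where
  "ball_slope d \<sigma> t = t * (- ball_const d * (real d + 1) * (1 + \<sigma>) powr (-3/2) * (1 - \<sigma> * t\<^sup>2 / (1 + \<sigma>)) powr ((real d - 1) / 2))"

lemma ball_inner_pos:
  fixes \<sigma> t :: real
  assumes "\<sigma> > -1/2" "\<bar>t\<bar> < 1" shows "1 - \<sigma> * t\<^sup>2 / (1 + \<sigma>) > 0"
proof -
  have t: "t\<^sup>2 < 1" using assms by (simp add: abs_square_less_1)
  have "\<sigma> * t\<^sup>2 < 1 + \<sigma>"
  proof (cases "\<sigma> \<ge> 0")
    case True
    then have "\<sigma> * t\<^sup>2 \<le> \<sigma> * 1" using t by (intro mult_left_mono) auto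
    then show ?thesis by simp
  next
    case False
    then have "\<sigma> * t\<^sup>2 \<le> 0" by (simp add: mult_nonpos_nonneg)
    then show ?thesis using assms by simp
  qed
  then show ?thesis using assms by simp
qed

lemma K_dom_inner:
  assumes "p \<in> K_dom"
  shows "0 < 1 - fst p * (fst (snd p))\<^sup>2 / (1 + fst p)" "0 < 1 + fst p" "1 + fst p \<noteq> 0"
proof -
  have "fst p > -1/2" "\<bar>fst (snd p)\<bar> < 1" using assms by (auto simp: K_dom_def)
  then show "0 < 1 - fst p * (fst (snd p))\<^sup>2 / (1 + fst p)" "0 < 1 + fst p" "1 + fst p \<noteq> 0"
    using ball_inner_pos by auto
qed

lemma Cinf_K_dom_coords: "Cinf K_dom (\<lambda>p. fst p)" "Cinf K_dom (\<lambda>p. fst (snd p))"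
  by (intro Cinf_linear open_K_dom bounded_linear_intros)+

lemma Cinf_compose_triple:
  fixes f :: "real \<times> real \<times> real \<Rightarrow> real"
  assumes "Cinf V f" "Cinf U a" "Cinf U b" "Cinf U c" "\<And>x. x \<in> U \<Longrightarrow> (a x, b x, c x) \<in> V"
  shows "Cinf U (\<lambda>x. f (a x, b x, c x))"
  by (rule Cinf_compose[OF assms(1) Cinf_open[OF assms(2)]]) (use assms in \<open>auto simp: Basis_prod_def\<close>)

lemma ball_vol_deriv:
  assumes "\<sigma> > -1/2" "\<bar>t\<bar> < 1"
  shows "(ball_vol d \<sigma> has_real_derivative \<sigma> * ball_slope d \<sigma> t) (at t)"
proof -
  have s: "1 + \<sigma> > 0" using assms by simp
  note i = ball_inner_pos[OF assms]
  have p: "(1 + \<sigma>) powr (-3/2) = (1 + \<sigma>) powr (-1/2) / (1 + \<sigma>)"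
    using s powr_diff[of "1 + \<sigma>" "-1/2" 1] by simp
  have 1: "(ball_vol d \<sigma> has_real_derivative ball_const d * (1 + \<sigma>) powr (-1/2) *
     (((real d + 1) / 2) * (1 - \<sigma> * t\<^sup>2 / (1 + \<sigma>)) powr ((real d + 1) / 2 - 1) * (- (\<sigma> * (2 * t) / (1 + \<sigma>))))) (at t)"
    unfolding ball_vol_def using i s
    by (auto intro!: derivative_eq_intros simp: power2_eq_square)
  have e: "(real d + 1) / 2 - 1 = (real d - 1) / 2" by (simp add: field_simps)
  have eq: "ball_const d * A * (((real d + 1) / 2) * R * (- (\<sigma> * (2 * t) / (1 + \<sigma>)))) =
      \<sigma> * (t * (- ball_const d * (real d + 1) * (A / (1 + \<sigma>)) * R))" for A R
    using s by (simp add: divide_simps)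
  show ?thesis unfolding ball_slope_def p eq[symmetric] by (rule 1[unfolded e])
qed

definition K_slope :: "nat \<Rightarrow> real \<times> real \<times> real \<Rightarrow> real" where
  "K_slope d p = ball_slope d (fst p) (fst (snd p)) + K_corr_slope d p"

lemma Cinf_K_slope: "Cinf K_dom (K_slope d)"
proof -
  have "Cinf K_dom (\<lambda>p. ball_slope d (fst p) (fst (snd p)))"
    unfolding ball_slope_def
    by (intro Cinf_mult Cinf_minus Cinf_const Cinf_powr_compose Cinf_diff Cinf_divide Cinf_add Cinf_power Cinf_K_dom_coords open_K_dom K_dom_inner)
  then show ?thesis unfolding K_slope_def[abs_def] by (intro Cinf_add Cinf_K_corr_slope)
qed

definition K_vol :: "nat \<Rightarrow> real \<times> real \<times> real \<Rightarrow> real" where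
  "K_vol d p = ball_vol d (fst p) (fst (snd p)) + K_corr d p"

lemma Cinf_K_vol: "Cinf K_dom (K_vol d)"
proof -
  have "Cinf K_dom (\<lambda>p. ball_vol d (fst p) (fst (snd p)))"
    unfolding ball_vol_def
    by (intro Cinf_mult Cinf_minus Cinf_const Cinf_powr_compose Cinf_diff Cinf_divide Cinf_add Cinf_power Cinf_K_dom_coords open_K_dom K_dom_inner)
  then show ?thesis unfolding K_vol_def[abs_def] by (intro Cinf_add Cinf_K_corr)
qed

lemma K_vol_deriv:
  assumes "(\<sigma>, t, e) \<in> K_dom"
  shows "((\<lambda>t. K_vol d (\<sigma>, t, e)) has_real_derivative \<sigma> * K_slope d (\<sigma>, t, e)) (at t)"
proof -
  have "(ball_vol d \<sigma> has_real_derivative \<sigma> * ball_slope d \<sigma> t) (at t)"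
    by (rule ball_vol_deriv) (use assms in \<open>auto simp: K_dom_def\<close>)
  moreover have "((\<lambda>t. K_corr d (\<sigma>, t, e)) has_real_derivative \<sigma> * K_corr_slope d (\<sigma>, t, e)) (at t)"
    using partial_t_slice[OF Cinf_K_corr assms] K_corr_slope_times[OF assms] by (simp add: K_corr_dt_def)
  ultimately have "((\<lambda>t. ball_vol d \<sigma> t + K_corr d (\<sigma>, t, e)) has_real_derivative \<sigma> * ball_slope d \<sigma> t + \<sigma> * K_corr_slope d (\<sigma>, t, e)) (at t)"
    by (rule DERIV_add)
  then show ?thesis by (simp add: K_vol_def K_slope_def distrib_left)
qed

text \<open>Nonzero even at \<sigma> = 0: after the division the critical height of the ball is
  nondegenerate, as the implicit function theorem demands.\<close>

lemma ball_slope_deriv0: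
  assumes "\<sigma> > -1/2"
  shows "(ball_slope d \<sigma> has_real_derivative - ball_const d * (real d + 1) * (1 + \<sigma>) powr (-3/2)) (at 0)"
  unfolding ball_slope_def using assms
  by (auto intro!: derivative_eq_intros)

lemma K_slope_zero_e: "(\<sigma>, t, 0) \<in> K_dom \<Longrightarrow> K_slope d (\<sigma>, t, 0) = ball_slope d \<sigma> t"
  by (simp add: K_slope_def K_corr_slope_zero)

section \<open>The maximal section of K and the radial function of L\<close>

text \<open>For e = 0 the slope vanishes at t = 0 and decreases there. Compactness in \<sigma> fixes
  first a range t1 of heights on which it keeps decreasing, then a bound e1 under which its signs at
  both ends persist; this gives a unique smooth zero T. The interval of \<sigma> passes below 0 for
  smoothness at 0, and beyond 100 to overlap the range where the correction vanishes.\<close>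

lemma exists_critical_height:
  "\<exists>t1 e1 T. 0 < t1 \<and> t1 < 1/8 \<and> 0 < e1 \<and> e1 < eps_max \<and> Cinf ({-1/4<..<102::real} \<times> {-e1<..<e1}) T \<and>
    (\<forall>\<sigma> e. \<sigma> \<in> {-1/4<..<102} \<and> e \<in> {-e1<..<e1} \<longrightarrow> \<bar>T (\<sigma>, e)\<bar> < t1 \<and>
      (\<forall>t. - t1 < t \<and> t < T (\<sigma>, e) \<longrightarrow> K_slope d (\<sigma>, t, e) > 0) \<and>
      (\<forall>t. t < t1 \<and> t > T (\<sigma>, e) \<longrightarrow> K_slope d (\<sigma>, t, e) < 0))"
proof -
  define C where "C = {-1/4..102 :: real}"
  have C: "compact C" by (simp add: C_def)
  let ?dP = "partial (K_slope d) (0, 1, 0)"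
  have cdP: "continuous_on K_dom ?dP"
    by (intro Cinf_continuous Cinf_partial Cinf_K_slope) (auto simp: Basis_prod_def)
  have u0: "(\<sigma>, 0, 0) \<in> K_dom" if "\<sigma> \<in> C" for \<sigma> using that eps_max_pos by (auto simp: C_def K_dom_def)
  have neg: "?dP (\<sigma>, 0, 0) < 0" if "\<sigma> \<in> C" for \<sigma>
  proof -
    have "((\<lambda>s. K_slope d (\<sigma>, s, 0)) has_real_derivative - ball_const d * (real d + 1) * (1 + \<sigma>) powr (-3/2)) (at 0)"
      by (rule has_field_derivative_transform_within_open[OF ball_slope_deriv0, of _ "{-1/8<..<1/8}"])
        (use u0[OF that] in \<open>auto simp: K_dom_def intro!: K_slope_zero_e[symmetric]\<close>)
    then have "?dP (\<sigma>, 0, 0) = - ball_const d * (real d + 1) * (1 + \<sigma>) powr (-3/2)"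
      using partial_t_slice[OF Cinf_K_slope u0[OF that]] DERIV_unique by blast
    moreover have "ball_const d * (real d + 1) * (1 + \<sigma>) powr (-3/2) > 0"
      using ball_const(2)[of d] that by (intro mult_pos_pos) (auto simp: C_def)
    ultimately show ?thesis by simp
  qed
  have "\<exists>\<delta>>0. \<forall>x\<in>C. \<forall>y. dist y (0, 0) < \<delta> \<longrightarrow> (x, y) \<in> K_dom \<and> - ?dP (x, y) > 0"
    by (rule tube_positive[OF C open_K_dom]) (use cdP u0 neg in \<open>auto intro!: continuous_intros\<close>)
  then obtain \<delta> where \<delta>: "\<delta> > 0" "\<And>\<sigma> t e. \<sigma> \<in> C \<Longrightarrow> norm (t, e) < \<delta> \<Longrightarrow> (\<sigma>, t, e) \<in> K_dom \<and> ?dP (\<sigma>, t, e) < 0"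
    by (auto simp: dist_norm)
  define t1 where "t1 = min (\<delta> / 2) (1/16)"
  have t1: "0 < t1" "t1 < 1/8" "t1 \<le> \<delta> / 2" using \<delta>(1) by (auto simp: t1_def)
  have near: "(\<sigma>, t, e) \<in> K_dom \<and> ?dP (\<sigma>, t, e) < 0" if "\<sigma> \<in> C" "\<bar>t\<bar> \<le> t1" "\<bar>e\<bar> < \<delta> / 2" for \<sigma> t e
    using \<delta>(2)[OF that(1), of t e] norm_Pair_le[of t e] that t1 by simp
  \<comment> \<open>t1 is fixed by now and only e still shrinks; the factor \<open>- sgn r\<close>
    merges the opposite sign conditions at both ends into one positivity claim.\<close>
  have ends: "\<exists>\<delta>'>0. \<forall>\<sigma>\<in>C. \<forall>e. dist e 0 < \<delta>' \<longrightarrow> (\<sigma>, e) \<in> {-1/2<..} \<times> {-eps_max<..<eps_max} \<and> - sgn r * K_slope d (\<sigma>, r, e) > 0"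
    if r: "r = t1 \<or> r = - t1" for r
  proof -
    have c: "continuous_on ({-1/2<..} \<times> {-eps_max<..<eps_max}) (\<lambda>p. - sgn r * K_slope d (fst p, r, snd p))"
      by (intro continuous_intros continuous_on_compose2[OF Cinf_continuous[OF Cinf_K_slope]]) (use r t1 in \<open>auto simp: K_dom_def\<close>)
    have "\<exists>\<delta>'>0. \<forall>\<sigma>\<in>C. \<forall>e. dist e 0 < \<delta>' \<longrightarrow> (\<sigma>, e) \<in> {-1/2<..} \<times> {-eps_max<..<eps_max} \<and> - sgn r * K_slope d (fst (\<sigma>, e), r, snd (\<sigma>, e)) > 0"
    proof (rule tube_positive[OF C _ c])
      fix \<sigma> assume s: "\<sigma> \<in> C"
      have "(\<sigma>, r, 0) \<in> K_dom" using s r t1 eps_max_pos by (auto simp: K_dom_def C_def)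
      moreover have "1 - \<sigma> * r\<^sup>2 / (1 + \<sigma>) > 0" using s r t1 by (intro ball_inner_pos) (auto simp: C_def)
      moreover have "- sgn r * r < 0" using r t1 by (auto simp: sgn_if)
      ultimately have "- sgn r * K_slope d (\<sigma>, r, 0) > 0"
        using ball_const(2)[of d] s
        by (simp add: K_slope_zero_e ball_slope_def C_def mult.assoc[symmetric] zero_less_mult_iff)
      then show "(\<sigma>, 0) \<in> {-1/2<..} \<times> {-eps_max<..<eps_max} \<and> - sgn r * K_slope d (fst (\<sigma>, 0), r, snd (\<sigma>, 0::real)) > 0"
        using s eps_max_pos by (auto simp: C_def)
    qed (auto intro!: open_Times)
    then show ?thesis by simp
  qed
  obtain da where da: "da > 0" "\<And>\<sigma> e. \<sigma> \<in> C \<Longrightarrow> \<bar>e\<bar> < da \<Longrightarrow> K_slope d (\<sigma>, t1, e) < 0"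
    using ends[of t1] t1 by (auto simp: sgn_if)
  obtain db where db: "db > 0" "\<And>\<sigma> e. \<sigma> \<in> C \<Longrightarrow> \<bar>e\<bar> < db \<Longrightarrow> K_slope d (\<sigma>, - t1, e) > 0"
    using ends[of "- t1"] t1 by (auto simp: sgn_if)
  define e1 where "e1 = min (min da db) (min (\<delta> / 2) (eps_max / 2))"
  have e1: "0 < e1" "e1 < eps_max" "e1 \<le> da" "e1 \<le> db" "e1 \<le> \<delta> / 2"
    using da db \<delta>(1) eps_max_pos by (auto simp: e1_def)
  have ex: "\<exists>T. \<bar>T\<bar> < t1 \<and> K_slope d (\<sigma>, T, e) = 0 \<and> (\<forall>t. - t1 < t \<and> t < T \<longrightarrow> K_slope d (\<sigma>, t, e) > 0) \<and>
      (\<forall>t. t < t1 \<and> t > T \<longrightarrow> K_slope d (\<sigma>, t, e) < 0)" if s: "\<sigma> \<in> {-1/4<..<102}" "e \<in> {-e1<..<e1}" for \<sigma> e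
  proof -
    have sC: "\<sigma> \<in> C" using s by (auto simp: C_def)
    have ee: "\<bar>e\<bar> < e1" using s by auto
    have nr: "(\<sigma>, t, e) \<in> K_dom" "?dP (\<sigma>, t, e) < 0" if "\<bar>t\<bar> \<le> t1" for t
      using near[OF sC that] ee e1 by auto
    have dec: "K_slope d (\<sigma>, b, e) < K_slope d (\<sigma>, a, e)" if "- t1 \<le> a" "a < b" "b \<le> t1" for a b
    proof (rule DERIV_neg_imp_decreasing[OF that(2)])
      fix t assume "a \<le> t" "t \<le> b"
      then have "\<bar>t\<bar> \<le> t1" using that by auto
      then show "\<exists>y. ((\<lambda>t. K_slope d (\<sigma>, t, e)) has_real_derivative y) (at t) \<and> y < 0"
        using partial_t_slice[OF Cinf_K_slope nr(1)] nr(2) by blast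
    qed
    have cont: "continuous_on {- t1..t1} (\<lambda>t. K_slope d (\<sigma>, t, e))"
      by (rule continuous_on_compose2[OF Cinf_continuous[OF Cinf_K_slope]]) (use nr in \<open>auto intro!: continuous_intros\<close>)
    obtain T where T: "- t1 \<le> T" "T \<le> t1" "K_slope d (\<sigma>, T, e) = 0"
      using IVT2'[of "\<lambda>t. K_slope d (\<sigma>, t, e)" t1 0 "- t1"] cont da(2)[OF sC, of e] db(2)[OF sC, of e] ee e1 t1 by force
    have "T \<noteq> t1" "T \<noteq> - t1" using T da(2)[OF sC, of e] db(2)[OF sC, of e] ee e1 by auto
    then show ?thesis
      using T dec[of _ T] dec[of T] by (intro exI[of _ T]) auto
  qed
  then obtain T where T: "\<And>\<sigma> e. \<sigma> \<in> {-1/4<..<102} \<Longrightarrow> e \<in> {-e1<..<e1} \<Longrightarrow>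
      \<bar>T (\<sigma>, e)\<bar> < t1 \<and> K_slope d (\<sigma>, T (\<sigma>, e), e) = 0 \<and> (\<forall>t. - t1 < t \<and> t < T (\<sigma>, e) \<longrightarrow> K_slope d (\<sigma>, t, e) > 0) \<and>
      (\<forall>t. t < t1 \<and> t > T (\<sigma>, e) \<longrightarrow> K_slope d (\<sigma>, t, e) < 0)"
    by (metis (no_types, lifting) old.prod.case)
  let ?U = "{-1/4<..<102::real} \<times> {-e1<..<e1}"
  have oU: "open ?U" by (intro open_Times open_greaterThanLessThan)
  have nrU: "(fst p, t, snd p) \<in> K_dom \<and> ?dP (fst p, t, snd p) < 0" if "p \<in> ?U" "\<bar>t\<bar> < t1" for p t
    using near[of "fst p" t "snd p"] that e1 by (auto simp: C_def)
  have oUJ: "open (?U \<times> {- t1<..<t1})" by (intro open_Times oU) auto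
  have CH: "Cinf (?U \<times> {- t1<..<t1}) (\<lambda>z. - K_slope d (fst (fst z), snd z, snd (fst z)))"
  proof (intro Cinf_minus Cinf_compose_triple[OF Cinf_K_slope])
    show "Cinf (?U \<times> {- t1<..<t1}) (\<lambda>z. fst (fst z))" "Cinf (?U \<times> {- t1<..<t1}) (\<lambda>z. snd z)"
      "Cinf (?U \<times> {- t1<..<t1}) (\<lambda>z. snd (fst z))"
      by (intro Cinf_linear oUJ bounded_linear_intros)+
    fix z assume "z \<in> ?U \<times> {- t1<..<t1}"
    then show "(fst (fst z), snd z, snd (fst z)) \<in> K_dom" using nrU[of "fst z" "snd z"] by (auto simp: mem_Times_iff)
  qed
  have "Cinf ?U T"
  proof (rule implicit_Cinf_sign[OF CH oU])
    fix p assume p: "p \<in> ?U"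
    have Tp: "\<bar>T p\<bar> < t1" "K_slope d (fst p, T p, snd p) = 0" "\<And>t. - t1 < t \<Longrightarrow> t < T p \<Longrightarrow> K_slope d (fst p, t, snd p) > 0"
      "\<And>t. t < t1 \<Longrightarrow> t > T p \<Longrightarrow> K_slope d (fst p, t, snd p) < 0"
      using T[of "fst p" "snd p"] p by auto
    show "T p \<in> {- t1<..<t1}" using Tp(1) by auto
    show "- K_slope d (fst (fst (p, s)), snd (p, s), snd (fst (p, s))) < 0" if "- t1 < s" "s < T p" for s using Tp(3) that by simp
    show "- K_slope d (fst (fst (p, s)), snd (p, s), snd (fst (p, s))) > 0" if "T p < s" "s < t1" for s using Tp(4) that by simp
    show "- K_slope d (fst (fst (p, T p)), snd (p, T p), snd (fst (p, T p))) = 0" using Tp(2) by simp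
    have "partial (\<lambda>z. - K_slope d (fst (fst z), snd z, snd (fst z))) (0, 1) (p, T p) = - ?dP (fst p, T p, snd p)"
      by (rule partial_slice_snd[OF CH])
        (use p Tp(1) nrU[OF p Tp(1)] in \<open>auto intro!: DERIV_minus partial_t_slice[OF Cinf_K_slope]\<close>)
    then show "partial (\<lambda>z. - K_slope d (fst (fst z), snd z, snd (fst z))) (0, 1) (p, T p) \<noteq> 0"
      using nrU[OF p Tp(1)] by simp
  qed
  then show ?thesis using t1 e1 T by (intro exI[of _ t1] exI[of _ e1] exI[of _ T]) auto
qed

text \<open>E is the volume of K at the critical height minus the central volume of the ball,
  continued by 0. The pieces fit smoothly because on 100 < \<sigma> < 102 the correction vanishes
  and the critical height is 0. Maximality is so far local, among |t| < t1, but strict for \<sigma>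
  > 0, and quasi-concavity will make it global.\<close>

lemma exists_section_excess:
  obtains t1 e1 E where "0 < t1" "t1 < 1/8" "0 < e1" "e1 < eps_max" "Cinf ({-1/4<..} \<times> {-e1<..<e1}) E"
    "\<And>\<sigma> e. \<sigma> > 100 \<Longrightarrow> \<bar>e\<bar> < e1 \<Longrightarrow> E (\<sigma>, e) = 0" "\<And>\<sigma>. \<sigma> > -1/4 \<Longrightarrow> E (\<sigma>, 0) = 0"
    "\<And>\<sigma> e. 0 \<le> \<sigma> \<Longrightarrow> \<sigma> \<le> 100 \<Longrightarrow> \<bar>e\<bar> < e1 \<Longrightarrow> \<exists>T. \<bar>T\<bar> < t1 \<and> K_vol d (\<sigma>, T, e) = ball_vol d \<sigma> 0 + E (\<sigma>, e) \<and>
      (\<forall>t. 0 < \<sigma> \<and> \<bar>t\<bar> < t1 \<and> t \<noteq> T \<longrightarrow> K_vol d (\<sigma>, t, e) < K_vol d (\<sigma>, T, e))"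
proof -
  obtain t1 e1 T where t1: "0 < t1" "t1 < 1/8" and e1: "0 < e1" "e1 < eps_max"
    and CT: "Cinf ({-1/4<..<102::real} \<times> {-e1<..<e1}) T"
    and T: "\<And>\<sigma> e. \<sigma> \<in> {-1/4<..<102} \<Longrightarrow> e \<in> {-e1<..<e1} \<Longrightarrow> \<bar>T (\<sigma>, e)\<bar> < t1 \<and>
      (\<forall>t. - t1 < t \<and> t < T (\<sigma>, e) \<longrightarrow> K_slope d (\<sigma>, t, e) > 0) \<and>
      (\<forall>t. t < t1 \<and> t > T (\<sigma>, e) \<longrightarrow> K_slope d (\<sigma>, t, e) < 0)"
    using exists_critical_height[of d] by blast
  let ?U = "{-1/4<..<102::real} \<times> {-e1<..<e1}"
  have oU: "open ?U" by (intro open_Times open_greaterThanLessThan)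
  have K_dom: "(\<sigma>, t, e) \<in> K_dom" if "\<sigma> > -1/4" "\<bar>t\<bar> < t1" "\<bar>e\<bar> < e1" for \<sigma> t e
    using that t1 e1 by (auto simp: K_dom_def)
  have T0: "T (\<sigma>, e) = 0" if s: "\<sigma> \<in> {-1/4<..<102}" "e \<in> {-e1<..<e1}" and P: "K_slope d (\<sigma>, 0, e) = 0" for \<sigma> e
    using T[OF s] P t1 by (metis (no_types, opaque_lifting) less_irrefl linorder_neqE_linordered_idom neg_less_0_iff_less)
  have Psib0: "ball_slope d \<sigma> 0 = 0" for \<sigma> by (simp add: ball_slope_def)
  define F where "F p = K_vol d (fst p, T p, snd p) - ball_vol d (fst p) 0" for p
  define E where "E p = (if fst p < 102 then F p else 0)" for p
  have CF: "Cinf ?U F"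
    unfolding F_def
  proof (intro Cinf_diff Cinf_compose_triple[OF Cinf_K_vol] CT)
    show f: "Cinf ?U fst" and "Cinf ?U snd" by (intro Cinf_linear oU bounded_linear_intros)+
    show "(fst p, T p, snd p) \<in> K_dom" if "p \<in> ?U" for p
      using K_dom[of "fst p" "T p" "snd p"] T[of "fst p" "snd p"] that by (auto simp: abs_less_iff)
    have "Cinf ?U (\<lambda>p. ball_const d * (1 + fst p) powr (-1/2))"
      by (intro Cinf_mult Cinf_const oU Cinf_powr_compose Cinf_add f) auto
    then show "Cinf ?U (\<lambda>p. ball_vol d (fst p) 0)"
      by (rule Cinf_cong) (simp add: ball_vol_def)
  qed
  have F100: "F (\<sigma>, e) = 0" if s: "100 < \<sigma>" "\<sigma> < 102" "\<bar>e\<bar> < e1" for \<sigma> e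
  proof -
    have u: "(\<sigma>, 0, e) \<in> K_dom" using K_dom[of \<sigma> 0 e] s t1 by auto
    have "K_slope d (\<sigma>, 0, e) = 0" using K_corr_slope_vanish[OF u s(1)] by (simp add: K_slope_def Psib0)
    then have "T (\<sigma>, e) = 0" using s by (intro T0) auto
    then show ?thesis using K_corr_vanish[OF u s(1)] by (simp add: F_def K_vol_def)
  qed
  have CE: "Cinf ({-1/4<..} \<times> {-e1<..<e1}) E"
  proof -
    have 1: "Cinf ?U E" by (rule Cinf_cong[OF CF]) (auto simp: E_def)
    have 2: "Cinf ({100<..} \<times> {-e1<..<e1}) E"
      by (rule Cinf_cong[OF Cinf_const[of _ 0]]) (auto simp: E_def F100 intro!: open_Times)
    have "?U \<union> {100<..} \<times> {-e1<..<e1} = {-1/4<..} \<times> {-e1<..<e1}" by auto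
    then show ?thesis using Cinf_Un[OF 1 2] by simp
  qed
  have E100: "E (\<sigma>, e) = 0" if "\<sigma> > 100" "\<bar>e\<bar> < e1" for \<sigma> e using F100 that by (auto simp: E_def)
  have E0: "E (\<sigma>, 0) = 0" if "\<sigma> > -1/4" for \<sigma>
  proof (cases "\<sigma> < 102")
    case True
    have u: "(\<sigma>, 0, 0) \<in> K_dom" using K_dom[of \<sigma> 0 0] that t1 e1 by auto
    have "T (\<sigma>, 0) = 0" using that True e1 by (intro T0) (auto simp: K_slope_zero_e[OF u] Psib0)
    then show ?thesis using True by (simp add: E_def F_def K_vol_def K_corr_zero)
  qed (simp add: E_def)
  have ET: "\<exists>T. \<bar>T\<bar> < t1 \<and> K_vol d (\<sigma>, T, e) = ball_vol d \<sigma> 0 + E (\<sigma>, e) \<and>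
      (\<forall>t. 0 < \<sigma> \<and> \<bar>t\<bar> < t1 \<and> t \<noteq> T \<longrightarrow> K_vol d (\<sigma>, t, e) < K_vol d (\<sigma>, T, e))"
    if s: "0 \<le> \<sigma>" "\<sigma> \<le> 100" "\<bar>e\<bar> < e1" for \<sigma> e
  proof (intro exI[of _ "T (\<sigma>, e)"] conjI allI impI)
    have se: "\<sigma> \<in> {-1/4<..<102}" "e \<in> {-e1<..<e1}" using s by auto
    note Tse = T[OF se]
    show "\<bar>T (\<sigma>, e)\<bar> < t1" using Tse by blast
    show "K_vol d (\<sigma>, T (\<sigma>, e), e) = ball_vol d \<sigma> 0 + E (\<sigma>, e)" using s by (simp add: E_def F_def)
    fix t assume t: "0 < \<sigma> \<and> \<bar>t\<bar> < t1 \<and> t \<noteq> T (\<sigma>, e)"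
    have der: "((\<lambda>t. K_vol d (\<sigma>, t, e)) has_real_derivative \<sigma> * K_slope d (\<sigma>, x, e)) (at x)" if "\<bar>x\<bar> < t1" for x
      by (rule K_vol_deriv) (use K_dom[of \<sigma> x e] that s in auto)
    show "K_vol d (\<sigma>, t, e) < K_vol d (\<sigma>, T (\<sigma>, e), e)"
    proof (cases "t < T (\<sigma>, e)")
      case True
      obtain x where x: "t < x" "x < T (\<sigma>, e)"
        "K_vol d (\<sigma>, T (\<sigma>, e), e) - K_vol d (\<sigma>, t, e) = (T (\<sigma>, e) - t) * (\<sigma> * K_slope d (\<sigma>, x, e))"
        using MVT2[OF True der] t Tse by force
      have "K_slope d (\<sigma>, x, e) > 0" using Tse x t by auto
      then have "(T (\<sigma>, e) - t) * (\<sigma> * K_slope d (\<sigma>, x, e)) > 0" using True t by simp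
      then show ?thesis using x by simp
    next
      case False
      then have l: "T (\<sigma>, e) < t" using t by auto
      obtain x where x: "T (\<sigma>, e) < x" "x < t"
        "K_vol d (\<sigma>, t, e) - K_vol d (\<sigma>, T (\<sigma>, e), e) = (t - T (\<sigma>, e)) * (\<sigma> * K_slope d (\<sigma>, x, e))"
        using MVT2[OF l der] t Tse by force
      have "K_slope d (\<sigma>, x, e) < 0" using Tse x t by auto
      then have "(t - T (\<sigma>, e)) * (\<sigma> * K_slope d (\<sigma>, x, e)) < 0" using l t by (simp add: mult_pos_neg)
      then show ?thesis using x by simp
    qed
  qed
  show thesis by (rule that[OF t1 e1 CE E100 E0 ET])
qed

lemma neg_deriv_pow_zero:
  assumes "Cinf ({l<..} \<times> P) g" "p \<in> P" "\<And>\<sigma>. \<sigma> > l \<Longrightarrow> g (\<sigma>, p) = 0" "\<sigma> > l"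
  shows "(neg_deriv ^^ k) g (\<sigma>, p) = 0"
  using assms(4)
proof (induction k arbitrary: \<sigma>)
  case (Suc k)
  have d: "((\<lambda>s. (neg_deriv ^^ k) g (s, p)) has_real_derivative - neg_deriv ((neg_deriv ^^ k) g) (\<sigma>, p)) (at \<sigma>)"
    by (rule has_real_derivative_slice[OF Cinf_neg_deriv_pow[OF assms(1)] assms(2) Suc.prems])
  have "((\<lambda>s. 0) has_real_derivative 0) (at \<sigma>)" by simp
  then have "((\<lambda>s. (neg_deriv ^^ k) g (s, p)) has_real_derivative 0) (at \<sigma>)"
    by (rule has_field_derivative_transform_within_open[of _ _ _ "{l<..}"]) (use Suc in auto)
  from DERIV_unique[OF this d] show ?case by simp
qed (use assms in auto)

text \<open>The power d + 1 of (1 + \<tau>)^(-1/2), the axial coordinate at which a ray with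
  parameter \<tau> leaves the unit ball.\<close>

definition ball_radius_pow :: "nat \<Rightarrow> real \<Rightarrow> real" where
  "ball_radius_pow d \<tau> = (1 + \<tau>) powr (- (real d + 1) / 2)"

lemma half_vol_ball:
  assumes "\<sigma> \<ge> 0"
  shows "(nn_abel ^^ d) (\<lambda>\<tau>. ennreal ((if \<tau> > -1/8 then ball_radius_pow d \<tau> else 0) / Suc d)) \<sigma> = ennreal (ball_vol d \<sigma> 0 / 2)"
proof -
  define Y where "Y \<tau> = (if \<tau> > -1/8 then (1 + \<tau>) powr (-1/2) else 0)" for \<tau> :: real
  have [measurable]: "Y \<in> borel_measurable borel" unfolding Y_def by measurable
  have [measurable]: "Measurable.pred (borel \<Otimes>\<^sub>M borel) (\<lambda>(z, a). ballP z a)" unfolding ballP_def by measurable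
  have "half_vol d ballP \<sigma> = (nn_abel ^^ d) (\<lambda>\<tau>. ennreal (Y \<tau> ^ Suc d / Suc d)) \<sigma>"
    unfolding half_vol_def
  proof (rule polar_half)
    show "Y \<tau> \<ge> 0" for \<tau> by (simp add: Y_def)
    fix z \<tau> :: real assume z: "z > 0" "\<tau> \<ge> \<sigma>"
    have "ballP z (\<tau> * z\<^sup>2) \<longleftrightarrow> (1 + \<tau>) * z\<^sup>2 \<le> 1" by (simp add: ballP_def algebra_simps)
    also have "\<dots> \<longleftrightarrow> z\<^sup>2 \<le> (Y \<tau>)\<^sup>2"
    proof -
      have "(Y \<tau>)\<^sup>2 = 1 / (1 + \<tau>)"
        using z assms by (simp add: Y_def power2_eq_square powr_add[symmetric] powr_minus_divide)
      moreover have "z\<^sup>2 \<le> 1 / (1 + \<tau>) \<longleftrightarrow> z\<^sup>2 * (1 + \<tau>) \<le> 1"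
        using z assms by (intro pos_le_divide_eq) auto
      ultimately show ?thesis by (simp add: mult.commute)
    qed
    also have "\<dots> \<longleftrightarrow> z \<le> Y \<tau>" using z by (simp add: Y_def power2_le_iff_abs_le)
    finally show "ballP z (\<tau> * z\<^sup>2) \<longleftrightarrow> z \<le> Y \<tau>" .
  next
    fix z show "Measurable.pred borel (ballP z)" unfolding ballP_def by measurable
  qed measurable
  moreover have "Y \<tau> ^ Suc d / Suc d = (if \<tau> > -1/8 then ball_radius_pow d \<tau> else 0) / Suc d" for \<tau>
  proof (cases "\<tau> > -1/8")
    case True
    have "((1 + \<tau>) powr (-1/2)) ^ Suc d = (1 + \<tau>) powr (real (Suc d) * (-1/2))"
      by (rule powr_power) (use True in simp)
    also have "real (Suc d) * (-1/2) = - (real d + 1) / 2" by (simp add: field_simps)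
    finally have "Y \<tau> ^ Suc d = ball_radius_pow d \<tau>" using True by (simp add: Y_def ball_radius_pow_def)
    then show ?thesis using True by simp
  qed (simp add: Y_def)
  ultimately have 1: "(nn_abel ^^ d) (\<lambda>\<tau>. ennreal ((if \<tau> > -1/8 then ball_radius_pow d \<tau> else 0) / Suc d)) \<sigma> = half_vol d ballP \<sigma>" by simp
  have "sec_vol_at d ballP \<sigma> 0 = half_vol d (\<lambda>z. ballP (0 + z)) \<sigma> + half_vol d (\<lambda>z. ballP (0 - z)) \<sigma>"
    by (rule sec_vol_at_halves) measurable
  also have "(\<lambda>z. ballP (0 - z)) = ballP" by (simp add: ballP_def fun_eq_iff)
  also have "half_vol d (\<lambda>z. ballP (0 + z)) \<sigma> + half_vol d ballP \<sigma> = 2 * half_vol d ballP \<sigma>" by (simp add: mult_2)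
  finally have 2: "ennreal (ball_vol d \<sigma> 0) = 2 * half_vol d ballP \<sigma>" using sec_vol_at_ball[of \<sigma> 0 d] assms by simp
  then have "half_vol d ballP \<sigma> \<noteq> top" by (metis ennreal_neq_top ennreal_mult_top zero_neq_numeral)
  then obtain u where u: "half_vol d ballP \<sigma> = ennreal u" "u \<ge> 0" by (metis ennreal_cases)
  have "ball_vol d \<sigma> 0 \<ge> 0" using ball_const(2)[of d] by (simp add: ball_vol_def)
  moreover have "ennreal (ball_vol d \<sigma> 0) = ennreal (2 * u)" using 2 u by (simp add: ennreal_mult')
  ultimately have "u = ball_vol d \<sigma> 0 / 2" using u by simp
  then show ?thesis using 1 u by simp
qed

text \<open>The squared gauge function of L will be \<open>\<bar>x\<bar>\<^sup>2 + z\<^sup>2 r (\<tau>, \<epsilon>)\<close>, where z is the axial coordinate of x and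
  \<open>\<tau> = (\<bar>x\<bar>\<^sup>2 - z\<^sup>2) / z\<^sup>2\<close>.\<close>

lemma exists_L_radial_data:
  fixes E :: "real \<times> real \<Rightarrow> real"
  assumes e1: "0 < e1" and CE: "Cinf ({-1/4<..} \<times> {-e1<..<e1}) E"
    and E100: "\<And>\<sigma> e. \<sigma> > 100 \<Longrightarrow> \<bar>e\<bar> < e1 \<Longrightarrow> E (\<sigma>, e) = 0" and E0: "\<And>\<sigma>. \<sigma> > -1/4 \<Longrightarrow> E (\<sigma>, 0) = 0"
  obtains e2 r where "0 < e2" "e2 < e1" "Cinf ({-1/8<..} \<times> {-e2<..<e2}) r"
    "\<And>\<tau> e. \<tau> > 100 \<Longrightarrow> \<bar>e\<bar> < e2 \<Longrightarrow> r (\<tau>, e) = 0" "\<And>\<tau>. \<tau> > -1/8 \<Longrightarrow> r (\<tau>, 0) = 0"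
    "\<And>\<tau> e. \<tau> > -1/8 \<Longrightarrow> \<bar>e\<bar> < e2 \<Longrightarrow> 1 + \<tau> + r (\<tau>, e) > 0"
    "\<And>\<sigma> e. \<sigma> \<ge> 0 \<Longrightarrow> \<bar>e\<bar> < e2 \<Longrightarrow>
      (nn_abel ^^ d) (\<lambda>\<tau>. ennreal ((if \<tau> > -1/8 then (1 + \<tau> + r (\<tau>, e)) powr (-1/2) else 0) ^ Suc d / Suc d)) \<sigma>
        = ennreal ((ball_vol d \<sigma> 0 + E (\<sigma>, e)) / 2) \<and> ball_vol d \<sigma> 0 + E (\<sigma>, e) \<ge> 0"
proof -
  let ?I = "{-e1<..<e1}"
  \<comment> \<open>pi^d cancels the factor of the inversion, d + 1 the divisor from radial
    integration, and 2 accounts for the two congruent halves of a central section of L.\<close>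
  define c where "c = (real d + 1) / (2 * pi ^ d)"
  define D where "D p = c * (abel_par ^^ d) ((neg_deriv ^^ d) E) p" for p
  have E100': "E (\<sigma>, e) = 0" if "\<sigma> > 100" "e \<in> ?I" for \<sigma> e 
  proof -
    have "\<bar>e\<bar> < e1" using that by auto
    then show ?thesis using E100 that by blast
  qed
  have dE: "Cinf ({-1/4<..} \<times> ?I) ((neg_deriv ^^ d) E)" by (rule Cinf_neg_deriv_pow[OF CE])
  have CD: "Cinf ({-1/4<..} \<times> ?I) D"
    unfolding D_def[abs_def] by (intro Cinf_mult Cinf_const Cinf_abel_par_pow dE) (auto intro: open_Times)
  have D100: "D (\<tau>, e) = 0" if "\<tau> > 100" "e \<in> ?I" for \<tau> e
  proof -
    have "(abel ^^ d) (\<lambda>t. (neg_deriv ^^ d) E (t, e)) \<tau> = 0"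
      by (rule abel_pow_zero, rule neg_deriv_pow_vanish[of ?I]) (use that E100' in auto)
    then show ?thesis by (simp add: D_def abel_par_pow)
  qed
  have D0: "D (\<tau>, 0) = 0" if "\<tau> > -1/4" for \<tau>
  proof -
    have "(abel ^^ d) (\<lambda>t. (neg_deriv ^^ d) E (t, 0)) \<tau> = 0"
      by (rule abel_pow_zero, rule neg_deriv_pow_zero[OF CE]) (use that E0 e1 in auto)
    then show ?thesis by (simp add: D_def abel_par_pow)
  qed
  have JD: "(abel ^^ d) (\<lambda>\<tau>. D (\<tau>, e) / Suc d) \<sigma> = E (\<sigma>, e) / 2" if "\<sigma> > -1/4" "e \<in> ?I" for \<sigma> e
  proof -
    define m where "m = real (Suc d)"
    have m: "m \<noteq> 0" "real d + 1 = m" by (simp_all add: m_def)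
    have c': "c / m = 1 / (2 * pi ^ d)" unfolding c_def m(2) using m(1) by simp
    have "(abel ^^ d) (\<lambda>\<tau>. D (\<tau>, e) / m) \<sigma> = (abel ^^ d) (\<lambda>\<tau>. (c / m) * (abel_par ^^ d) ((neg_deriv ^^ d) E) (\<tau>, e)) \<sigma>"
      by (simp add: D_def)
    also have "\<dots> = (c / m) * (abel_par ^^ d) ((abel_par ^^ d) ((neg_deriv ^^ d) E)) (\<sigma>, e)"
      unfolding abel_pow_cmult abel_par_pow[of d "(abel_par ^^ d) _"] ..
    also have "\<dots> = (c / m) * (pi ^ d * E (\<sigma>, e))"
      by (subst abel_par_inverse[OF CE E100']) (use that in auto)
    also have "\<dots> = E (\<sigma>, e) / 2" unfolding c' by simp
    finally show ?thesis unfolding m_def .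
  qed
  \<comment> \<open>The intended power d + 1 of the axial coordinate at which a ray leaves
    L.\<close>
  define YL where "YL p = ball_radius_pow d (fst p) + D p" for p
  have CYb: "Cinf U (\<lambda>p. ball_radius_pow d (fst p))" if "open U" "U \<subseteq> {-1/4<..} \<times> ?I" for U :: "(real \<times> real) set"
    unfolding ball_radius_pow_def using that
    by (intro Cinf_powr_compose Cinf_add Cinf_const Cinf_linear bounded_linear_intros) auto
  have oI: "open ({-1/4<..} \<times> ?I :: (real \<times> real) set)" by (intro open_Times) auto
  have CYL: "Cinf ({-1/4<..} \<times> ?I) YL"
    unfolding YL_def[abs_def] by (intro Cinf_add CD CYb oI) auto
  have YL100: "YL (\<tau>, e) = ball_radius_pow d \<tau>" if "\<tau> > 100" "e \<in> ?I" for \<tau> e using D100[OF that] by (simp add: YL_def)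
  have Ybpos: "ball_radius_pow d \<tau> > 0" if "\<tau> > -1/4" for \<tau> using that by (simp add: ball_radius_pow_def)
  \<comment> \<open>Compactness is called for only up to 100; beyond, \<open>YL\<close> is the
    positive power belonging to the ball.\<close>
  have "\<exists>\<delta>>0. \<forall>\<tau>\<in>{-1/8..100}. \<forall>e. dist e 0 < \<delta> \<longrightarrow> (\<tau>, e) \<in> {-1/4<..} \<times> ?I \<and> YL (\<tau>, e) > 0"
    by (rule tube_positive[OF compact_Icc oI Cinf_continuous[OF CYL]])
      (use D0 Ybpos e1 in \<open>auto simp: YL_def\<close>)
  then obtain \<delta> where \<delta>: "\<delta> > 0" "\<And>\<tau> e. \<tau> \<in> {-1/8..100} \<Longrightarrow> \<bar>e\<bar> < \<delta> \<Longrightarrow> YL (\<tau>, e) > 0" by auto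
  define e2 where "e2 = min (\<delta> / 2) (e1 / 2)"
  have e2: "0 < e2" "e2 < e1" "e2 < \<delta>" using \<delta>(1) e1 by (auto simp: e2_def)
  have inI: "e \<in> ?I" if "\<bar>e\<bar> < e2" for e
    unfolding greaterThanLessThan_iff using that e2 by linarith
  have YLpos: "YL (\<tau>, e) > 0" if "\<tau> > -1/8" "\<bar>e\<bar> < e2" for \<tau> e
    using \<delta>(2)[of \<tau> e] YL100[of \<tau> e, OF _ inI] Ybpos[of \<tau>] that e2 by (cases "\<tau> \<le> 100") auto
  \<comment> \<open>Solves Y^(-2) = 1 + \<tau> + r for Y^(d+1) = \<open>YL\<close>; for the ball
    this gives r = 0.\<close>
  define r where "r p = YL p powr (- 2 / (real d + 1)) - (1 + fst p)" for p
  let ?W = "{-1/8<..} \<times> {-e2<..<e2} :: (real \<times> real) set"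
  have oW: "open ?W" by (intro open_Times) auto
  have sub: "?W \<subseteq> {-1/4<..} \<times> ?I" using e2 by auto
  have Cr: "Cinf ?W r"
    unfolding r_def[abs_def]
    by (intro Cinf_diff Cinf_add Cinf_powr_compose Cinf_subset[OF CYL oW sub] Cinf_const Cinf_linear oW bounded_linear_intros)
      (use YLpos in auto)
  have em: "(- (real d + 1) / 2) * (- 2 / (real d + 1)) = 1" "(- 2 / (real d + 1)) * (- (real d + 1) / 2) = 1"
  proof -
    define m where "m = real d + 1"
    have "m \<noteq> 0" by (simp add: m_def)
    then show "(- (real d + 1) / 2) * (- 2 / (real d + 1)) = 1" "(- 2 / (real d + 1)) * (- (real d + 1) / 2) = 1"
      unfolding m_def[symmetric] by simp_all
  qed
  have Ybr: "ball_radius_pow d \<tau> powr (- 2 / (real d + 1)) = 1 + \<tau>" if "\<tau> > -1/4" for \<tau>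
    using that unfolding ball_radius_pow_def powr_powr em by simp
  have r100: "r (\<tau>, e) = 0" if "\<tau> > 100" "\<bar>e\<bar> < e2" for \<tau> e
    using YL100[of \<tau> e, OF _ inI] Ybr[of \<tau>] that by (auto simp: r_def)
  have r0: "r (\<tau>, 0) = 0" if "\<tau> > -1/8" for \<tau>
    using D0[of \<tau>] Ybr[of \<tau>] that by (auto simp: r_def YL_def)
  have rq: "1 + \<tau> + r (\<tau>, e) = YL (\<tau>, e) powr (- 2 / (real d + 1))" for \<tau> e by (simp add: r_def)
  have rpos: "1 + \<tau> + r (\<tau>, e) > 0" if "\<tau> > -1/8" "\<bar>e\<bar> < e2" for \<tau> e
    unfolding rq using YLpos[OF that] by simp
  have main: "(nn_abel ^^ d) (\<lambda>\<tau>. ennreal ((if \<tau> > -1/8 then (1 + \<tau> + r (\<tau>, e)) powr (-1/2) else 0) ^ Suc d / Suc d)) \<sigma>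
        = ennreal ((ball_vol d \<sigma> 0 + E (\<sigma>, e)) / 2) \<and> ball_vol d \<sigma> 0 + E (\<sigma>, e) \<ge> 0"
    if s: "\<sigma> \<ge> 0" "\<bar>e\<bar> < e2" for \<sigma> e
  proof -
    have ei: "e \<in> ?I" using inI s by blast
    have pw: "(if \<tau> > -1/8 then (1 + \<tau> + r (\<tau>, e)) powr (-1/2) else 0) ^ Suc d = (if \<tau> > -1/8 then YL (\<tau>, e) else 0)" for \<tau>
    proof (cases "\<tau> > -1/8")
      case True
      have "((1 + \<tau> + r (\<tau>, e)) powr (-1/2)) ^ Suc d = (1 + \<tau> + r (\<tau>, e)) powr (real (Suc d) * (-1/2))"
        by (rule powr_power) (use rpos[OF True s(2)] in simp)
      also have "\<dots> = (1 + \<tau> + r (\<tau>, e)) powr (- (real d + 1) / 2)"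
        by (rule arg_cong[where f="(powr) _"]) (simp add: field_simps)
      also have "\<dots> = YL (\<tau>, e) powr 1" unfolding rq powr_powr em ..
      also have "\<dots> = YL (\<tau>, e)" using YLpos[OF True s(2)] by simp
      finally show ?thesis using True by simp
    qed simp
    have mY: "(\<lambda>\<tau>. (if \<tau> > -1/8 then YL (\<tau>, e) else 0)) \<in> borel_measurable borel"
    proof -
      have "continuous_on {-1/8<..} (\<lambda>\<tau>. YL (\<tau>, e))"
        by (rule continuous_on_compose2[OF Cinf_continuous[OF CYL]]) (use ei in \<open>auto intro!: continuous_intros\<close>)
      from borel_measurable_continuous_on_indicator[OF _ this]
      have "(\<lambda>\<tau>. indicator {-1/8<..} \<tau> *\<^sub>R YL (\<tau>, e)) \<in> borel_measurable borel" by simp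
      moreover have "(\<lambda>\<tau>. indicator {-1/8<..} \<tau> *\<^sub>R YL (\<tau>, e)) = (\<lambda>\<tau>. (if \<tau> > -1/8 then YL (\<tau>, e) else 0))"
        by (auto simp: fun_eq_iff)
      ultimately show ?thesis by simp
    qed
    have "(nn_abel ^^ d) (\<lambda>\<tau>. ennreal ((if \<tau> > -1/8 then YL (\<tau>, e) else 0) / Suc d)) \<sigma>
      = ennreal (ball_vol d \<sigma> 0 / 2 + (abel ^^ d) (\<lambda>\<tau>. D (\<tau>, e) / Suc d) \<sigma>) \<and> ball_vol d \<sigma> 0 / 2 + (abel ^^ d) (\<lambda>\<tau>. D (\<tau>, e) / Suc d) \<sigma> \<ge> 0"
    proof (rule nn_abel_pow_difference[where ball_radius_pow="\<lambda>\<tau>. (if \<tau> > -1/8 then ball_radius_pow d \<tau> else 0) / Suc d" and l="-1/4"])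
      show "(\<lambda>\<tau>. (if \<tau> > -1/8 then YL (\<tau>, e) else 0) / Suc d) \<in> borel_measurable borel"
        using mY by measurable
      show "(\<lambda>\<tau>. (if \<tau> > -1/8 then ball_radius_pow d \<tau> else 0) / real (Suc d)) \<in> borel_measurable borel"
        unfolding ball_radius_pow_def by measurable
      show "(if \<tau> > -1/8 then YL (\<tau>, e) else 0) / Suc d \<ge> 0" for \<tau> using YLpos[of \<tau> e] s by (auto simp: less_imp_le)
      show "(if \<tau> > -1/8 then ball_radius_pow d \<tau> else 0) / Suc d \<ge> 0" for \<tau> using Ybpos[of \<tau>] by (auto simp: less_imp_le)
      show "admissible (-1/4) (\<lambda>\<tau>. D (\<tau>, e) / Suc d)"
      proof -
        have "admissible (-1/4) (\<lambda>\<tau>. D (\<tau>, e))" by (rule admissible_slice[OF CD]) (use D100 ei in auto)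
        then show ?thesis by (auto simp: admissible_def intro!: continuous_intros)
      qed
      show "(if \<tau> > -1/8 then YL (\<tau>, e) else 0) / Suc d = (if \<tau> > -1/8 then ball_radius_pow d \<tau> else 0) / Suc d + D (\<tau>, e) / Suc d"
        if "\<tau> \<ge> \<sigma>" for \<tau> using that s by (simp add: YL_def add_divide_distrib)
      show "(nn_abel ^^ d) (\<lambda>\<tau>. ennreal ((if \<tau> > -1/8 then ball_radius_pow d \<tau> else 0) / Suc d)) \<sigma> = ennreal (ball_vol d \<sigma> 0 / 2)"
        by (rule half_vol_ball[OF s(1)])
      show "ball_vol d \<sigma> 0 / 2 \<ge> 0" using ball_const(2)[of d] by (simp add: ball_vol_def)
    qed (use s in auto)
    then show ?thesis
      unfolding pw using JD[of \<sigma> e] s ei by (simp add: add_divide_distrib)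
  qed
  show thesis by (rule that[OF e2(1,2) Cr r100 r0 rpos main])
qed

section \<open>Homogeneous perturbations of the squared norm\<close>

definition dir_deriv :: "('a::euclidean_space \<times> real \<Rightarrow> real) \<Rightarrow> 'a \<Rightarrow> 'a \<times> real \<Rightarrow> real" where
  "dir_deriv f v p = (\<Sum>c\<in>Basis. (v \<bullet> c) * partial f (c, 0) p)"

lemma dir_deriv_deriv:
  fixes f :: "'a::euclidean_space \<times> real \<Rightarrow> real"
  assumes "Cinf W f" "(x + s *\<^sub>R v, e) \<in> W"
  shows "((\<lambda>s. f (x + s *\<^sub>R v, e)) has_real_derivative dir_deriv f v (x + s *\<^sub>R v, e)) (at s)"
proof -
  let ?p = "(x + s *\<^sub>R v, e)"
  have D: "(f has_derivative frechet_derivative f (at ?p)) (at ?p)" by (rule Cinf_has_derivative[OF assms])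
  have g: "((\<lambda>s. (x + s *\<^sub>R v, e)) has_derivative (\<lambda>h. (h *\<^sub>R v, 0))) (at s)"
    by (intro has_derivative_Pair has_derivative_const) (auto intro!: derivative_eq_intros)
  have 1: "((\<lambda>s. f (x + s *\<^sub>R v, e)) has_derivative (\<lambda>h. frechet_derivative f (at ?p) (h *\<^sub>R v, 0))) (at s)"
    using has_derivative_compose[OF g D] .
  have "frechet_derivative f (at ?p) (h *\<^sub>R v, 0) = dir_deriv f v ?p * h" for h
  proof -
    have "(h *\<^sub>R v, 0 :: real) = h *\<^sub>R (\<Sum>c\<in>Basis. (v \<bullet> c) *\<^sub>R (c, 0))"
    proof -
      have "fst (\<Sum>c\<in>Basis. (v \<bullet> c) *\<^sub>R (c, 0 :: real)) = v"
        by (simp add: fst_sum euclidean_representation)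
      moreover have "snd (\<Sum>c\<in>Basis. (v \<bullet> c) *\<^sub>R (c, 0 :: real)) = 0" by (simp add: snd_sum)
      ultimately show ?thesis by (metis prod.collapse scaleR_Pair scaleR_zero_right)
    qed
    then have "frechet_derivative f (at ?p) (h *\<^sub>R v, 0) = h * (\<Sum>c\<in>Basis. (v \<bullet> c) * frechet_derivative f (at ?p) (c, 0))"
      using has_derivative_linear[OF D] by (simp only: linear_scale linear_sum) (simp add: linear_scale)
    then show ?thesis by (simp add: dir_deriv_def mult.commute)
  qed
  then have 2: "(\<lambda>h. frechet_derivative f (at ?p) (h *\<^sub>R v, 0)) = (*) (dir_deriv f v ?p)" by (rule ext)
  show ?thesis unfolding has_field_derivative_def 2[symmetric] by (rule 1)
qed

lemma dir_deriv_Basis: "b \<in> Basis \<Longrightarrow> dir_deriv f b p = partial f (b, 0) p"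
  unfolding dir_deriv_def by (simp add: inner_Basis if_distrib[of "\<lambda>x. x * _"] cong: if_cong)

text \<open>Differentiating the homogeneity relation lowers the degree by one. Used twice on degree
  2, it makes second derivatives constant along rays, so that the unit sphere controls them
  everywhere.\<close>

lemma partial_homogeneous:
  fixes f :: "'a::euclidean_space \<times> real \<Rightarrow> real"
  assumes f: "Cinf ((-{0}) \<times> I) f" and hom: "\<And>x e. x \<noteq> 0 \<Longrightarrow> e \<in> I \<Longrightarrow> f (l *\<^sub>R x, e) = l ^ Suc m * f (x, e)"
    and l: "l > 0" and x: "x \<noteq> 0" "e \<in> I" and b: "b \<in> Basis"
  shows "partial f (b, 0) (l *\<^sub>R x, e) = l ^ m * partial f (b, 0) (x, e)"
proof -
  have 1: "((\<lambda>s. f (l *\<^sub>R x + s *\<^sub>R b, e)) has_real_derivative partial f (b, 0) (l *\<^sub>R x, e)) (at (l * 0))"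
    using dir_deriv_deriv[OF f, of "l *\<^sub>R x" 0 b e] x l by (simp add: dir_deriv_Basis[OF b])
  have "((\<lambda>s. l * s) has_real_derivative l) (at 0)" by (auto intro!: derivative_eq_intros)
  from DERIV_chain2[OF 1 this]
  have A: "((\<lambda>s. f (l *\<^sub>R x + (l * s) *\<^sub>R b, e)) has_real_derivative partial f (b, 0) (l *\<^sub>R x, e) * l) (at 0)" .
  have "((\<lambda>s. f (x + s *\<^sub>R b, e)) has_real_derivative partial f (b, 0) (x, e)) (at 0)"
    using dir_deriv_deriv[OF f, of x 0 b e] x by (simp add: dir_deriv_Basis[OF b])
  then have B: "((\<lambda>s. l ^ Suc m * f (x + s *\<^sub>R b, e)) has_real_derivative l ^ Suc m * partial f (b, 0) (x, e)) (at 0)"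
    by (rule DERIV_cmult)
  have "open ((\<lambda>s::real. x + s *\<^sub>R b) -` (-{0}))" by (intro open_vimage continuous_intros)
  then have C: "((\<lambda>s. f (l *\<^sub>R x + (l * s) *\<^sub>R b, e)) has_real_derivative l ^ Suc m * partial f (b, 0) (x, e)) (at 0)"
  proof (rule has_field_derivative_transform_within_open[OF B])
    fix s assume "s \<in> (\<lambda>s::real. x + s *\<^sub>R b) -` (-{0})"
    then have "x + s *\<^sub>R b \<noteq> 0" by simp
    from hom[OF this x(2)]
    show "l ^ Suc m * f (x + s *\<^sub>R b, e) = f (l *\<^sub>R x + (l * s) *\<^sub>R b, e)" by (simp add: scaleR_add_right)
  qed (use x in auto)
  show ?thesis using DERIV_unique[OF A C] l by simp
qed

lemma dir_deriv_scale: "dir_deriv f (c *\<^sub>R v) p = c * dir_deriv f v p"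
  by (simp add: dir_deriv_def sum_distrib_left mult.assoc)

definition dir_deriv2 :: "('a::euclidean_space \<times> real \<Rightarrow> real) \<Rightarrow> 'a \<Rightarrow> 'a \<times> real \<Rightarrow> real" where
  "dir_deriv2 f v p = (\<Sum>c\<in>Basis. (v \<bullet> c) * dir_deriv (partial f (c, 0)) v p)"

lemma dir_deriv2_scale: "dir_deriv2 f (c *\<^sub>R v) p = c\<^sup>2 * dir_deriv2 f v p"
  by (simp add: dir_deriv2_def dir_deriv_scale sum_distrib_left power2_eq_square algebra_simps)

lemma dir_deriv2_deriv:
  assumes "Cinf W f" "(x + s *\<^sub>R v, e) \<in> W"
  shows "((\<lambda>s. dir_deriv f v (x + s *\<^sub>R v, e)) has_real_derivative dir_deriv2 f v (x + s *\<^sub>R v, e)) (at s)"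
  unfolding dir_deriv_def[of f] dir_deriv2_def
  by (intro DERIV_sum DERIV_cmult dir_deriv_deriv[OF Cinf_partial[OF assms(1)] assms(2)]) (auto simp: Basis_prod_def)

lemma partial_x_zero:
  fixes f :: "'a::euclidean_space \<times> real \<Rightarrow> real"
  assumes "Cinf ((-{0}) \<times> I) f" "\<And>x. x \<noteq> 0 \<Longrightarrow> f (x, e) = 0" "x \<noteq> 0" "e \<in> I" "b \<in> Basis"
  shows "partial f (b, 0) (x, e) = 0"
proof -
  have A: "((\<lambda>s. f (x + s *\<^sub>R b, e)) has_real_derivative partial f (b, 0) (x, e)) (at 0)"
    using dir_deriv_deriv[OF assms(1), of x 0 b e] assms by (simp add: dir_deriv_Basis)
  have "((\<lambda>s. 0) has_real_derivative 0) (at 0)" by simp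
  moreover have "open ((\<lambda>s::real. x + s *\<^sub>R b) -` (-{0}))" by (intro open_vimage continuous_intros)
  ultimately have "((\<lambda>s. f (x + s *\<^sub>R b, e)) has_real_derivative 0) (at 0)"
    by (rule has_field_derivative_transform_within_open) (use assms in auto)
  then show ?thesis using A DERIV_unique by blast
qed

text \<open>The second derivative of the squared norm along a unit vector is 2; that of R is
  constant along rays and zero at e = 0. On a product of two unit spheres the sum therefore stays
  positive for small e. R need not be twice differentiable at 0, so segments through the origin are
  handled by homogeneity.\<close>

lemma homogeneous_perturbation_convex:
  fixes R :: "'a::euclidean_space \<times> real \<Rightarrow> real"
  assumes i: "i > 0" and R: "Cinf ((-{0}) \<times> {-i<..<i}) R"
    and hom: "\<And>c x e. R (c *\<^sub>R x, e) = c\<^sup>2 * R (x, e)" and R0: "\<And>x. R (x, 0) = 0"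
  shows "\<exists>d>0. d \<le> i \<and> (\<forall>e. \<bar>e\<bar> < d \<longrightarrow> (\<forall>x. \<bar>R (x, e)\<bar> \<le> (norm x)\<^sup>2 / 2) \<and> convex {x. (norm x)\<^sup>2 + R (x, e) \<le> 1})"
proof -
  let ?I = "{-i<..<i}"
  let ?W = "(-{0}) \<times> ?I :: ('a \<times> real) set"
  have oW: "open ?W" by (intro open_Times) auto
  have p1: "Cinf ?W (partial R (c, 0))" if "c \<in> Basis" for c
    by (rule Cinf_partial[OF R]) (use that in \<open>auto simp: Basis_prod_def\<close>)
  have p2: "Cinf ?W (partial (partial R (c, 0)) (c', 0))" if "c \<in> Basis" "c' \<in> Basis" for c c'
    by (rule Cinf_partial[OF p1[OF that(1)]]) (use that in \<open>auto simp: Basis_prod_def\<close>)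
  have h1: "partial R (c, 0) (l *\<^sub>R x, e) = l ^ Suc 0 * partial R (c, 0) (x, e)" if "x \<noteq> 0" "e \<in> ?I" "l > 0" "c \<in> Basis" for l x e c
    by (rule partial_homogeneous[OF R]) (use that hom in \<open>auto simp: power2_eq_square\<close>)
  have h2: "partial (partial R (c, 0)) (c', 0) (l *\<^sub>R x, e) = l ^ 0 * partial (partial R (c, 0)) (c', 0) (x, e)"
    if "x \<noteq> 0" "e \<in> ?I" "l > 0" "c \<in> Basis" "c' \<in> Basis" for l x e c c'
    by (rule partial_homogeneous[OF p1]) (use that h1[of _ _ l c] in auto)
  have dv2h: "dir_deriv2 R v (l *\<^sub>R x, e) = dir_deriv2 R v (x, e)" if "x \<noteq> 0" "e \<in> ?I" "l > 0" for l x e v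
    unfolding dir_deriv2_def dir_deriv_def using h2[OF that] by simp
  have z1: "partial R (c, 0) (x, 0) = 0" if "x \<noteq> 0" "c \<in> Basis" for x c
    by (rule partial_x_zero[OF R]) (use that R0 i in auto)
  have z2: "partial (partial R (c, 0)) (c', 0) (x, 0) = 0" if "x \<noteq> 0" "c \<in> Basis" "c' \<in> Basis" for x c c'
    by (rule partial_x_zero[OF p1]) (use that z1 i in auto)
  have dv20: "dir_deriv2 R v (x, 0) = 0" if "x \<noteq> 0" for v x
    unfolding dir_deriv2_def dir_deriv_def using z2[OF that] by simp
  define V where "V = {q :: ('a \<times> 'a) \<times> real. (fst (fst q), snd q) \<in> ?W}"
  have oV: "open V"
  proof -
    have "V = (\<lambda>q. (fst (fst q), snd q)) -` ?W" by (auto simp: V_def)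
    moreover have "open \<dots>" by (intro open_vimage oW continuous_intros)
    ultimately show ?thesis by simp
  qed
  have cV: "continuous_on V (\<lambda>q. 2 + dir_deriv2 R (snd (fst q)) (fst (fst q), snd q))"
    unfolding dir_deriv2_def dir_deriv_def
    by (intro continuous_intros continuous_on_compose2[OF Cinf_continuous[OF p2]]) (auto simp: V_def)
  have "\<exists>d>0. \<forall>q\<in>sphere 0 1 \<times> sphere 0 1. \<forall>e. dist e 0 < d \<longrightarrow> (q, e) \<in> V \<and> 2 + dir_deriv2 R (snd (fst (q, e))) (fst (fst (q, e)), snd (q, e)) > 0"
  proof (rule tube_positive[OF _ oV cV])
    fix q :: "'a \<times> 'a" assume "q \<in> sphere 0 1 \<times> sphere 0 1"
    then have "fst q \<noteq> 0" by auto
    then show "(q, 0) \<in> V \<and> 2 + dir_deriv2 R (snd (fst (q, 0))) (fst (fst (q, 0)), snd (q, 0::real)) > 0"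
      using i dv20 by (auto simp: V_def)
  qed (intro compact_Times compact_sphere)
  then obtain d1 where d1: "d1 > 0" "\<And>x v e. norm x = 1 \<Longrightarrow> norm v = 1 \<Longrightarrow> \<bar>e\<bar> < d1 \<Longrightarrow> 2 + dir_deriv2 R v (x, e) > 0"
    by auto
  have "\<exists>d>0. \<forall>x\<in>sphere 0 1. \<forall>e. dist e 0 < d \<longrightarrow> (x, e) \<in> ?W \<and> 1/2 - \<bar>R (x, e)\<bar> > 0"
    by (rule tube_positive[OF compact_sphere oW])
      (use R0 i in \<open>auto intro!: continuous_intros Cinf_continuous[OF R]\<close>)
  then obtain d2 where d2: "d2 > 0" "\<And>x e. norm x = 1 \<Longrightarrow> \<bar>e\<bar> < d2 \<Longrightarrow> \<bar>R (x, e)\<bar> < 1/2"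
    by auto
  define d where "d = min i (min d1 d2)"
  have d: "d > 0" "d \<le> i" "d \<le> d1" "d \<le> d2" using i d1(1) d2(1) by (auto simp: d_def)
  have main: "(\<forall>x. \<bar>R (x, e)\<bar> \<le> (norm x)\<^sup>2 / 2) \<and> convex {x. (norm x)\<^sup>2 + R (x, e) \<le> 1}" if e: "\<bar>e\<bar> < d" for e
  proof
    have eI: "e \<in> ?I" unfolding greaterThanLessThan_iff using e d by linarith
    show bd: "\<forall>x. \<bar>R (x, e)\<bar> \<le> (norm x)\<^sup>2 / 2"
    proof
      fix x :: 'a
      show "\<bar>R (x, e)\<bar> \<le> (norm x)\<^sup>2 / 2"
      proof (cases "x = 0")
        case True
        then show ?thesis using hom[of 0 x e] by simp
      next
        case False
        have "\<bar>R ((1 / norm x) *\<^sub>R x, e)\<bar> \<le> 1/2" using d2(2)[of "(1 / norm x) *\<^sub>R x" e] False e d by simp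
        then show ?thesis using False by (simp add: hom abs_mult power_divide field_simps)
      qed
    qed
    define Q where "Q x = (norm x)\<^sup>2 + R (x, e)" for x
    have Qh: "Q (c *\<^sub>R x) = c\<^sup>2 * Q x" for c x by (simp add: Q_def hom power_mult_distrib distrib_left)
    have Qpos: "Q x \<ge> 0" for x using bd[rule_format, of x] zero_le_power2[of "norm x"] unfolding Q_def by linarith
    have d2pos: "2 * (norm v)\<^sup>2 + dir_deriv2 R v (x, e) \<ge> 0" if "x \<noteq> 0" for x v
    proof (cases "v = 0")
      case True
      then show ?thesis by (simp add: dir_deriv2_def)
    next
      case False
      define x' where "x' = (1 / norm x) *\<^sub>R x"
      define v' where "v' = (1 / norm v) *\<^sub>R v"
      have n: "norm x' = 1" "norm v' = 1" using that False by (auto simp: x'_def v'_def)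
      have x: "x = norm x *\<^sub>R x'" "x' \<noteq> 0" and v: "v = norm v *\<^sub>R v'" using that False by (auto simp: x'_def v'_def)
      have "dir_deriv2 R v (x, e) = (norm v)\<^sup>2 * dir_deriv2 R v' (norm x *\<^sub>R x', e)"
        using dir_deriv2_scale[of R "norm v" v' "(x, e)"] x v by metis
      also have "\<dots> = (norm v)\<^sup>2 * dir_deriv2 R v' (x', e)" using dv2h[OF x(2) eI, of "norm x" v'] that by simp
      finally have "2 * (norm v)\<^sup>2 + dir_deriv2 R v (x, e) = (norm v)\<^sup>2 * (2 + dir_deriv2 R v' (x', e))" by (simp add: algebra_simps)
      also have "\<dots> \<ge> 0" using d1(2)[OF n, of e] e d by (intro mult_nonneg_nonneg) auto
      finally show ?thesis .
    qed
    have "convex {x. Q x \<le> 1}"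
    proof (rule convexI)
      fix a b :: 'a and p u :: real
      assume ab: "a \<in> {x. Q x \<le> 1}" "b \<in> {x. Q x \<le> 1}" and pu: "0 \<le> p" "0 \<le> u" "p + u = 1"
      define v where "v = b - a"
      have pt: "p *\<^sub>R a + u *\<^sub>R b = a + u *\<^sub>R v"
      proof -
        have "p = 1 - u" using pu by simp
        show ?thesis unfolding \<open>p = 1 - u\<close> v_def by (simp add: algebra_simps)
      qed
      have "Q (a + u *\<^sub>R v) \<le> 1"
      proof (cases "\<exists>s\<in>{0..1}. a + s *\<^sub>R v = 0")
        case False
        define f where "f s = Q (a + s *\<^sub>R v)" for s
        define f' where "f' s = 2 * ((a + s *\<^sub>R v) \<bullet> v) + dir_deriv R v (a + s *\<^sub>R v, e)" for s
        have nz: "a + s *\<^sub>R v \<noteq> 0" if "s \<in> {0..1}" for s using False that by blast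
        have "convex_on {0..1} f"
        proof (rule f''_ge0_imp_convex)
          fix s :: real assume s: "s \<in> {0..1}"
          have m: "(a + s *\<^sub>R v, e) \<in> ?W" using nz[OF s] eI by simp
          have "((\<lambda>s. (a + s *\<^sub>R v) \<bullet> (a + s *\<^sub>R v)) has_real_derivative 2 * ((a + s *\<^sub>R v) \<bullet> v)) (at s)"
            unfolding inner_add_left inner_add_right inner_scaleR_left inner_scaleR_right
            by (auto intro!: derivative_eq_intros simp: inner_commute[of v a] algebra_simps)
          from DERIV_add[OF this dir_deriv_deriv[OF R m]]
          show "(f has_real_derivative f' s) (at s)"
            unfolding f_def[abs_def] f'_def Q_def power2_norm_eq_inner .
          have "((\<lambda>s. 2 * ((a + s *\<^sub>R v) \<bullet> v)) has_real_derivative 2 * (norm v)\<^sup>2) (at s)"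
            unfolding inner_add_left inner_scaleR_left power2_norm_eq_inner
            by (auto intro!: derivative_eq_intros)
          from DERIV_add[OF this dir_deriv2_deriv[OF R m]]
          show "(f' has_real_derivative 2 * (norm v)\<^sup>2 + dir_deriv2 R v (a + s *\<^sub>R v, e)) (at s)"
            unfolding f'_def[abs_def] .
          show "0 \<le> 2 * (norm v)\<^sup>2 + dir_deriv2 R v (a + s *\<^sub>R v, e)" by (rule d2pos[OF nz[OF s]])
        qed simp
        then have "f ((1 - u) *\<^sub>R 0 + u *\<^sub>R 1) \<le> (1 - u) * f 0 + u * f 1"
          by (rule convex_onD) (use pu in auto)
        also have "\<dots> \<le> (1 - u) * 1 + u * 1"
          using ab pu by (intro add_mono mult_left_mono) (auto simp: f_def v_def)
        finally show ?thesis by (simp add: f_def)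
      next
        case True
        then obtain s where s: "0 \<le> s" "s \<le> 1" "a + s *\<^sub>R v = 0" by auto
        have av: "a = - (s *\<^sub>R v)" using s(3) by (simp add: eq_neg_iff_add_eq_0)
        have bv: "b = (1 - s) *\<^sub>R v" using av by (simp add: v_def algebra_simps)
        have Qa: "s\<^sup>2 * Q v \<le> 1" using ab(1) Qh[of "-s" v] by (simp add: av)
        have Qb: "(1 - s)\<^sup>2 * Q v \<le> 1" using ab(2) Qh[of "1 - s" v] by (simp add: bv)
        have x: "a + u *\<^sub>R v = (u - s) *\<^sub>R v" unfolding av by (simp add: algebra_simps)
        \<comment> \<open>On a line through 0 the function is a multiple of the squared distance
          from the zero s, and u is no farther from s than one of the endpoints 0 and 1.\<close>
        have "(u - s)\<^sup>2 \<le> s\<^sup>2 \<or> (u - s)\<^sup>2 \<le> (1 - s)\<^sup>2"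
        proof (cases "u \<le> s")
          case True
          then have "(s - u)\<^sup>2 \<le> s\<^sup>2" using pu by (intro power_mono) auto
          then show ?thesis by (simp add: power2_commute)
        next
          case False
          then have "(u - s)\<^sup>2 \<le> (1 - s)\<^sup>2" using pu by (intro power_mono) auto
          then show ?thesis by simp
        qed
        then have "(u - s)\<^sup>2 * Q v \<le> 1"
          using Qa Qb Qpos[of v] mult_right_mono[of "(u - s)\<^sup>2" "s\<^sup>2" "Q v"] mult_right_mono[of "(u - s)\<^sup>2" "(1 - s)\<^sup>2" "Q v"]
          by linarith
        then show ?thesis unfolding x Qh .
      qed
      then show "p *\<^sub>R a + u *\<^sub>R b \<in> {x. Q x \<le> 1}" by (simp add: pt)
    qed
    then show "convex {x. (norm x)\<^sup>2 + R (x, e) \<le> 1}" by (simp add: Q_def)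
  qed
  show ?thesis using d(1,2) main by blast
qed

section \<open>The bodies K and L\<close>

lemma Cinf_norm_sq:
  fixes g :: "'a::euclidean_space \<Rightarrow> 'b::euclidean_space"
  assumes "open U" "\<And>c. c \<in> Basis \<Longrightarrow> Cinf U (\<lambda>x. g x \<bullet> c)"
  shows "Cinf U (\<lambda>x. (norm (g x))\<^sup>2)"
proof -
  have "Cinf U (\<lambda>x. \<Sum>c\<in>Basis. (g x \<bullet> c) * (g x \<bullet> c))"
    by (intro Cinf_sum Cinf_mult assms)
  then show ?thesis
    by (rule Cinf_cong) (simp add: power2_norm_eq_inner euclidean_inner[of "g _" "g _"])
qed

lemma bounded_linear_nth: "bounded_linear (\<lambda>x :: real^'n. x $ k)"
  by (rule bounded_linear_vec_nth)

lemma inner_section_fun_max: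
  assumes "\<And>t. hyp_volume u (K \<inter> hyperplane_at u t) \<le> hyp_volume u (K \<inter> hyperplane_at u t0)"
  shows "inner_section_fun K u = hyp_volume u (K \<inter> hyperplane_at u t0)"
  unfolding inner_section_fun_def by (rule cSup_eq_maximum) (use assms in auto)

section \<open>Convexity, smoothness and asymmetry of K\<close>

lemma mem_K_profile: "x \<in> rotbody k (K_profile e) \<longleftrightarrow> (norm x)\<^sup>2 + e * bump (x $ k) \<le> 1"
  by (simp add: rotbody_def K_profile_def)

text \<open>Along a segment the second derivative is 2 |v|^2 + e bump'' v_k^2, and e bump'' is at
  most 1/4 in absolute value.\<close>

lemma convex_K_profile:
  assumes "\<bar>e\<bar> < eps_max" shows "convex (rotbody k (K_profile e) :: (real^'n) set)"
proof (rule convexI)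
  fix a b :: "real^'n" and p u :: real
  assume ab: "a \<in> rotbody k (K_profile e)" "b \<in> rotbody k (K_profile e)" and pu: "0 \<le> p" "0 \<le> u" "p + u = 1"
  define v where "v = b - a"
  define f where "f s = (a + s *\<^sub>R v) \<bullet> (a + s *\<^sub>R v) + e * bump (a $ k + s * v $ k)" for s
  have p: "p = 1 - u" using pu by simp
  have pt: "p *\<^sub>R a + u *\<^sub>R b = a + u *\<^sub>R v" unfolding p v_def by (simp add: algebra_simps)
  have "convex_on UNIV f"
  proof (rule f''_ge0_imp_convex)
    fix s :: real
    have l: "((\<lambda>s. a $ k + s * v $ k) has_real_derivative v $ k) (at s)"
      by (auto intro!: derivative_eq_intros)
    have 1: "((\<lambda>s. (a + s *\<^sub>R v) \<bullet> (a + s *\<^sub>R v)) has_real_derivative 2 * ((a + s *\<^sub>R v) \<bullet> v)) (at s)"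
      unfolding inner_add_left inner_add_right inner_scaleR_left inner_scaleR_right
      by (auto intro!: derivative_eq_intros simp: inner_commute[of v a] algebra_simps)
    show "(f has_real_derivative 2 * ((a + s *\<^sub>R v) \<bullet> v) + e * (bump_deriv (a $ k + s * v $ k) * v $ k)) (at s)"
      unfolding f_def[abs_def] by (intro DERIV_add DERIV_cmult 1 DERIV_chain2[OF bump_derivs(1) l])
    have 2: "((\<lambda>s. 2 * ((a + s *\<^sub>R v) \<bullet> v)) has_real_derivative 2 * (norm v)\<^sup>2) (at s)"
      unfolding inner_add_left inner_scaleR_left power2_norm_eq_inner
      by (auto intro!: derivative_eq_intros)
    show "((\<lambda>s. 2 * ((a + s *\<^sub>R v) \<bullet> v) + e * (bump_deriv (a $ k + s * v $ k) * v $ k)) has_real_derivative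
      2 * (norm v)\<^sup>2 + e * (bump_deriv2 (a $ k + s * v $ k) * v $ k * v $ k)) (at s)"
      by (intro DERIV_add DERIV_cmult 2 DERIV_cmult_right DERIV_chain2[OF bump_derivs(2) l])
    have "\<bar>v $ k\<bar>\<^sup>2 \<le> (norm v)\<^sup>2" by (intro power_mono component_le_norm_cart) auto
    then have "(v $ k)\<^sup>2 \<le> (norm v)\<^sup>2" by simp
    moreover have "\<bar>e * bump_deriv2 (a $ k + s * v $ k)\<bar> * (v $ k)\<^sup>2 \<le> 1/4 * (v $ k)\<^sup>2"
      by (intro mult_right_mono eps_max_bound(2)[OF assms]) auto
    moreover have "e * (bump_deriv2 (a $ k + s * v $ k) * v $ k * v $ k) = (e * bump_deriv2 (a $ k + s * v $ k)) * (v $ k)\<^sup>2"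
      by (simp add: power2_eq_square)
    moreover have "\<bar>(e * bump_deriv2 (a $ k + s * v $ k)) * (v $ k)\<^sup>2\<bar> = \<bar>e * bump_deriv2 (a $ k + s * v $ k)\<bar> * (v $ k)\<^sup>2"
      by (simp add: abs_mult)
    moreover have "0 \<le> (v $ k)\<^sup>2" by simp
    ultimately show "0 \<le> 2 * (norm v)\<^sup>2 + e * (bump_deriv2 (a $ k + s * v $ k) * v $ k * v $ k)" by linarith
  qed simp
  then have "f ((1 - u) *\<^sub>R 0 + u *\<^sub>R 1) \<le> (1 - u) * f 0 + u * f 1"
    by (rule convex_onD) (use pu in auto)
  also have "\<dots> \<le> (1 - u) * 1 + u * 1"
    using ab pu by (intro add_mono mult_left_mono) (auto simp: f_def v_def mem_K_profile power2_norm_eq_inner)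
  finally have "f u \<le> 1" by simp
  then show "p *\<^sub>R a + u *\<^sub>R b \<in> rotbody k (K_profile e)"
    unfolding pt mem_K_profile power2_norm_eq_inner by (simp add: f_def)
qed

lemma compact_K_profile:
  assumes "0 \<le> e" shows "compact (rotbody k (K_profile e) :: (real^'n) set)"
proof -
  have "continuous_on UNIV (\<lambda>x :: real^'n. (norm x)\<^sup>2 + e * bump (x $ k))"
    by (intro continuous_intros continuous_on_compose2[OF Cinf_continuous[OF bump(1)]]) auto
  then have "closed {x :: real^'n. (norm x)\<^sup>2 + e * bump (x $ k) \<le> 1}"
    by (intro closed_Collect_le) auto
  moreover have "{x :: real^'n. (norm x)\<^sup>2 + e * bump (x $ k) \<le> 1} \<subseteq> cball 0 1"
  proof
    fix x :: "real^'n" assume "x \<in> {x. (norm x)\<^sup>2 + e * bump (x $ k) \<le> 1}"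
    moreover have "e * bump (x $ k) \<ge> 0" using assms bump(2) by simp
    ultimately have "(norm x)\<^sup>2 \<le> 1" by simp
    then show "x \<in> cball 0 1" by (simp add: abs_square_le_1)
  qed
  moreover have "rotbody k (K_profile e) = {x :: real^'n. (norm x)\<^sup>2 + e * bump (x $ k) \<le> 1}" using mem_K_profile by blast
  ultimately show ?thesis using compact_subset_closed[OF _ compact_cball] by metis
qed

lemma interior_K_profile: "0 \<in> interior (rotbody k (K_profile e) :: (real^'n) set)"
proof -
  have "ball 0 (1/4) \<subseteq> (rotbody k (K_profile e) :: (real^'n) set)"
  proof
    fix x :: "real^'n" assume x: "x \<in> ball 0 (1/4)"
    have "x $ k \<le> 1/4" using x component_le_norm_cart[of x k] by (auto simp: abs_le_iff)
    moreover have "(norm x)\<^sup>2 \<le> 1" using x by (simp add: abs_square_le_1)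
    ultimately show "x \<in> rotbody k (K_profile e)" using bump_zero by (simp add: mem_K_profile)
  qed
  then have "ball 0 (1/4) \<subseteq> interior (rotbody k (K_profile e) :: (real^'n) set)" by (rule interior_maximal) simp
  then show ?thesis by (meson centre_in_ball subsetD zero_less_divide_1_iff zero_less_numeral)
qed

text \<open>The radial function is the positive root in r of |r x|^2 + e bump (r x_k) = 1. On the
  neighbourhood |x| > 1/2 of the sphere it lies below 4, since at r = 4 the left side exceeds 16/4 -
  1/4.\<close>

lemma radial_K_profile:
  assumes e: "\<bar>e\<bar> < eps_max" shows "smooth_on_sphere (radial_fun (rotbody k (K_profile e) :: (real^'n) set))"
proof -
  define g where "g x r = r\<^sup>2 * (norm x)\<^sup>2 + e * bump (r * x $ k) - 1" for x :: "real^'n" and r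
  define g' where "g' x r = 2 * r * (norm x)\<^sup>2 + e * (bump_deriv (r * x $ k) * x $ k)" for x :: "real^'n" and r
  define U where "U = {x :: real^'n. 1/2 < norm x}"
  have oU: "open U" unfolding U_def by (intro open_Collect_less continuous_intros)
  have l: "((\<lambda>r. r * x $ k) has_real_derivative x $ k) (at r)" for x :: "real^'n" and r
    by (auto intro!: derivative_eq_intros)
  have dg: "(g x has_real_derivative g' x r) (at r)" for x r
  proof -
    have "((\<lambda>r. r\<^sup>2 * (norm x)\<^sup>2) has_real_derivative 2 * r * (norm x)\<^sup>2) (at r)"
      by (auto intro!: derivative_eq_intros)
    from DERIV_diff[OF DERIV_add[OF this DERIV_cmult[OF DERIV_chain2[OF bump_derivs(1) l[of x]]]] DERIV_const]
    show ?thesis unfolding g_def[abs_def] g'_def by simp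
  qed
  have "\<exists>y. 0 < y \<and> y < 4 \<and> g x y = 0 \<and> (\<forall>s\<ge>0. s < y \<longrightarrow> g x s < 0) \<and> (\<forall>s>y. g x s > 0) \<and> g' x y > 0"
    if x: "x \<in> U" for x
  proof (rule convex_root[OF dg])
    have n: "(1/2)\<^sup>2 < (norm x)\<^sup>2" using x by (intro power_strict_mono) (auto simp: U_def)
    fix r
    have "((\<lambda>r. 2 * r * (norm x)\<^sup>2) has_real_derivative 2 * (norm x)\<^sup>2) (at r)"
      by (auto intro!: derivative_eq_intros)
    from DERIV_add[OF this DERIV_cmult[OF DERIV_cmult_right[OF DERIV_chain2[OF bump_derivs(2) l[of x]]]]]
    show "(g' x has_real_derivative 2 * (norm x)\<^sup>2 + e * (bump_deriv2 (r * x $ k) * x $ k * x $ k)) (at r)"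
      unfolding g'_def[abs_def] .
    have "\<bar>x $ k\<bar>\<^sup>2 \<le> (norm x)\<^sup>2" by (intro power_mono component_le_norm_cart) auto
    then have "(x $ k)\<^sup>2 \<le> (norm x)\<^sup>2" by simp
    moreover have "\<bar>e * bump_deriv2 (r * x $ k)\<bar> * (x $ k)\<^sup>2 \<le> 1/4 * (x $ k)\<^sup>2"
      by (intro mult_right_mono eps_max_bound(2)[OF e]) auto
    moreover have "e * (bump_deriv2 (r * x $ k) * x $ k * x $ k) = (e * bump_deriv2 (r * x $ k)) * (x $ k)\<^sup>2"
      by (simp add: power2_eq_square)
    moreover have "\<bar>(e * bump_deriv2 (r * x $ k)) * (x $ k)\<^sup>2\<bar> = \<bar>e * bump_deriv2 (r * x $ k)\<bar> * (x $ k)\<^sup>2"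
      by (simp add: abs_mult)
    moreover have "(norm x)\<^sup>2 > 0" using n by (simp add: power2_eq_square)
    ultimately show "0 < 2 * (norm x)\<^sup>2 + e * (bump_deriv2 (r * x $ k) * x $ k * x $ k)" by linarith
    show "g x 0 < 0" using bump_zero[of 0] by (simp add: g_def)
    show "g x 4 > 0" using n eps_max_bound(1)[OF e, of "4 * x $ k"] unfolding g_def by (simp add: power2_eq_square)
  qed simp
  then obtain \<rho> where \<rho>: "\<And>x. x \<in> U \<Longrightarrow> 0 < \<rho> x \<and> \<rho> x < 4 \<and> g x (\<rho> x) = 0 \<and> (\<forall>s\<ge>0. s < \<rho> x \<longrightarrow> g x s < 0) \<and>
    (\<forall>s>\<rho> x. g x s > 0) \<and> g' x (\<rho> x) > 0" by metis
  have CH: "Cinf (U \<times> {0<..<4}) (\<lambda>p. g (fst p) (snd p))"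
  proof -
    have o: "open (U \<times> {0<..<4::real})" by (intro open_Times oU open_greaterThanLessThan)
    have 1: "Cinf (U \<times> {0<..<4}) (\<lambda>p. snd p)" by (intro Cinf_linear o bounded_linear_intros)
    have 2: "Cinf (U \<times> {0<..<4::real}) (\<lambda>p. fst p $ k)"
      by (intro Cinf_linear o bounded_linear_compose[OF bounded_linear_nth] bounded_linear_intros)
    have 3: "Cinf (U \<times> {0<..<4::real}) (\<lambda>p. (norm (fst p))\<^sup>2)"
      by (intro Cinf_norm_sq o Cinf_linear bounded_linear_intros)
    show ?thesis unfolding g_def
      by (intro Cinf_diff Cinf_add Cinf_mult Cinf_power Cinf_const o 1 2 3 Cinf_compose_real[OF bump(1)]) auto
  qed
  have "Cinf U \<rho>"
  proof (rule implicit_Cinf_sign[OF CH oU])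
    fix x assume x: "x \<in> U"
    note \<rho>x = \<rho>[OF x]
    show "\<rho> x \<in> {0<..<4}" using \<rho>x by auto
    show "g (fst (x, s)) (snd (x, s)) < 0" if "0 < s" "s < \<rho> x" for s using \<rho>x that by auto
    show "g (fst (x, s)) (snd (x, s)) > 0" if "\<rho> x < s" "s < 4" for s using \<rho>x that by auto
    show "g (fst (x, \<rho> x)) (snd (x, \<rho> x)) = 0" using \<rho>x by auto
    have "partial (\<lambda>p. g (fst p) (snd p)) (0, 1) (x, \<rho> x) = g' x (\<rho> x)"
      by (rule partial_slice_snd[OF CH]) (use x \<rho>x dg in auto)
    then show "partial (\<lambda>p. g (fst p) (snd p)) (0, 1) (x, \<rho> x) \<noteq> 0" using \<rho>x by simp
  qed
  then have "smooth_on U \<rho>" by (rule Cinf_imp_smooth_on)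
  moreover have "sphere 0 1 \<subseteq> U" by (auto simp: U_def)
  moreover have "\<rho> x = radial_fun (rotbody k (K_profile e)) x" if "x \<in> sphere 0 1" for x
  proof -
    have x: "x \<in> U" "norm x = 1" using that by (auto simp: U_def)
    note \<rho>x = \<rho>[OF x(1)]
    have m: "c *\<^sub>R x \<in> rotbody k (K_profile e) \<longleftrightarrow> g x c \<le> 0" for c using x by (simp add: mem_K_profile g_def)
    have "Sup {c. c *\<^sub>R x \<in> rotbody k (K_profile e)} = \<rho> x"
    proof (rule cSup_eq_maximum)
      show "\<rho> x \<in> {c. c *\<^sub>R x \<in> rotbody k (K_profile e)}" using \<rho>x by (simp add: m)
      fix c assume "c \<in> {c. c *\<^sub>R x \<in> rotbody k (K_profile e)}"
      then have "\<not> g x c > 0" by (simp add: m)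
      then show "c \<le> \<rho> x" using \<rho>x by (meson not_le)
    qed
    then show ?thesis by (simp add: radial_fun_def)
  qed
  ultimately show ?thesis unfolding smooth_on_sphere_def by blast
qed

text \<open>Both poles belong to K, which lies in the unit ball, so the only possible centre is the origin.\<close>

lemma not_centrally_symmetric_K_profile:
  fixes k j :: "'n::finite"
  assumes "e > 0" "j \<noteq> k"
  shows "\<not> centrally_symmetric (rotbody k (K_profile e) :: (real^'n) set)"
proof
  let ?K = "rotbody k (K_profile e) :: (real^'n) set"
  assume "centrally_symmetric ?K"
  then obtain c X where cX: "origin_symmetric X" "?K = (\<lambda>x. c + x) ` X" by (auto simp: centrally_symmetric_def)
  have sym: "2 *\<^sub>R c - x \<in> ?K" if x: "x \<in> ?K" for x
  proof -
    obtain y where y: "y \<in> X" "x = c + y" using x cX(2) by auto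
    have "- y \<in> X" using cX(1) y(1) unfolding origin_symmetric_def by (metis imageI)
    then have "c + - y \<in> ?K" using cX(2) by blast
    moreover have "c + - y = 2 *\<^sub>R c - x" by (simp add: y(2) scaleR_2)
    ultimately show ?thesis by simp
  qed
  have nK: "norm x \<le> 1" if "x \<in> ?K" for x
  proof -
    have "0 \<le> e * bump (x $ k)" using bump(2) assms(1) by (intro mult_nonneg_nonneg) auto
    then have "(norm x)\<^sup>2 \<le> 1" using that unfolding mem_K_profile by linarith
    then show ?thesis by (simp add: abs_square_le_1)
  qed
  let ?a = "axis k 1 :: real^'n"
  have a: "?a \<in> ?K" "- ?a \<in> ?K" using bump_zero[of 1] bump_zero[of "-1"] by (auto simp: mem_K_profile norm_axis_1 axis_nth)
  have n1: "(norm (2 *\<^sub>R c - ?a))\<^sup>2 \<le> 1" "(norm (2 *\<^sub>R c + ?a))\<^sup>2 \<le> 1"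
    using nK[OF sym[OF a(1)]] nK[OF sym[OF a(2)]] by (auto simp: abs_square_le_1)
  have "?a \<bullet> ?a = 1" by (simp add: inner_axis_axis)
  \<comment> \<open>Parallelogram law: the two squared norms, each at most 1, have the mean 4 |c|^2
    + 1.\<close>
  then have "(norm (2 *\<^sub>R c - ?a))\<^sup>2 + (norm (2 *\<^sub>R c + ?a))\<^sup>2 = 8 * (c \<bullet> c) + 2"
    unfolding power2_norm_eq_inner by (simp add: inner_diff_left inner_diff_right inner_add_left inner_add_right)
  then have "c \<bullet> c \<le> 0" using n1 by linarith
  then have c0: "c = 0" by (metis inner_eq_zero_iff inner_ge_zero order_antisym)
  \<comment> \<open>A point of the unit sphere at height -3/8, where nothing is cut off; its
    antipode, at the middle of the band, is removed.\<close>
  define x where "x = (-3/8) *\<^sub>R ?a + sqrt (1 - 9/64) *\<^sub>R (axis j 1 :: real^'n)"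
  have "(p *\<^sub>R ?a + q *\<^sub>R axis j 1) \<bullet> (p *\<^sub>R ?a + q *\<^sub>R axis j 1) = p\<^sup>2 + q\<^sup>2" for p q
    using assms(2) by (simp add: inner_add_left inner_add_right inner_axis_axis power2_eq_square)
  from this[of "-3/8" "sqrt (1 - 9/64)"]
  have "(norm x)\<^sup>2 = 1" unfolding power2_norm_eq_inner x_def by (simp add: power_divide)
  moreover have xk: "x $ k = -3/8" using assms(2) by (simp add: x_def axis_def)
  ultimately have "x \<in> ?K" using bump_zero[of "-3/8"] by (simp add: mem_K_profile)
  then have "- x \<in> ?K" using sym c0 by fastforce
  then have "1 + e * bump (3/8) \<le> 1" using \<open>(norm x)\<^sup>2 = 1\<close> xk by (simp add: mem_K_profile)
  moreover have "bump (3/8) > 0" by (simp add: bump(3))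
  ultimately show False using assms(1) by (simp add: mult_le_0_iff)
qed

text \<open>For a normal along the axis \<sigma> would be infinite, so this direction is treated
  directly: projection along the axis carries every horizontal section into the central one.\<close>

lemma inner_section_fun_axis:
  fixes u :: "real^'n"
  assumes comp: "compact (rotbody k P :: (real^'n) set)" and u: "norm u = 1" "\<bar>u $ k\<bar> = 1"
    and proj: "\<And>x :: real^'n. x \<in> rotbody k P \<Longrightarrow> x - (x $ k) *\<^sub>R axis k 1 \<in> rotbody k P"
  shows "inner_section_fun (rotbody k P) u = hyp_volume u (rotbody k P \<inter> {x. x $ k = 0})"
proof -
  have uk2: "(u $ k)\<^sup>2 = 1" using u(2) by (simp add: abs_square_eq_1)
  have ueq: "u = (u $ k) *\<^sub>R axis k 1"
  proof -
    have "u \<bullet> u = 1" using u by (simp add: dot_square_norm)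
    then have "(u - (u $ k) *\<^sub>R axis k 1) \<bullet> (u - (u $ k) *\<^sub>R axis k 1) = 0"
      using uk2 unfolding inner_diff_left inner_diff_right
      by (simp add: inner_axis inner_axis' inner_axis_axis power2_eq_square)
    then show ?thesis by simp
  qed
  have xu: "x \<bullet> u = (u $ k) * (x $ k)" for x by (subst ueq) (simp add: inner_axis)
  have h0: "hyperplane_at u 0 = {x. x $ k = 0}" using uk2 by (auto simp: hyperplane_at_eq[OF u(1)] xu)
  have "hyp_volume u (rotbody k P \<inter> hyperplane_at u t) \<le> hyp_volume u (rotbody k P \<inter> hyperplane_at u 0)" for t
  proof -
    have sub: "prism u (rotbody k P \<inter> hyperplane_at u t) \<subseteq> (+) (t *\<^sub>R u) ` prism u (rotbody k P \<inter> hyperplane_at u 0)"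
    proof
      fix y assume "y \<in> prism u (rotbody k P \<inter> hyperplane_at u t)"
      then obtain a s where a: "y = a + s *\<^sub>R u" "a \<in> rotbody k P" "u $ k * a $ k = t" "s \<in> {0..1}"
        by (auto simp: prism_def hyperplane_at_eq[OF u(1)] xu)
      have "a $ k = t * u $ k" using a(3) uk2 by (auto simp: power2_eq_square)
      then have "t *\<^sub>R u = (a $ k) *\<^sub>R axis k 1" by (subst ueq) simp
      then have "a - t *\<^sub>R u \<in> rotbody k P \<inter> hyperplane_at u 0" using proj[OF a(2)] by (simp add: h0 axis_def)
      then have "(a - t *\<^sub>R u) + s *\<^sub>R u \<in> prism u (rotbody k P \<inter> hyperplane_at u 0)" using a(4) by (auto simp: prism_def)
      then show "y \<in> (+) (t *\<^sub>R u) ` prism u (rotbody k P \<inter> hyperplane_at u 0)"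
        by (rule rev_image_eqI) (simp add: a(1))
    qed
    have c: "compact (prism u (rotbody k P \<inter> hyperplane_at u t))" for t by (intro compact_prism compact_section comp u)
    have "measure lebesgue (prism u (rotbody k P \<inter> hyperplane_at u t)) \<le> measure lebesgue ((+) (t *\<^sub>R u) ` prism u (rotbody k P \<inter> hyperplane_at u 0))"
      by (intro measure_mono_fmeasurable[OF sub] measurable_translation lmeasurable_compact c)
        (use lmeasurable_compact[OF c] in \<open>auto simp: fmeasurable_def\<close>)
    also have "\<dots> = measure lebesgue (prism u (rotbody k P \<inter> hyperplane_at u 0))" by (rule measure_translation)
    finally show ?thesis by (simp add: hyp_volume_prism)
  qed
  from inner_section_fun_max[OF this] show ?thesis by (simp add: h0)
qed

lemma proj_axis_mem:
  "x - (x $ k) *\<^sub>R axis k 1 \<in> rotbody k P \<longleftrightarrow> P 0 ((norm x)\<^sup>2 - (x $ k)\<^sup>2)"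
proof -
  have "(\<Sum>i\<in>-{k}. ((x - (x $ k) *\<^sub>R axis k 1) $ i)\<^sup>2) = (\<Sum>i\<in>-{k}. (x $ i)\<^sup>2)"
    by (intro sum.cong) (auto simp: axis_def)
  then show ?thesis by (simp add: rotbody_def norm_sq_minus axis_def)
qed

lemma sec_vol_reflect:
  assumes [measurable]: "Measurable.pred (borel \<Otimes>\<^sub>M borel) (\<lambda>(z, a). P z a)" and "\<And>z a. P (- z) a = P z a"
  shows "sec_vol d P (- \<alpha>) \<beta> = sec_vol d P \<alpha> \<beta>"
proof -
  have m: "(\<lambda>z. (nn_abel ^^ d) (\<lambda>a. of_bool (P z a)) ((\<alpha> - \<beta> * z)\<^sup>2)) \<in> borel_measurable borel"
    by (rule nn_abel_pow_section_measurable) measurable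
  have "sec_vol d P \<alpha> \<beta> = (\<integral>\<^sup>+z. (nn_abel ^^ d) (\<lambda>a. of_bool (P (0 + - 1 * z) a)) ((\<alpha> - \<beta> * (0 + - 1 * z))\<^sup>2) \<partial>lborel)"
    unfolding sec_vol_def using nn_integral_real_affine[OF m, of "-1" 0] by simp
  also have "\<dots> = sec_vol d P (- \<alpha>) \<beta>"
    unfolding sec_vol_def
  proof (intro nn_integral_cong)
    fix z
    have "(\<alpha> - \<beta> * (0 + - 1 * z))\<^sup>2 = (- \<alpha> - \<beta> * z)\<^sup>2" by (simp add: power2_eq_square algebra_simps)
    then show "(nn_abel ^^ d) (\<lambda>a. of_bool (P (0 + - 1 * z) a)) ((\<alpha> - \<beta> * (0 + - 1 * z))\<^sup>2) = (nn_abel ^^ d) (\<lambda>a. of_bool (P z a)) ((- \<alpha> - \<beta> * z)\<^sup>2)"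
      using assms(2)[of z] by simp
  qed
  finally show ?thesis by simp
qed

text \<open>The perturbation is homogeneous of degree 2 in the point, with a / z^2 playing the role
  of \<tau>. At z = 0 the factor z^2 makes the value of the quotient irrelevant.\<close>

definition L_profile :: "(real \<Rightarrow> real) \<Rightarrow> real \<Rightarrow> real \<Rightarrow> bool" where
  "L_profile q z a \<longleftrightarrow> a + z\<^sup>2 + z\<^sup>2 * q (a / z\<^sup>2) \<le> 1"

lemma L_profile_measurable [measurable]:
  assumes [measurable]: "q \<in> borel_measurable borel"
  shows "Measurable.pred (borel \<Otimes>\<^sub>M borel) (\<lambda>(z, a). L_profile q z a)"
  unfolding L_profile_def by measurable

lemma L_profile_reflect: "L_profile q (- z) a = L_profile q z a" by (simp add: L_profile_def)

text \<open>About the origin L is explicit in polar coordinates, z^2 (1 + \<tau> + q \<tau>) \<le>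
  1; the factor 2 comes from reflection in the equator.\<close>

lemma sec_vol_at_L_profile:
  assumes q: "q \<in> borel_measurable borel" and pos: "\<And>\<tau>. \<tau> \<ge> 0 \<Longrightarrow> 1 + \<tau> + q \<tau> > 0" and "\<sigma> \<ge> 0"
  shows "sec_vol_at d (L_profile q) \<sigma> 0 = 2 * (nn_abel ^^ d) (\<lambda>\<tau>. ennreal ((if \<tau> > -1/8 then (1 + \<tau> + q \<tau>) powr (-1/2) else 0) ^ Suc d / Suc d)) \<sigma>"
proof -
  note [measurable] = q
  let ?Y = "\<lambda>\<tau>. if \<tau> > -1/8 then (1 + \<tau> + q \<tau>) powr (-1/2) else 0"
  have "sec_vol_at d (L_profile q) \<sigma> 0 = half_vol d (\<lambda>z. L_profile q (0 + z)) \<sigma> + half_vol d (\<lambda>z. L_profile q (0 - z)) \<sigma>"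
    by (rule sec_vol_at_halves) measurable
  also have "(\<lambda>z. L_profile q (0 - z)) = L_profile q" by (simp add: L_profile_reflect fun_eq_iff)
  also have "half_vol d (\<lambda>z. L_profile q (0 + z)) \<sigma> + half_vol d (L_profile q) \<sigma> = 2 * half_vol d (L_profile q) \<sigma>" by (simp add: mult_2)
  also have "half_vol d (L_profile q) \<sigma> = (nn_abel ^^ d) (\<lambda>\<tau>. ennreal (?Y \<tau> ^ Suc d / Suc d)) \<sigma>"
    unfolding half_vol_def
  proof (rule polar_half)
    fix z \<tau> :: real assume z: "z > 0" "\<tau> \<ge> \<sigma>"
    then have t: "\<tau> \<ge> 0" using assms(3) by simp
    note p = pos[OF t]
    have "L_profile q z (\<tau> * z\<^sup>2) \<longleftrightarrow> z\<^sup>2 * (1 + \<tau> + q \<tau>) \<le> 1" using z by (simp add: L_profile_def algebra_simps)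
    also have "\<dots> \<longleftrightarrow> z\<^sup>2 \<le> (?Y \<tau>)\<^sup>2"
    proof -
      have "(?Y \<tau>)\<^sup>2 = 1 / (1 + \<tau> + q \<tau>)"
        using p t by (simp add: power2_eq_square powr_add[symmetric] powr_minus_divide)
      then show ?thesis using pos_le_divide_eq[OF p, of "z\<^sup>2" 1] by simp
    qed
    also have "\<dots> \<longleftrightarrow> z \<le> ?Y \<tau>" using z by (simp add: power2_le_iff_abs_le)
    finally show "L_profile q z (\<tau> * z\<^sup>2) \<longleftrightarrow> z \<le> ?Y \<tau>" .
  next
    fix z show "Measurable.pred borel (L_profile q z)" unfolding L_profile_def by measurable
  next
    show "?Y \<in> borel_measurable borel" by measurable
    show "?Y \<tau> \<ge> 0" for \<tau> by simp
  qed
  finally show ?thesis .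
qed

theorem theorem3p1:
  fixes k :: "'n::finite"
  assumes "CARD('n) \<ge> 3"
  shows "\<exists>(K :: (real^'n) set) (L :: (real^'n) set).
           convex_body K \<and> convex_body L \<and>
           0 \<in> interior K \<and> 0 \<in> interior L \<and>
           smooth_on_sphere (radial_fun K) \<and> smooth_on_sphere (radial_fun L) \<and>
           body_of_revolution (axis k 1) K \<and> body_of_revolution (axis k 1) L \<and>
           \<not> centrally_symmetric K \<and> origin_symmetric L \<and>
           (\<forall>u\<in>sphere 0 1. inner_section_fun K u = inner_section_fun L u)"
proof -
  have new: "\<exists>i. i \<notin> S" if "card S < CARD('n)" for S :: "'n set"
    using that by (metis UNIV_eq_I less_irrefl)
  \<comment> \<open>Three distinct coordinates are used: the axis k, the direction j of tilt, and i
    for the Brunn-Minkowski argument.\<close>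
  obtain j where j: "j \<noteq> k" using new[of "{k}"] assms by auto
  obtain i where ijk: "i \<noteq> k" "i \<noteq> j" using new[of "{k, j}"] assms j by auto
  define d where "d = CARD('n) - 2"
  obtain d' where d': "d = Suc d'" using assms by (cases d) (auto simp: d_def)
  obtain t1 e1 E where t1: "0 < t1" "t1 < 1/8" and e1: "0 < e1" "e1 < eps_max"
    and CE: "Cinf ({-1/4<..} \<times> {-e1<..<e1}) E"
    and E100: "\<And>\<sigma> e. \<sigma> > 100 \<Longrightarrow> \<bar>e\<bar> < e1 \<Longrightarrow> E (\<sigma>, e) = 0" and E0: "\<And>\<sigma>. \<sigma> > -1/4 \<Longrightarrow> E (\<sigma>, 0) = 0"
    and ET: "\<And>\<sigma> e. 0 \<le> \<sigma> \<Longrightarrow> \<sigma> \<le> 100 \<Longrightarrow> \<bar>e\<bar> < e1 \<Longrightarrow> \<exists>T. \<bar>T\<bar> < t1 \<and> K_vol d (\<sigma>, T, e) = ball_vol d \<sigma> 0 + E (\<sigma>, e) \<and>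
      (\<forall>t. 0 < \<sigma> \<and> \<bar>t\<bar> < t1 \<and> t \<noteq> T \<longrightarrow> K_vol d (\<sigma>, t, e) < K_vol d (\<sigma>, T, e))"
    by (rule exists_section_excess[of d]) (rule that)
  obtain e2 r where e2: "0 < e2" "e2 < e1" and Cr: "Cinf ({-1/8<..} \<times> {-e2<..<e2}) r"
    and r100: "\<And>\<tau> e. \<tau> > 100 \<Longrightarrow> \<bar>e\<bar> < e2 \<Longrightarrow> r (\<tau>, e) = 0" and r0: "\<And>\<tau>. \<tau> > -1/8 \<Longrightarrow> r (\<tau>, 0) = 0"
    and rpos: "\<And>\<tau> e. \<tau> > -1/8 \<Longrightarrow> \<bar>e\<bar> < e2 \<Longrightarrow> 1 + \<tau> + r (\<tau>, e) > 0"
    and rJ: "\<And>\<sigma> e. \<sigma> \<ge> 0 \<Longrightarrow> \<bar>e\<bar> < e2 \<Longrightarrow>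
      (nn_abel ^^ d) (\<lambda>\<tau>. ennreal ((if \<tau> > -1/8 then (1 + \<tau> + r (\<tau>, e)) powr (-1/2) else 0) ^ Suc d / Suc d)) \<sigma>
        = ennreal ((ball_vol d \<sigma> 0 + E (\<sigma>, e)) / 2) \<and> ball_vol d \<sigma> 0 + E (\<sigma>, e) \<ge> 0"
  proof (rule exists_L_radial_data[OF e1(1) CE])
    show "E (\<sigma>, e) = 0" if "\<sigma> > 100" "\<bar>e\<bar> < e1" for \<sigma> e by (rule E100[OF that])
    show "E (\<sigma>, 0) = 0" if "\<sigma> > -1/4" for \<sigma> by (rule E0[OF that])
  qed (rule that)
  let ?I = "{-e2<..<e2}"
  define ra where "ra x = ((norm x)\<^sup>2 - (x $ k)\<^sup>2) / (x $ k)\<^sup>2" for x :: "real^'n"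
  define R where "R p = (fst p $ k)\<^sup>2 * r (ra (fst p), snd p)" for p :: "(real^'n) \<times> real"
  have ra0: "ra x \<ge> 0" for x
    unfolding ra_def norm_sq_minus by (intro divide_nonneg_nonneg sum_nonneg) auto
  have hom: "R (c *\<^sub>R x, e) = c\<^sup>2 * R (x, e)" for c x e
  proof (cases "c = 0")
    case False
    then have "ra (c *\<^sub>R x) = ra x"
      by (simp add: ra_def power_mult_distrib right_diff_distrib[symmetric])
    then show ?thesis by (simp add: R_def power_mult_distrib)
  qed (simp add: R_def)
  have R0: "R (x, 0) = 0" for x using r0[of "ra x"] ra0[of x] by (simp add: R_def)
  have nthlin: "bounded_linear (\<lambda>p :: (real^'n) \<times> real. fst p $ k)"
    by (intro bounded_linear_compose[OF bounded_linear_nth] bounded_linear_fst)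
  \<comment> \<open>Off the hyperplane x_k = 0, on A, the quotient \<open>ra\<close> is smooth. Near
    that hyperplane, on B, it exceeds 100 wherever x_k \<noteq> 0, so R vanishes there.\<close>
  have CR: "Cinf ((-{0}) \<times> ?I) R"
  proof -
    define A where "A = {p :: (real^'n) \<times> real. fst p $ k \<noteq> 0} \<inter> UNIV \<times> ?I"
    define B where "B = {p :: (real^'n) \<times> real. 100 * (fst p $ k)\<^sup>2 < (norm (fst p))\<^sup>2 - (fst p $ k)\<^sup>2} \<inter> UNIV \<times> ?I"
    have oA: "open A" unfolding A_def
      by (intro open_Int open_Times open_Collect_neq continuous_intros) auto
    have oB: "open B" unfolding B_def
      by (intro open_Int open_Times open_Collect_less continuous_intros) auto
    have nk: "Cinf A (\<lambda>p. fst p $ k)" by (rule Cinf_linear[OF oA nthlin])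
    have nn: "Cinf A (\<lambda>p. (norm (fst p))\<^sup>2)" by (intro Cinf_norm_sq oA Cinf_linear bounded_linear_intros)
    have "Cinf A (\<lambda>p. ra (fst p))"
      unfolding ra_def by (intro Cinf_divide Cinf_diff Cinf_power nk nn) (auto simp: A_def)
    then have "Cinf A (\<lambda>p. r (ra (fst p), snd p))"
    proof (intro Cinf_compose_Pair[OF Cr oA])
      show "Cinf A (\<lambda>p. snd p \<bullet> c)" for c by (intro Cinf_linear oA bounded_linear_intros)
      show "(ra (fst p), snd p) \<in> {-1/8<..} \<times> ?I" if "p \<in> A" for p
        using that ra0[of "fst p"] by (auto simp: A_def)
    qed simp
    then have 1: "Cinf A R" unfolding R_def[abs_def] by (intro Cinf_mult Cinf_power nk)
    have 2: "Cinf B R"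
    proof (rule Cinf_cong[OF Cinf_const[OF oB, of 0]])
      fix p assume p: "p \<in> B"
      show "0 = R p"
      proof (cases "fst p $ k = 0")
        case False
        then have "ra (fst p) > 100" using p by (simp add: ra_def B_def pos_less_divide_eq)
        moreover have "\<bar>snd p\<bar> < e2" using p by (auto simp: B_def)
        ultimately show ?thesis using r100 by (simp add: R_def)
      qed (simp add: R_def)
    qed
    have "A \<union> B = (-{0}) \<times> ?I"
    proof (intro set_eqI iffI)
      fix p assume "p \<in> A \<union> B"
      then show "p \<in> (-{0}) \<times> ?I" by (cases p) (auto simp: A_def B_def)
    next
      fix p :: "(real^'n) \<times> real" assume p: "p \<in> (-{0}) \<times> ?I"
      then show "p \<in> A \<union> B" by (cases p) (auto simp: A_def B_def)
    qed
    then show ?thesis using Cinf_Un[OF 1 2] by simp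
  qed
  obtain e3 where e3: "e3 > 0" "e3 \<le> e2" and pert: "\<And>e. \<bar>e\<bar> < e3 \<Longrightarrow>
      (\<forall>x. \<bar>R (x, e)\<bar> \<le> (norm x)\<^sup>2 / 2) \<and> convex {x. (norm x)\<^sup>2 + R (x, e) \<le> 1}"
    using homogeneous_perturbation_convex[OF e2(1) CR hom R0] by blast
  define e where "e = e3 / 2"
  have e: "0 < e" "\<bar>e\<bar> < e3" "\<bar>e\<bar> < e2" "\<bar>e\<bar> < e1" "\<bar>e\<bar> < eps_max" "e \<in> ?I"
    using e3 e2 e1 by (auto simp: e_def)
  define K where "K = (rotbody k (K_profile e) :: (real^'n) set)"
  \<comment> \<open>Extension by 0 gives a measurable function on the line; points of the space have
    \<tau> \<ge> 0.\<close>
  define q where "q \<tau> = (if \<tau> > -1/8 then r (\<tau>, e) else 0)" for \<tau>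
  define L where "L = (rotbody k (L_profile q) :: (real^'n) set)"
  define Q where "Q x = (norm x)\<^sup>2 + R (x, e)" for x
  have bd: "\<bar>R (x, e)\<bar> \<le> (norm x)\<^sup>2 / 2" for x using pert[OF e(2)] by blast
  have qr: "q (ra x) = r (ra x, e)" for x using ra0[of x] by (simp add: q_def)
  have memL: "x \<in> L \<longleftrightarrow> Q x \<le> 1" for x
    unfolding L_def rotbody_def L_profile_def Q_def R_def by (simp add: ra_def[symmetric] qr)
  have qm [measurable]: "q \<in> borel_measurable borel"
  proof -
    have "continuous_on {-1/8<..} (\<lambda>\<tau>. r (\<tau>, e))"
      by (rule continuous_on_compose2[OF Cinf_continuous[OF Cr]]) (use e in \<open>auto intro!: continuous_intros\<close>)
    from borel_measurable_continuous_on_indicator[OF _ this]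
    have "(\<lambda>\<tau>. indicator {-1/8<..} \<tau> *\<^sub>R r (\<tau>, e)) \<in> borel_measurable borel" by simp
    moreover have "(\<lambda>\<tau>. indicator {-1/8<..} \<tau> *\<^sub>R r (\<tau>, e)) = q" by (auto simp: fun_eq_iff q_def)
    ultimately show ?thesis by simp
  qed
  have qpos: "1 + \<tau> + q \<tau> > 0" if "\<tau> \<ge> 0" for \<tau> using rpos[of \<tau> e] that e by (simp add: q_def)
  have Qh: "Q (c *\<^sub>R x) = c\<^sup>2 * Q x" for c x by (simp add: Q_def hom power_mult_distrib distrib_left)
  have Qlo: "(norm x)\<^sup>2 / 2 \<le> Q x" and Qhi: "Q x \<le> 3/2 * (norm x)\<^sup>2" for x
    using bd[of x] by (auto simp: Q_def abs_le_iff)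
  have CQ: "Cinf (-{0}) Q"
  proof -
    have o: "open (-{0 :: real^'n})" by auto
    have "Cinf (-{0}) (\<lambda>x. R (x, e))"
      by (rule Cinf_compose_Pair[OF CR o]) (use e in \<open>auto intro!: Cinf_linear Cinf_const bounded_linear_inner_left\<close>)
    moreover have "Cinf (-{0 :: real^'n}) (\<lambda>x. (norm x)\<^sup>2)"
      by (intro Cinf_norm_sq o Cinf_linear bounded_linear_inner_left)
    ultimately show ?thesis unfolding Q_def[abs_def] by (intro Cinf_add)
  qed
  \<comment> \<open>At the origin, where Q need not be smooth, continuity comes from the quadratic
    bound.\<close>
  have contQ: "continuous_on UNIV Q"
  proof -
    have "isCont Q x" for x
    proof (cases "x = 0")
      case True
      have "Q 0 = 0" using Qh[of 0 0] by simp
      have "isCont (\<lambda>x :: real^'n. 3/2 * (norm x)\<^sup>2) 0" by (intro continuous_intros)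
      then have lim: "((\<lambda>x :: real^'n. 3/2 * (norm x)\<^sup>2) \<longlongrightarrow> 0) (at 0)" by (simp add: isCont_def)
      have "norm (Q x) \<le> 3/2 * (norm x)\<^sup>2" for x
        using Qlo[of x] Qhi[of x] zero_le_power2[of "norm x"] unfolding real_norm_def by linarith
      then have "(Q \<longlongrightarrow> 0) (at 0)"
        by (intro Lim_null_comparison[OF always_eventually lim]) simp
      then show ?thesis using True \<open>Q 0 = 0\<close> by (simp add: isCont_def)
    next
      case False
      then show ?thesis using Cinf_continuous[OF CQ] continuous_on_eq_continuous_at[OF Cinf_open[OF CQ]] by blast
    qed
    then show ?thesis by (simp add: continuous_at_imp_continuous_on)
  qed
  have Leq: "L = {x. Q x \<le> 1}" using memL by blast
  have convL: "convex L" using pert[OF e(2)] by (simp add: Leq Q_def)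
  have compL: "compact L"
  proof (rule compact_subset_closed[OF _ compact_cball])
    show "closed L" unfolding Leq by (intro closed_Collect_le contQ continuous_intros)
    show "L \<subseteq> cball 0 2"
    proof
      fix x assume "x \<in> L"
      then have "(norm x)\<^sup>2 \<le> 2\<^sup>2" using Qlo[of x] by (simp add: memL)
      then have "norm x \<le> 2" by (rule power2_le_imp_le) simp
      then show "x \<in> cball 0 2" by simp
    qed
  qed
  have intL: "0 \<in> interior L"
  proof -
    have "ball 0 (1/2) \<subseteq> L"
    proof
      fix x :: "real^'n" assume "x \<in> ball 0 (1/2)"
      then have "(norm x)\<^sup>2 \<le> (1/2)\<^sup>2" by (intro power_mono) auto
      then show "x \<in> L" using Qhi[of x] by (simp add: memL power2_eq_square)
    qed
    then have "ball 0 (1/2) \<subseteq> interior L" by (rule interior_maximal) simp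
    then show ?thesis by (meson centre_in_ball subsetD zero_less_divide_1_iff zero_less_numeral)
  qed
  have radL: "smooth_on_sphere (radial_fun L)"
  proof -
    have Qpos: "Q x > 0" if "x \<noteq> 0" for x
      using Qlo[of x] that by (smt (verit) half_gt_zero zero_less_norm_iff zero_less_power)
    have "smooth_on (-{0}) (\<lambda>x. Q x powr (-1/2))"
      by (intro Cinf_imp_smooth_on Cinf_powr_compose CQ) (use Qpos in auto)
    moreover have "sphere 0 1 \<subseteq> (-{0} :: (real^'n) set)" by auto
    moreover have "Q x powr (-1/2) = radial_fun L x" if "x \<in> sphere 0 1" for x
    proof -
      have "x \<noteq> 0" using that by auto
      then have x: "Q x > 0" by (rule Qpos)
      define \<rho> where "\<rho> = Q x powr (-1/2)"
      have \<rho>: "\<rho> > 0" "\<rho>\<^sup>2 * Q x = 1"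
        using x by (simp_all add: \<rho>_def power2_eq_square powr_add[symmetric] powr_minus_divide)
      have "c *\<^sub>R x \<in> L \<longleftrightarrow> \<bar>c\<bar> \<le> \<rho>" for c
      proof -
        have "c *\<^sub>R x \<in> L \<longleftrightarrow> c\<^sup>2 * Q x \<le> \<rho>\<^sup>2 * Q x" by (simp add: memL Qh \<rho>)
        also have "\<dots> \<longleftrightarrow> \<bar>c\<bar> \<le> \<rho>" using x \<rho>(1) by (simp add: power2_le_iff_abs_le)
        finally show ?thesis .
      qed
      then have "Sup {c. c *\<^sub>R x \<in> L} = \<rho>" using \<rho>(1) by (intro cSup_eq_maximum) auto
      then show ?thesis by (simp add: radial_fun_def \<rho>_def)
    qed
    ultimately show ?thesis unfolding smooth_on_sphere_def by blast
  qed
  have symL: "origin_symmetric L"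
  proof -
    have "- x \<in> L \<longleftrightarrow> x \<in> L" for x using Qh[of "-1" x] by (simp add: memL)
    then show ?thesis unfolding origin_symmetric_def by (auto simp: image_iff) (metis minus_minus)
  qed
  have compK: "compact K" unfolding K_def by (rule compact_K_profile) (use e in simp)
  have convK: "convex K" unfolding K_def by (rule convex_K_profile[OF e(5)])
  have sect: "inner_section_fun K u = inner_section_fun L u" if u: "u \<in> sphere 0 1" for u
  proof (cases "\<bar>u $ k\<bar> = 1")
    case True
    have nu: "norm u = 1" using u by simp
    have "inner_section_fun K u = hyp_volume u (K \<inter> {x. x $ k = 0})"
      unfolding K_def
    proof (rule inner_section_fun_axis[OF compK[unfolded K_def] nu True])
      fix x :: "real^'n" assume x: "x \<in> rotbody k (K_profile e)"
      have "0 \<le> e * bump (x $ k)" using bump(2) e(1) by (intro mult_nonneg_nonneg) auto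
      moreover have "0 \<le> (x $ k)\<^sup>2" by simp
      ultimately have "(norm x)\<^sup>2 - (x $ k)\<^sup>2 \<le> 1" using x unfolding mem_K_profile by linarith
      then show "x - (x $ k) *\<^sub>R axis k 1 \<in> rotbody k (K_profile e)"
        unfolding proj_axis_mem using bump_zero[of 0] by (simp add: K_profile_def)
    qed
    moreover have "inner_section_fun L u = hyp_volume u (L \<inter> {x. x $ k = 0})"
      unfolding L_def
    proof (rule inner_section_fun_axis[OF compL[unfolded L_def] nu True])
      fix x :: "real^'n" assume x: "x \<in> rotbody k (L_profile q)"
      \<comment> \<open>The mirror image of x in the equator; the midpoint of both is the projection
        of x.\<close>
      define x' where "x' = x - (2 * x $ k) *\<^sub>R axis k 1"
      have x'k: "x' $ k = - x $ k" by (simp add: x'_def axis_def)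
      have "(\<Sum>i\<in>-{k}. (x' $ i)\<^sup>2) = (\<Sum>i\<in>-{k}. (x $ i)\<^sup>2)"
        by (intro sum.cong) (auto simp: x'_def axis_def)
      then have "x' \<in> rotbody k (L_profile q)" using x by (simp add: rotbody_def norm_sq_minus x'k L_profile_reflect)
      then have "(1 - 1/2) *\<^sub>R x + (1/2) *\<^sub>R x' \<in> rotbody k (L_profile q)"
        using convL x unfolding L_def by (intro convexD_alt) auto
      moreover have "(1 - 1/2) *\<^sub>R x + (1/2) *\<^sub>R x' = x - (x $ k) *\<^sub>R axis k 1"
        unfolding x'_def scaleR_diff_right scaleR_scaleR
        by (simp add: algebra_simps flip: scaleR_add_left)
      ultimately show "x - (x $ k) *\<^sub>R axis k 1 \<in> rotbody k (L_profile q)" by simp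
    qed
    moreover have "K \<inter> {x. x $ k = 0} = L \<inter> {x. x $ k = 0}"
      using bump_zero[of 0] by (auto simp: K_def L_def rotbody_def K_profile_def L_profile_def)
    ultimately show ?thesis by simp
  next
    case False
    have nu: "norm u = 1" using u by simp
    have uk: "\<bar>u $ k\<bar> < 1" using False component_le_norm_cart[of u k] nu by simp
    define sn where "sn = sqrt (1 - (u $ k)\<^sup>2)"
    have "(u $ k)\<^sup>2 < 1" using uk by (simp add: abs_square_less_1)
    then have sn: "sn > 0" by (simp add: sn_def)
    define \<beta> where "\<beta> = u $ k / sn"
    define \<sigma> where "\<sigma> = \<beta>\<^sup>2"
    have s0: "\<sigma> \<ge> 0" by (simp add: \<sigma>_def)
    obtain C where C: "C \<ge> 0" "\<And>P c. Measurable.pred (borel \<Otimes>\<^sub>M borel) (\<lambda>(z, a). P z a) \<Longrightarrow> compact (rotbody k P :: (real^'n) set) \<Longrightarrow>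
      hyp_volume u (rotbody k P \<inter> hyperplane_at u c) = C * enn2real (sec_vol d P (c / sn) \<beta>)"
      using hyp_volume_rotbody[OF j nu uk] unfolding d_def \<beta>_def sn_def by blast
    \<comment> \<open>The common value, attained by K at its critical height and by L at its
      centre.\<close>
    define M where "M = ball_vol d \<sigma> 0 + E (\<sigma>, e)"
    have M0: "M \<ge> 0" using rJ[OF s0 e(3)] by (simp add: M_def)
    have inner_section: "inner_section_fun (rotbody k P :: (real^'n) set) u = C * M"
      if P: "Measurable.pred (borel \<Otimes>\<^sub>M borel) (\<lambda>(z, a). P z a)" "compact (rotbody k P :: (real^'n) set)"
        and \<alpha>0: "sec_vol d P \<alpha>0 \<beta> = ennreal M" and le: "\<And>\<alpha>. sec_vol d P \<alpha> \<beta> \<le> sec_vol d P \<alpha>0 \<beta>" for P \<alpha>0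
    proof -
      have *: "hyp_volume u (rotbody k P \<inter> hyperplane_at u (\<alpha>0 * sn)) = C * M"
        using C(2)[OF P, of "\<alpha>0 * sn"] sn \<alpha>0 M0 by simp
      have "inner_section_fun (rotbody k P :: (real^'n) set) u = hyp_volume u (rotbody k P \<inter> hyperplane_at u (\<alpha>0 * sn))"
      proof (rule inner_section_fun_max)
        fix c
        have "enn2real (sec_vol d P (c / sn) \<beta>) \<le> enn2real (sec_vol d P \<alpha>0 \<beta>)"
          by (rule enn2real_mono[OF le]) (simp add: \<alpha>0)
        then have "enn2real (sec_vol d P (c / sn) \<beta>) \<le> M" using \<alpha>0 M0 by simp
        then show "hyp_volume u (rotbody k P \<inter> hyperplane_at u c) \<le> hyp_volume u (rotbody k P \<inter> hyperplane_at u (\<alpha>0 * sn))"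
          unfolding * C(2)[OF P, of c] using C(1) by (rule mult_left_mono)
      qed
      then show ?thesis using * by simp
    qed
    note qc = section_quasi_concave[OF _ j ijk, of _ _ d', folded d']
    have "inner_section_fun L u = C * M"
      unfolding L_def
    proof (rule inner_section[of _ 0])
      show Pm: "Measurable.pred (borel \<Otimes>\<^sub>M borel) (\<lambda>(z, a). L_profile q z a)" by measurable
      show "compact (rotbody k (L_profile q) :: (real^'n) set)" using compL by (simp add: L_def)
      have "sec_vol_at d (L_profile q) \<sigma> 0 = 2 * ennreal (M / 2)"
      proof -
        have 1: "sec_vol_at d (L_profile q) \<sigma> 0 = 2 * (nn_abel ^^ d) (\<lambda>\<tau>. ennreal ((if \<tau> > -1/8 then (1 + \<tau> + q \<tau>) powr (-1/2) else 0) ^ Suc d / Suc d)) \<sigma>"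
          by (rule sec_vol_at_L_profile[OF qm _ s0]) (rule qpos)
        have 2: "(\<lambda>\<tau>. ennreal ((if \<tau> > -1/8 then (1 + \<tau> + q \<tau>) powr (-1/2) else 0) ^ Suc d / Suc d))
          = (\<lambda>\<tau>. ennreal ((if \<tau> > -1/8 then (1 + \<tau> + r (\<tau>, e)) powr (-1/2) else 0) ^ Suc d / Suc d))"
          by (auto simp: fun_eq_iff q_def)
        show ?thesis
          unfolding 1 2 M_def using rJ[OF s0 e(3)] by (simp only:)
      qed
      also have "\<dots> = ennreal M" using M0 by (simp add: ennreal_mult'[symmetric] flip: ennreal_numeral)
      finally show "sec_vol d (L_profile q) 0 \<beta> = ennreal M" using sec_vol_sec_vol_at[of d "L_profile q" \<beta> 0] by (simp add: \<sigma>_def)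
      fix \<alpha>
      \<comment> \<open>The offsets \<alpha> and -\<alpha> give equal volumes and have 0 as
        midpoint, so quasi-concavity makes the central section maximal.\<close>
      have "min (sec_vol d (L_profile q) \<alpha> \<beta>) (sec_vol d (L_profile q) (- \<alpha>) \<beta>) \<le> sec_vol d (L_profile q) ((1 - 1/2) * \<alpha> + 1/2 * (- \<alpha>)) \<beta>"
        by (rule qc[OF Pm]) (use convL compL in \<open>auto simp: L_def\<close>)
      then show "sec_vol d (L_profile q) \<alpha> \<beta> \<le> sec_vol d (L_profile q) 0 \<beta>"
        using sec_vol_reflect[of "L_profile q" d \<alpha> \<beta>, OF Pm L_profile_reflect] by simp
    qed
    moreover have "inner_section_fun K u = C * M"
    proof -
      note Km = K_profile_measurable[of e]
      have qcK: "min (sec_vol d (K_profile e) \<alpha> \<beta>) (sec_vol d (K_profile e) \<alpha>' \<beta>) \<le> sec_vol d (K_profile e) ((1 - l) * \<alpha> + l * \<alpha>') \<beta>"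
        if "0 \<le> l" "l \<le> 1" for \<alpha> \<alpha>' l
        by (rule qc[OF Km]) (use convK compK that in \<open>auto simp: K_def\<close>)
      have "\<exists>\<alpha>0. sec_vol d (K_profile e) \<alpha>0 \<beta> = ennreal M \<and> (\<forall>\<alpha>. sec_vol d (K_profile e) \<alpha> \<beta> \<le> sec_vol d (K_profile e) \<alpha>0 \<beta>)"
      \<comment> \<open>Beyond 100 the local analysis is replaced by comparison with the ball, which
        contains K, has its maximal section at the centre, and shares that volume with K.\<close>
      proof (cases "\<sigma> > 100")
        case True
        then have b: "\<beta> \<noteq> 0" by (auto simp: \<sigma>_def)
        have sb: "sec_vol d P \<alpha> \<beta> = sec_vol_at d P \<sigma> (\<alpha> / \<beta>)" for P \<alpha>
          using sec_vol_sec_vol_at[of d P \<beta> "\<alpha> / \<beta>"] b by (simp add: \<sigma>_def)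
        have u0: "(\<sigma>, 0, e) \<in> K_dom" using s0 e by (auto simp: K_dom_def)
        have K0: "sec_vol_at d (K_profile e) \<sigma> 0 = ennreal M"
          using sec_vol_at_K_profile(1)[OF s0 _ e(5), of 0 d] K_corr_vanish[OF u0 True] E100[OF True e(4)] by (simp add: M_def)
        have B0: "sec_vol_at d ballP \<sigma> 0 = ennreal M"
          using sec_vol_at_ball[OF s0, of 0 d] E100[OF True e(4)] by (simp add: M_def)
        have "sec_vol_at d (K_profile e) \<sigma> t \<le> sec_vol_at d (K_profile e) \<sigma> 0" for t
        proof -
          have "sec_vol_at d (K_profile e) \<sigma> t \<le> sec_vol_at d ballP \<sigma> t"
          proof (rule sec_vol_at_mono)
            fix z a assume "K_profile e z a"
            moreover have "0 \<le> e * bump z" using bump(2) e(1) by (intro mult_nonneg_nonneg) auto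
            ultimately show "ballP z a" unfolding K_profile_def ballP_def by linarith
          qed
          also have "\<dots> \<le> sec_vol_at d ballP \<sigma> 0" by (rule sec_vol_at_ball_le[OF s0])
          finally show ?thesis using K0 B0 by simp
        qed
        then show ?thesis using K0 by (intro exI[of _ 0]) (simp add: sb)
      next
        case False
        then obtain T where T: "\<bar>T\<bar> < t1" "K_vol d (\<sigma>, T, e) = M"
          "\<And>t. 0 < \<sigma> \<Longrightarrow> \<bar>t\<bar> < t1 \<Longrightarrow> t \<noteq> T \<Longrightarrow> K_vol d (\<sigma>, t, e) < M"
          using ET[OF s0 _ e(4)] unfolding M_def by (metis not_le)
        have ST: "sec_vol_at d (K_profile e) \<sigma> t = ennreal (K_vol d (\<sigma>, t, e))" "K_vol d (\<sigma>, t, e) \<ge> 0" if "\<bar>t\<bar> < t1" for t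
          using sec_vol_at_K_profile[OF s0 _ e(5), of t d] that t1 by (auto simp: K_vol_def)
        show ?thesis
        \<comment> \<open>At \<beta> = 0 the offset \<alpha> is the signed distance from the axis
          and not a multiple of t; the volume is even in \<alpha>, and quasi-concavity
          suffices.\<close>
        proof (cases "\<beta> = 0")
          case True
          then have sz: "\<sigma> = 0" by (simp add: \<sigma>_def)
          have "sec_vol d (K_profile e) 0 \<beta> = ennreal M"
            using sec_vol_sec_vol_at[of d "K_profile e" \<beta> 0] sec_vol_at_zero[of d "K_profile e" T] ST(1)[OF T(1)] T(2) by (simp add: True sz)
          moreover have "sec_vol d (K_profile e) \<alpha> \<beta> \<le> sec_vol d (K_profile e) 0 \<beta>" for \<alpha>
          proof -
            have "sec_vol d (K_profile e) (- \<alpha>) \<beta> = sec_vol d (K_profile e) \<alpha> \<beta>" by (simp add: sec_vol_def True)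
            then show ?thesis using qcK[of "1/2" \<alpha> "- \<alpha>"] by simp
          qed
          ultimately show ?thesis by blast
        next
          case b: False
          have sp: "\<sigma> > 0" using b by (simp add: \<sigma>_def)
          have sb: "sec_vol d (K_profile e) (\<beta> * t) \<beta> = sec_vol_at d (K_profile e) \<sigma> t" for t
            by (simp add: sec_vol_sec_vol_at \<sigma>_def)
          have top: "sec_vol d (K_profile e) (\<beta> * T) \<beta> = ennreal M" using ST(1)[OF T(1)] T(2) by (simp add: sb)
          have "sec_vol d (K_profile e) \<alpha> \<beta> \<le> sec_vol d (K_profile e) (\<beta> * T) \<beta>" for \<alpha>
          proof (rule ccontr)
            assume "\<not> ?thesis"
            then have gt: "sec_vol d (K_profile e) (\<beta> * T) \<beta> < sec_vol d (K_profile e) \<alpha> \<beta>" by simp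
            define t' where "t' = \<alpha> / \<beta>"
            have \<alpha>: "\<alpha> = \<beta> * t'" using b by (simp add: t'_def)
            have ne: "t' \<noteq> T" using gt unfolding \<alpha> by auto
            \<comment> \<open>A step from T towards t' short enough to stay within |t| < t1. There
              quasi-concavity gives at least M, while strict local maximality gives less than
              M.\<close>
            define l where "l = min 1 ((t1 - \<bar>T\<bar>) / (2 * \<bar>t' - T\<bar>))"
            have l: "0 < l" "l \<le> 1" using ne T(1) by (auto simp: l_def)
            have "l * \<bar>t' - T\<bar> \<le> (t1 - \<bar>T\<bar>) / (2 * \<bar>t' - T\<bar>) * \<bar>t' - T\<bar>"
              by (intro mult_right_mono) (auto simp: l_def)
            also have "\<dots> = (t1 - \<bar>T\<bar>) / 2" using ne by simp
            finally have "\<bar>l * (t' - T)\<bar> < t1 - \<bar>T\<bar>" using l T(1) by (simp add: abs_mult)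
            then have t: "\<bar>T + l * (t' - T)\<bar> < t1" by linarith
            have "ennreal M = min (sec_vol d (K_profile e) (\<beta> * T) \<beta>) (sec_vol d (K_profile e) \<alpha> \<beta>)"
              using gt top by (simp add: min_absorb1 less_imp_le)
            also have "\<dots> \<le> sec_vol d (K_profile e) ((1 - l) * (\<beta> * T) + l * \<alpha>) \<beta>" using l by (intro qcK) auto
            also have "(1 - l) * (\<beta> * T) + l * \<alpha> = \<beta> * (T + l * (t' - T))" by (simp add: \<alpha> algebra_simps)
            also have "sec_vol d (K_profile e) \<dots> \<beta> = ennreal (K_vol d (\<sigma>, T + l * (t' - T), e))" using ST(1)[OF t] by (simp add: sb)
            finally have "M \<le> K_vol d (\<sigma>, T + l * (t' - T), e)" using ST(2)[OF t] by simp
            moreover have "K_vol d (\<sigma>, T + l * (t' - T), e) < M" using sp t ne l by (intro T(3)) auto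
            ultimately show False by simp
          qed
          then show ?thesis using top by blast
        qed
      qed
      then obtain \<alpha>0 where "sec_vol d (K_profile e) \<alpha>0 \<beta> = ennreal M" "\<And>\<alpha>. sec_vol d (K_profile e) \<alpha> \<beta> \<le> sec_vol d (K_profile e) \<alpha>0 \<beta>" by blast
      then show ?thesis unfolding K_def by (intro inner_section[OF Km]) (use compK in \<open>auto simp: K_def\<close>)
    qed
    ultimately show ?thesis by simp
  qed
  show ?thesis
  proof (rule exI[of _ K], rule exI[of _ L], intro conjI ballI)
    show "0 \<in> interior K" unfolding K_def by (rule interior_K_profile)
    then show "convex_body K" using compK convK by (auto simp: convex_body_def)
    show "convex_body L" using compL convL intL by (auto simp: convex_body_def)
    show "smooth_on_sphere (radial_fun K)" unfolding K_def by (rule radial_K_profile[OF e(5)])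
    show "body_of_revolution (axis k 1) K" "body_of_revolution (axis k 1) L"
      unfolding K_def L_def by (rule body_of_revolution_rotbody)+
    show "\<not> centrally_symmetric K" unfolding K_def by (rule not_centrally_symmetric_K_profile[OF e(1) j])
  qed (use intL radL symL sect in auto)
qed

end
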